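(* Every two-dimensional topological similarity class in $\mathrm{Aut}(\mathbb{QU}_{\prec})$ is meager in $\mathrm{Aut}(\mathbb{QU}_{\prec})\times\mathrm{Aut}(\mathbb{QU}_{\prec})$.
   Context: $\mathbb{QU}_{\prec}$ (the randomly ordered rational Urysohn space) is the Fraïssé limit of the class of all finite ordered metric spaces with rational distances, where an ordered metric space is a triple $(A,d,<)$ with $d$ a metric and $<$ an arbitrary linear order on $A$; equivalently, it is the unique countable ordered metric space with rational distances into which every finite ordered metric space with rational distances embeds (isometrically and order-preservingly) and in which every isometric order-preserving bijection between finite subsets extends to an automorphism. $\mathrm{Aut}(\mathbb{QU}_{\prec})$ is the group of order-preserving isometric bijections of $\mathbb{QU}_{\prec}$, with the topology of pointwise convergence ($\mathbb{QU}_{\prec}$ taken discrete). For a topological group $K$, a pair $(g_1,g_2)\in K^2$ is topologically similar to $(f_1,f_2)\in K^2$ if the map $g_i\mapsto f_i$ ($i=1,2$) extends to a group isomorphism $\langle g_1,g_2\rangle\to\langle f_1,f_2\rangle$ that is a homeomorphism with respect to the subspace topologies; its equivalence classes are the two-dimensional topological similarity classes. *)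

theory Defs
  imports "HOL-Analysis.Analysis"
begin

definition rat_metric_on :: "'b set \<Rightarrow> ('b \<Rightarrow> 'b \<Rightarrow> rat) \<Rightarrow> bool" where
  "rat_metric_on A d \<longleftrightarrow>
     (\<forall>x\<in>A. \<forall>y\<in>A. d x y \<ge> 0 \<and> (d x y = 0 \<longleftrightarrow> x = y) \<and> d x y = d y x) \<and>
     (\<forall>x\<in>A. \<forall>y\<in>A. \<forall>z\<in>A. d x z \<le> d x y + d y z)"

definition strict_linear_order_on :: "'b set \<Rightarrow> ('b \<Rightarrow> 'b \<Rightarrow> bool) \<Rightarrow> bool" where
  "strict_linear_order_on A lt \<longleftrightarrow>
     (\<forall>x\<in>A. \<not> lt x x) \<and>
     (\<forall>x\<in>A. \<forall>y\<in>A. \<forall>z\<in>A. lt x y \<and> lt y z \<longrightarrow> lt x z) \<and>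
     (\<forall>x\<in>A. \<forall>y\<in>A. x = y \<or> lt x y \<or> lt y x)"

definition ord_isom_on :: "'b set \<Rightarrow> ('b \<Rightarrow> 'b \<Rightarrow> rat) \<Rightarrow> ('b \<Rightarrow> 'b \<Rightarrow> bool)
      \<Rightarrow> ('c \<Rightarrow> 'c \<Rightarrow> rat) \<Rightarrow> ('c \<Rightarrow> 'c \<Rightarrow> bool) \<Rightarrow> ('b \<Rightarrow> 'c) \<Rightarrow> bool" where
  "ord_isom_on A d1 lt1 d2 lt2 e \<longleftrightarrow>
     (\<forall>x\<in>A. \<forall>y\<in>A. d2 (e x) (e y) = d1 x y \<and> (lt2 (e x) (e y) \<longleftrightarrow> lt1 x y))"

text \<open>Characterisation of the randomly ordered rational Urysohn space on the type 'a:
  a countable ordered metric space with rational distances into which every finite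
  ordered rational metric space embeds, and which is ultrahomogeneous.
  Finite ordered metric spaces are represented (up to isomorphism) on carriers {..<n}.\<close>
definition is_QU_prec :: "('a \<Rightarrow> 'a \<Rightarrow> rat) \<Rightarrow> ('a \<Rightarrow> 'a \<Rightarrow> bool) \<Rightarrow> bool" where
  "is_QU_prec d lt \<longleftrightarrow>
     countable (UNIV :: 'a set) \<and>
     rat_metric_on UNIV d \<and> strict_linear_order_on UNIV lt \<and>
     (\<forall>(n::nat) (d' :: nat \<Rightarrow> nat \<Rightarrow> rat) (lt' :: nat \<Rightarrow> nat \<Rightarrow> bool).
        rat_metric_on {..<n} d' \<and> strict_linear_order_on {..<n} lt' \<longrightarrow>
        (\<exists>e :: nat \<Rightarrow> 'a. inj_on e {..<n} \<and> ord_isom_on {..<n} d' lt' d lt e)) \<and>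
     (\<forall>(A :: 'a set) B p. finite A \<and> bij_betw p A B \<and> ord_isom_on A d lt d lt p \<longrightarrow>
        (\<exists>g. bij g \<and> ord_isom_on UNIV d lt d lt g \<and> (\<forall>x\<in>A. g x = p x)))"

definition Aut :: "('a \<Rightarrow> 'a \<Rightarrow> rat) \<Rightarrow> ('a \<Rightarrow> 'a \<Rightarrow> bool) \<Rightarrow> ('a \<Rightarrow> 'a) set" where
  "Aut d lt = {g. bij g \<and> ord_isom_on UNIV d lt d lt g}"

definition Aut_top :: "('a \<Rightarrow> 'a \<Rightarrow> rat) \<Rightarrow> ('a \<Rightarrow> 'a \<Rightarrow> bool) \<Rightarrow> ('a \<Rightarrow> 'a) topology" where
  "Aut_top d lt = subtopology (product_topology (\<lambda>_. discrete_topology (UNIV :: 'a set)) UNIV) (Aut d lt)"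

inductive_set gen2 :: "('a \<Rightarrow> 'a) \<Rightarrow> ('a \<Rightarrow> 'a) \<Rightarrow> ('a \<Rightarrow> 'a) set" for g1 g2 where
  gen2_id: "id \<in> gen2 g1 g2"
| gen2_g1: "g1 \<in> gen2 g1 g2"
| gen2_g2: "g2 \<in> gen2 g1 g2"
| gen2_comp: "a \<in> gen2 g1 g2 \<Longrightarrow> b \<in> gen2 g1 g2 \<Longrightarrow> a \<circ> b \<in> gen2 g1 g2"
| gen2_inv: "a \<in> gen2 g1 g2 \<Longrightarrow> inv a \<in> gen2 g1 g2"

definition top_similar :: "('a \<Rightarrow> 'a) topology \<Rightarrow> ('a \<Rightarrow> 'a) \<Rightarrow> ('a \<Rightarrow> 'a) \<Rightarrow> ('a \<Rightarrow> 'a) \<Rightarrow> ('a \<Rightarrow> 'a) \<Rightarrow> bool" where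
  "top_similar T g1 g2 f1 f2 \<longleftrightarrow>
     (\<exists>\<phi>. bij_betw \<phi> (gen2 g1 g2) (gen2 f1 f2) \<and>
          (\<forall>a\<in>gen2 g1 g2. \<forall>b\<in>gen2 g1 g2. \<phi> (a \<circ> b) = \<phi> a \<circ> \<phi> b) \<and>
          \<phi> g1 = f1 \<and> \<phi> g2 = f2 \<and>
          homeomorphic_map (subtopology T (gen2 g1 g2)) (subtopology T (gen2 f1 f2)) \<phi>)"

definition nowhere_dense_in :: "'b topology \<Rightarrow> 'b set \<Rightarrow> bool" where
  "nowhere_dense_in X N \<longleftrightarrow> N \<subseteq> topspace X \<and> X interior_of (X closure_of N) = {}"

definition meager_in :: "'b topology \<Rightarrow> 'b set \<Rightarrow> bool" where
  "meager_in X M \<longleftrightarrow> M \<subseteq> topspace X \<and>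
     (\<exists>\<F>. countable \<F> \<and> (\<forall>N\<in>\<F>. nowhere_dense_in X N) \<and> M \<subseteq> \<Union>\<F>)"

end

theory Submission
  imports Defs
begin

text \<open>Write \<open>\<langle>g\<rangle>\<close> for the group generated by the pair \<open>(g1, g2)\<close>; words are evaluated at pairs.

  If \<open>\<langle>g\<rangle>\<close> is not discrete, then for every finite set \<open>A\<close> some nontrivial reduced word \<open>w\<close> satisfies
  \<open>w(g)|A = id\<close>. A similar pair \<open>f\<close> with \<open>f1 x \<noteq> x\<close> admits an \<open>A\<close> such that \<open>w(g)|A = id\<close> always implies
  \<open>w(f) x = x\<close>. Such pairs are nowhere dense: follow the \<open>f1\<close>-orbit of \<open>x\<close> (which is infinite because of the
  order) to a point \<open>u x\<close> where the finite approximation is undefined, take a reduced \<open>w\<close> with \<open>w(g)\<close> trivial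
  on \<open>u(g) A\<close>, extend the approximation freely along \<open>w\<close>, and use the word \<open>u\<inverse> w u\<close>.

  If \<open>\<langle>g\<rangle>\<close> is discrete and \<open>g1 \<noteq> id\<close>, then every similar pair \<open>f\<close> admits a finite \<open>B\<close> such that \<open>f1\<close> never
  fixes \<open>w(f) B\<close> pointwise. To see that such pairs are nowhere dense, extend the two partial automorphisms
  to automorphisms \<open>f1\<close>, \<open>f2\<close> with finite fixed point sets \<open>A1\<close>, \<open>A2\<close> whose large powers move every point
  metrically as far as possible from any given finite set over the fixed points, and monotonically towards the
  next fixed point. Alternating powers of \<open>f1\<close> and \<open>f2\<close> then moves \<open>B\<close> to a set \<open>N\<close> that is, over
  \<open>Z = A1 \<inter> A2\<close>, independent both in the metric and in the order from all points at which \<open>f1\<close> has been used.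
  Hence \<open>f1\<close> can be replaced by a partial automorphism fixing \<open>N\<close> pointwise.\<close>

subsection \<open>Automorphisms and the extension property\<close>


text \<open>In the discrete case the obstacle is that no power carries a point across a fixed point,
  and common fixed points are fixed by every word. So independence is possible only over
  \<open>Z\<close>. In the order, a fixed point of one automorphism is passed with the help of the
  other. In the metric, a path that avoids \<open>Z\<close> has to switch between \<open>A1\<close>
  and \<open>A2\<close>; each switch costs a fixed positive amount, whereas distances to
  \<open>Z\<close> never change, so after enough alternations a shortest path runs through
  \<open>Z\<close>. One word has to do this for all points of \<open>B\<close> at once. This is why
  directions are prescribed on the gaps next to \<open>Z\<close>: there both automorphisms move
  towards \<open>Z\<close>, and a position gained near the end of an interval of \<open>Z\<close> is
  kept by all further powers. The last power is one of \<open>f2\<close>, so that a change of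
  \<open>f1\<close> on \<open>N\<close> leaves the word leading to \<open>N\<close> intact.
  Meagerness comes from counting: the nowhere dense sets are indexed by finite sets and points of a
  countable space, apart from the pairs with \<open>f1 = id\<close>, which form one more nowhere
  dense set.\<close>

lemma strict_linear_order_on_dual:
  "strict_linear_order_on A (\<lambda>x y. r y x) \<longleftrightarrow> strict_linear_order_on A r"
proof -
  have "strict_linear_order_on A (\<lambda>x y. r y x)" if "strict_linear_order_on A r" for r
    using that unfolding strict_linear_order_on_def by fast
  from this[of r] this[of "\<lambda>x y. r y x"] show ?thesis by blast
qed

lemma ord_isom_on_dual:
  "ord_isom_on A d1 (\<lambda>x y. lt1 y x) d2 (\<lambda>x y. lt2 y x) e \<longleftrightarrow> ord_isom_on A d1 lt1 d2 lt2 e"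
  unfolding ord_isom_on_def by auto

locale QU =
  fixes d :: "'a \<Rightarrow> 'a \<Rightarrow> rat" and lt :: "'a \<Rightarrow> 'a \<Rightarrow> bool" (infix "\<sqsubset>" 50)
  assumes QU: "is_QU_prec d lt"
begin

lemma countable_UNIV: "countable (UNIV :: 'a set)"
  and metric: "rat_metric_on UNIV d"
  and order: "strict_linear_order_on UNIV lt"
  and universal: "\<And>n d' lt'. rat_metric_on {..<n::nat} d' \<Longrightarrow> strict_linear_order_on {..<n} lt' \<Longrightarrow>
        \<exists>e :: nat \<Rightarrow> 'a. inj_on e {..<n} \<and> ord_isom_on {..<n} d' lt' d lt e"
  and homogeneous: "\<And>A B p. finite A \<Longrightarrow> bij_betw p A B \<Longrightarrow> ord_isom_on A d lt d lt p \<Longrightarrow>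
        \<exists>g. bij g \<and> ord_isom_on UNIV d lt d lt g \<and> (\<forall>x\<in>A. g x = p x)"
  using QU unfolding is_QU_prec_def by auto

definition le (infix "\<sqsubseteq>" 50) where "x \<sqsubseteq> y \<longleftrightarrow> x = y \<or> x \<sqsubset> y"

lemma lt_irrefl: "\<not> x \<sqsubset> x" and lt_trans: "x \<sqsubset> y \<Longrightarrow> y \<sqsubset> z \<Longrightarrow> x \<sqsubset> z"
  and lt_total: "x = y \<or> x \<sqsubset> y \<or> y \<sqsubset> x"
  using order unfolding strict_linear_order_on_def by (simp, metis UNIV_I, metis UNIV_I)

sublocale linorder le lt
proof
  fix x y z
  show "x \<sqsubset> y \<longleftrightarrow> x \<sqsubseteq> y \<and> \<not> y \<sqsubseteq> x"
    unfolding le_def using lt_irrefl lt_trans by metis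
  show "x \<sqsubseteq> x" by (simp add: le_def)
  show "x \<sqsubseteq> y \<Longrightarrow> y \<sqsubseteq> x \<Longrightarrow> x = y"
    unfolding le_def using lt_irrefl lt_trans by metis
  show "x \<sqsubseteq> y \<or> y \<sqsubseteq> x"
    unfolding le_def using lt_total by metis
  show "x \<sqsubseteq> y \<Longrightarrow> y \<sqsubseteq> z \<Longrightarrow> x \<sqsubseteq> z"
    unfolding le_def using lt_trans by metis
qed

text \<open>Statements on upward slides are transferred to downward slides through this instance
  instead of being proved twice.\<close>

lemma dual: "QU d (\<lambda>x y. y \<sqsubset> x)"
  unfolding QU_def is_QU_prec_def
proof (intro conjI allI impI)
  fix n :: nat and d' lt'
  assume "rat_metric_on {..<n} d' \<and> strict_linear_order_on {..<n} lt'"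
  then show "\<exists>e. inj_on e {..<n} \<and> ord_isom_on {..<n} d' lt' d (\<lambda>x y. y \<sqsubset> x) e"
    using universal[of n d' "\<lambda>x y. lt' y x"] ord_isom_on_dual[of _ d' "\<lambda>x y. lt' y x" d lt] strict_linear_order_on_dual[of "{..<n}" lt'] by simp
next
  fix A B :: "'a set" and p
  assume "finite A \<and> bij_betw p A B \<and> ord_isom_on A d (\<lambda>x y. y \<sqsubset> x) d (\<lambda>x y. y \<sqsubset> x) p"
  then show "\<exists>g. bij g \<and> ord_isom_on UNIV d (\<lambda>x y. y \<sqsubset> x) d (\<lambda>x y. y \<sqsubset> x) g \<and> (\<forall>x\<in>A. g x = p x)"
    using homogeneous[of A p B] ord_isom_on_dual[of _ d lt d lt] by simp
qed (simp_all add: countable_UNIV metric order strict_linear_order_on_dual[of UNIV lt])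

lemma le_dual: "QU.le (\<lambda>x y. y \<sqsubset> x) x y \<longleftrightarrow> y \<sqsubseteq> x"
  using QU.le_def[OF dual] le_def by auto

abbreviation "G \<equiv> Aut d lt"

lemma d_nonneg [simp]: "0 \<le> d x y" and d_eq_0 [simp]: "d x y = 0 \<longleftrightarrow> x = y"
  and d_sym: "d x y = d y x" and d_triangle: "d x z \<le> d x y + d y z"
  using metric unfolding rat_metric_on_def by auto

lemma d_self [simp]: "d x x = 0"
  by simp

lemma d_pos [simp]: "0 < d x y \<longleftrightarrow> x \<noteq> y"
  using d_nonneg[of x y] d_eq_0[of x y] by linarith

lemma Aut_bij: "g \<in> G \<Longrightarrow> bij g"
  and Aut_d [simp]: "g \<in> G \<Longrightarrow> d (g x) (g y) = d x y"
  and Aut_lt [simp]: "g \<in> G \<Longrightarrow> g x \<sqsubset> g y \<longleftrightarrow> x \<sqsubset> y"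
  unfolding Aut_def ord_isom_on_def by auto

lemma Aut_eq [simp]: "g \<in> G \<Longrightarrow> g x = g y \<longleftrightarrow> x = y"
  using Aut_bij bij_is_inj inj_eq by metis

lemma Aut_le [simp]: "g \<in> G \<Longrightarrow> g x \<sqsubseteq> g y \<longleftrightarrow> x \<sqsubseteq> y"
  by (simp add: le_def)

lemma AutI:
  assumes "surj g" "\<And>x y. d (g x) (g y) = d x y" "\<And>x y. g x \<sqsubset> g y \<longleftrightarrow> x \<sqsubset> y"
  shows "g \<in> G"
proof -
  have "inj g"
    by (rule injI) (metis assms(2) d_eq_0)
  then show ?thesis
    using assms unfolding Aut_def ord_isom_on_def bij_def by simp
qed

lemma Aut_inv_f [simp]: "g \<in> G \<Longrightarrow> inv g (g x) = x"
  and Aut_f_inv [simp]: "g \<in> G \<Longrightarrow> g (inv g x) = x"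
  using Aut_bij by (simp_all add: bij_is_inj bij_is_surj surj_f_inv_f)

lemma Aut_id [simp]: "id \<in> G"
  by (rule AutI) auto

lemma Aut_comp [simp]: "f \<in> G \<Longrightarrow> g \<in> G \<Longrightarrow> f \<circ> g \<in> G"
  by (rule AutI) (use comp_surj[of g f] in \<open>auto simp: Aut_bij bij_is_surj\<close>)

lemma Aut_inv [simp]:
  assumes "g \<in> G" shows "inv g \<in> G"
proof (rule AutI)
  show "surj (inv g)"
    using assms by (simp add: Aut_bij bij_imp_bij_inv bij_is_surj)
  fix x y
  show "d (inv g x) (inv g y) = d x y"
    using Aut_d[OF assms, of "inv g x" "inv g y"] assms by simp
  show "inv g x \<sqsubset> inv g y \<longleftrightarrow> x \<sqsubset> y"
    using Aut_lt[OF assms, of "inv g x" "inv g y"] assms by simp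
qed

lemma Aut_inv_inv [simp]: "g \<in> G \<Longrightarrow> inv (inv g) = g"
  by (simp add: Aut_bij inv_inv_eq)

lemma Aut_funpow [simp]: "g \<in> G \<Longrightarrow> g ^^ k \<in> G"
  by (induction k) (auto simp del: comp_apply)

lemma Aut_dual: "Aut d (\<lambda>x y. y \<sqsubset> x) = G"
  unfolding Aut_def using ord_isom_on_dual[of UNIV d lt d lt] by auto

section \<open>Partial automorphisms and one-point types\<close>

lemma extend_partial:
  assumes "finite D" "\<And>x y. x \<in> D \<Longrightarrow> y \<in> D \<Longrightarrow> d (p x) (p y) = d x y"
    "\<And>x y. x \<in> D \<Longrightarrow> y \<in> D \<Longrightarrow> x \<sqsubset> y \<Longrightarrow> p x \<sqsubset> p y"
  obtains g where "g \<in> G" "\<And>x. x \<in> D \<Longrightarrow> g x = p x"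
proof -
  have "inj_on p D"
    by (rule inj_onI) (metis assms(2) d_eq_0)
  then have "bij_betw p D (p ` D)"
    by (rule inj_on_imp_bij_betw)
  moreover have "p x \<sqsubset> p y \<longleftrightarrow> x \<sqsubset> y" if "x \<in> D" "y \<in> D" for x y
    using assms(3)[OF that] assms(3)[OF that(2,1)] lt_total[of x y] lt_irrefl lt_trans by metis
  then have "ord_isom_on D d lt d lt p"
    unfolding ord_isom_on_def using assms by blast
  ultimately show ?thesis
    using homogeneous[of D p "p ` D"] assms(1) that unfolding Aut_def by blast
qed

text \<open>One-point extension property. \<open>K1\<close> and \<open>K2\<close> say that
  \<open>\<phi>\<close> is a Katetov function and \<open>L\<close> that \<open>P\<close> is a cut,
  so adding a point with these data to \<open>S\<close> gives a finite ordered metric space.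
  Universality embeds a copy of it, and homogeneity moves the copy of \<open>S\<close> back onto
  \<open>S\<close>.\<close>

lemma realize_type:
  fixes \<phi> :: "'a \<Rightarrow> rat"
  assumes S: "finite S" and pos: "\<And>s. s \<in> S \<Longrightarrow> 0 < \<phi> s"
    and K1: "\<And>s t. s \<in> S \<Longrightarrow> t \<in> S \<Longrightarrow> \<phi> s \<le> \<phi> t + d t s"
    and K2: "\<And>s t. s \<in> S \<Longrightarrow> t \<in> S \<Longrightarrow> d s t \<le> \<phi> s + \<phi> t"
    and L: "\<And>s t. s \<in> S \<Longrightarrow> t \<in> S \<Longrightarrow> s \<sqsubset> t \<Longrightarrow> P t \<Longrightarrow> P s"
  obtains y where "\<And>s. s \<in> S \<Longrightarrow> d y s = \<phi> s" "\<And>s. s \<in> S \<Longrightarrow> s \<sqsubset> y \<longleftrightarrow> P s" "y \<notin> S"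
proof -
  define n where "n = card S"
  obtain e0 where e0: "bij_betw e0 {..<n} S"
    using ex_bij_betw_nat_finite[OF S] unfolding n_def atLeast0LessThan by blast
  have e0S: "e0 i \<in> S" if "i < n" for i
    using e0 that bij_betwE by blast
  have e0i: "e0 i = e0 j \<longleftrightarrow> i = j" if "i < n" "j < n" for i j
    using bij_betw_imp_inj_on[OF e0] that by (simp add: inj_on_eq_iff)
  \<comment> \<open>The index \<open>n\<close> is the new point and \<open>{..<n}\<close> is
    \<open>S\<close>. The diagonal is tested first, so the arbitrary value
    \<open>\<phi> (e0 n)\<close> never enters.\<close>
  define d' where "d' i j = (if i = j then 0 else if i = n then \<phi> (e0 j) else if j = n then \<phi> (e0 i) else d (e0 i) (e0 j))" for i j
  define lt' where "lt' i j = (if i = n then j \<noteq> n \<and> \<not> P (e0 j) else if j = n then P (e0 i) else e0 i \<sqsubset> e0 j)" for i j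
  have lessE: "i < Suc n \<longleftrightarrow> i = n \<or> i < n" for i by auto
  have K: "0 \<le> \<phi> (e0 i)" if "i < n" for i
    using pos[OF e0S[OF that]] by simp
  have K': "\<phi> (e0 i) \<le> d (e0 i) (e0 j) + \<phi> (e0 j)" "\<phi> (e0 j) \<le> \<phi> (e0 i) + d (e0 i) (e0 j)"
    and K'': "d (e0 i) (e0 j) \<le> \<phi> (e0 i) + \<phi> (e0 j)" if "i < n" "j < n" for i j
    using K1[of "e0 i" "e0 j"] K1[of "e0 j" "e0 i"] K2[of "e0 i" "e0 j"] e0S that d_sym[of "e0 i" "e0 j"]
    by (auto simp: add.commute)
  have "rat_metric_on {..<Suc n} d'"
    unfolding rat_metric_on_def
  proof (intro conjI ballI)
    fix x y assume "x \<in> {..<Suc n}" "y \<in> {..<Suc n}"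
    then have xy: "x = n \<or> x < n" "y = n \<or> y < n" by auto
    show "0 \<le> d' x y" "d' x y = 0 \<longleftrightarrow> x = y" "d' x y = d' y x"
      using xy pos e0S unfolding d'_def by (force simp: e0i d_sym less_imp_le)+
    fix z assume "z \<in> {..<Suc n}"
    then have z: "z = n \<or> z < n" by auto
    show "d' x z \<le> d' x y + d' y z"
      using xy z d_triangle[of "e0 x" "e0 z" "e0 y"] K[of x] K[of y] K[of z] K'[of x y] K'[of y z] K''[of x z]
      unfolding d'_def by auto
  qed
  moreover have "strict_linear_order_on {..<Suc n} lt'"
    unfolding strict_linear_order_on_def
  proof (intro conjI ballI impI)
    fix x assume x: "x \<in> {..<Suc n}"
    show "\<not> lt' x x" by (auto simp: lt'_def)
    fix y assume y: "y \<in> {..<Suc n}"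
    show "x = y \<or> lt' x y \<or> lt' y x"
      using lt_total[of "e0 x" "e0 y"] e0i[of x y] x y lessE unfolding lt'_def by auto
    fix z assume z: "z \<in> {..<Suc n}" and a: "lt' x y \<and> lt' y z"
    have S: "e0 i \<in> S" if "i \<in> {..<Suc n}" "i \<noteq> n" for i
      using e0S that lessE by auto
    show "lt' x z"
      using L[of "e0 x" "e0 y"] L[of "e0 y" "e0 z"] lt_trans[of "e0 x" "e0 y" "e0 z"]
        L[of "e0 z" "e0 x"] lt_total[of "e0 z" "e0 x"] a S[OF x] S[OF y] S[OF z]
      unfolding lt'_def by (auto split: if_splits)
  qed
  ultimately obtain e :: "nat \<Rightarrow> 'a" where e: "inj_on e {..<Suc n}" "ord_isom_on {..<Suc n} d' lt' d lt e"
    using universal by blast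
  have ed: "d (e i) (e j) = d' i j" "e i \<sqsubset> e j \<longleftrightarrow> lt' i j" if "i < Suc n" "j < Suc n" for i j
    using e(2) that unfolding ord_isom_on_def by auto
  define p where "p s = e (inv_into {..<n} e0 s)" for s
  have inv: "inv_into {..<n} e0 s < n" "e0 (inv_into {..<n} e0 s) = s" if "s \<in> S" for s
    using e0 that bij_betw_inv_into_right[OF e0 that] inv_into_into[of s e0 "{..<n}"]
    unfolding bij_betw_def by auto
  obtain g where g: "g \<in> G" "\<And>s. s \<in> S \<Longrightarrow> g s = p s"
  proof (rule extend_partial[OF S, of p])
    fix x y assume xy: "x \<in> S" "y \<in> S"
    obtain i j where ij: "p x = e i" "i < n" "e0 i = x" "p y = e j" "j < n" "e0 j = y" "i = j \<longleftrightarrow> x = y"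
      using inv[OF xy(1)] inv[OF xy(2)] unfolding p_def by metis
    show "d (p x) (p y) = d x y" "x \<sqsubset> y \<Longrightarrow> p x \<sqsubset> p y"
      using ij ed[of i j] by (auto simp: d'_def lt'_def)
  qed blast
  define y where "y = inv g (e n)"
  have gy: "g y = e n" using g(1) by (simp add: y_def)
  have 1: "d y s = \<phi> s" "s \<sqsubset> y \<longleftrightarrow> P s" if sS: "s \<in> S" for s
  proof -
    have "d y s = d (e n) (p s)" "s \<sqsubset> y \<longleftrightarrow> p s \<sqsubset> e n"
      using g gy that Aut_d[OF g(1), of y s] Aut_lt[OF g(1), of s y] by auto
    moreover obtain i where "p s = e i" "i < n" "e0 i = s"
      using inv[OF sS] unfolding p_def by metis
    ultimately show "d y s = \<phi> s" "s \<sqsubset> y \<longleftrightarrow> P s"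
      using ed[of n i] ed[of i n] by (auto simp: d'_def lt'_def)
  qed
  have 2: "y \<notin> S"
    using 1(1)[of y] pos[of y] by auto
  show ?thesis
    by (rule that[OF 1 2])
qed

end

subsection \<open>Free one-point extensions and slides\<close>

context QU begin

text \<open>The new value lies in the free amalgam over \<open>D\<close>: \<open>\<phi> s\<close> is
  the length of a shortest path that goes from \<open>h\<close> to some \<open>c\<close> in
  \<open>D\<close> and continues from \<open>g c\<close> to \<open>s\<close>, the largest value that
  the triangle inequality allows, and \<open>P\<close> is the highest cut compatible with
  \<open>g\<close> on \<open>D\<close>. The conclusions name the point of \<open>D\<close>
  responsible for each constraint.\<close>

lemma free_step_up:
  assumes g: "g \<in> G" and D: "finite D" "D \<noteq> {}" and S: "finite S" "D \<subseteq> S" "g ` D \<subseteq> S" and h: "h \<notin> D"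
  obtains g' where "g' \<in> G" "\<And>c. c \<in> D \<Longrightarrow> g' c = g c"
    "\<And>s. s \<in> S \<Longrightarrow> \<exists>c\<in>D. d h c + d (g c) s \<le> d (g' h) s"
    "\<And>s. s \<in> S \<Longrightarrow> g' h \<sqsubseteq> s \<Longrightarrow> \<exists>c\<in>D. h \<sqsubset> c \<and> g c \<sqsubseteq> s"
    "g' h \<notin> S"
proof -
  \<comment> \<open>\<open>linorder_class.Min\<close> is the minimum of rationals; inside the
    locale, plain \<open>Min\<close> belongs to the order on points.\<close>
  define \<phi> where "\<phi> s = linorder_class.Min ((\<lambda>c. d h c + d (g c) s) ` D)" for s
  define P where "P s \<longleftrightarrow> \<not> (\<exists>c\<in>D. h \<sqsubset> c \<and> g c \<sqsubseteq> s)" for s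
  have att: "\<exists>c\<in>D. \<phi> s = d h c + d (g c) s" for s
  proof -
    have "\<phi> s \<in> (\<lambda>c. d h c + d (g c) s) ` D"
      unfolding \<phi>_def by (rule linorder_class.Min_in) (use D in auto)
    then show ?thesis by auto
  qed
  have low: "\<phi> s \<le> d h c + d (g c) s" if "c \<in> D" for c s
    using D that unfolding \<phi>_def by auto
  obtain y where y: "\<And>s. s \<in> S \<Longrightarrow> d y s = \<phi> s" "\<And>s. s \<in> S \<Longrightarrow> s \<sqsubset> y \<longleftrightarrow> P s" "y \<notin> S"
  proof (rule realize_type[OF S(1), of \<phi> P])
    fix s t
    obtain c where c: "c \<in> D" "\<phi> s = d h c + d (g c) s" using att by blast
    then have "0 < d h c" using h by auto
    then show "0 < \<phi> s" using c d_nonneg[of "g c" s] by linarith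
    obtain c' where c': "c' \<in> D" "\<phi> t = d h c' + d (g c') t" using att by blast
    show "\<phi> s \<le> \<phi> t + d t s"
      using low[OF c'(1), of s] c' d_triangle[of "g c'" s t] by linarith
    have "d s t \<le> d s (g c) + d (g c) (g c') + d (g c') t"
      using d_triangle[of s t "g c"] d_triangle[of "g c" t "g c'"] by linarith
    then show "d s t \<le> \<phi> s + \<phi> t"
      using c c' g d_triangle[of c c' h] d_sym[of s "g c"] d_sym[of c h] by simp
    show "s \<sqsubset> t \<Longrightarrow> P t \<Longrightarrow> P s"
      unfolding P_def by (meson less_imp_le order_trans)
  qed auto
  define p where "p = g(h := y)"
  have dp: "d y (g c) = d h c" if "c \<in> D" for c
  proof -
    have "g c \<in> S" using S that by auto
    obtain c' where c': "c' \<in> D" "\<phi> (g c) = d h c' + d (g c') (g c)" using att by blast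
    then have "d h c \<le> \<phi> (g c)" using g d_triangle[of h c c'] by simp
    moreover have "\<phi> (g c) \<le> d h c" using low[OF that, of "g c"] by simp
    ultimately show ?thesis using y(1)[OF \<open>g c \<in> S\<close>] by simp
  qed
  have lp: "h \<sqsubset> c \<Longrightarrow> y \<sqsubset> g c" "c \<sqsubset> h \<Longrightarrow> g c \<sqsubset> y" if "c \<in> D" for c
  proof -
    have gc: "g c \<in> S" using S that by auto
    show "y \<sqsubset> g c" if "h \<sqsubset> c"
    proof -
      have "\<not> P (g c)" unfolding P_def using that \<open>c \<in> D\<close> by auto
      then show ?thesis using y(2)[OF gc] y(3) gc lt_total[of y "g c"] by auto
    qed
    show "g c \<sqsubset> y" if "c \<sqsubset> h"
    proof -
      have "P (g c)" unfolding P_def using that g by auto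
      then show ?thesis using y(2)[OF gc] by auto
    qed
  qed
  obtain g' where g': "g' \<in> G" "\<And>c. c \<in> insert h D \<Longrightarrow> g' c = p c"
  proof (rule extend_partial[of "insert h D" p])
    fix a b assume ab: "a \<in> insert h D" "b \<in> insert h D"
    show "d (p a) (p b) = d a b" using ab h g dp d_sym unfolding p_def by auto
    show "a \<sqsubset> b \<Longrightarrow> p a \<sqsubset> p b" using ab h g lp unfolding p_def by auto
  qed (use D in auto)
  have "g' h = y" using g' by (auto simp: p_def)
  show ?thesis
  proof (rule that[OF g'(1)])
    show "g' c = g c" if "c \<in> D" for c using that h g'(2)[of c] by (auto simp: p_def)
    show "\<exists>c\<in>D. d h c + d (g c) s \<le> d (g' h) s" if "s \<in> S" for s
      using att[of s] y(1)[OF that] \<open>g' h = y\<close> by auto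
    show "\<exists>c\<in>D. h \<sqsubset> c \<and> g c \<sqsubseteq> s" if "s \<in> S" "g' h \<sqsubseteq> s" for s
      using y(2)[OF that(1)] y(3) that \<open>g' h = y\<close> unfolding P_def by auto
    show "g' h \<notin> S" using y(3) \<open>g' h = y\<close> by simp
  qed
qed

section \<open>Gaps of a fixed point set and directions of motion\<close>

definition separated where
  "separated A x y \<longleftrightarrow> (\<exists>\<alpha>\<in>A. x \<sqsubset> \<alpha> \<and> \<alpha> \<sqsubset> y \<or> y \<sqsubset> \<alpha> \<and> \<alpha> \<sqsubset> x)"

text \<open>\<open>Up\<close> prescribes the direction in which each gap of the fixed point set \<open>A\<close> is to be moved.\<close>

definition adapted where
  "adapted g D A Up \<longleftrightarrow> g \<in> G \<and> finite D \<and> A \<subseteq> D \<and> A \<noteq> {} \<and> (\<forall>\<alpha>\<in>A. g \<alpha> = \<alpha>) \<and>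
     (\<forall>x y. x \<notin> A \<longrightarrow> y \<notin> A \<longrightarrow> Up x \<noteq> Up y \<longrightarrow> separated A x y) \<and>
     (\<forall>c\<in>D - A. if Up c then c \<sqsubset> g c else g c \<sqsubset> c)"

lemma separated_dual: "QU.separated (\<lambda>x y. y \<sqsubset> x) A x y \<longleftrightarrow> separated A x y"
  unfolding QU.separated_def[OF dual] separated_def by blast

lemma adapted_dual: "QU.adapted d (\<lambda>x y. y \<sqsubset> x) g D A (\<lambda>x. \<not> Up x) \<longleftrightarrow> adapted g D A Up"
  unfolding QU.adapted_def[OF dual] adapted_def separated_dual Aut_dual by (auto split: if_splits)

lemma adaptedD:
  assumes "adapted g D A Up"
  shows "g \<in> G" "finite D" "A \<subseteq> D" "A \<noteq> {}" "\<And>\<alpha>. \<alpha> \<in> A \<Longrightarrow> g \<alpha> = \<alpha>"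
    "\<And>x y. x \<notin> A \<Longrightarrow> y \<notin> A \<Longrightarrow> Up x \<noteq> Up y \<Longrightarrow> x \<sqsubset> y \<Longrightarrow> \<exists>\<alpha>\<in>A. x \<sqsubset> \<alpha> \<and> \<alpha> \<sqsubset> y"
    "\<And>c. c \<in> D \<Longrightarrow> c \<notin> A \<Longrightarrow> Up c \<Longrightarrow> c \<sqsubset> g c"
    "\<And>c. c \<in> D \<Longrightarrow> c \<notin> A \<Longrightarrow> \<not> Up c \<Longrightarrow> g c \<sqsubset> c"
  using assms unfolding adapted_def separated_def by (auto dest: less_asym less_trans)

lemma fixes_notin:
  assumes "g \<in> G" "\<And>\<alpha>. \<alpha> \<in> A \<Longrightarrow> g \<alpha> = \<alpha>" "x \<notin> A"
  shows "g x \<notin> A"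
  using assms by (metis Aut_eq)

text \<open>A map that fixes \<open>A\<close> pointwise keeps every point in its gap of
  \<open>A\<close>, and \<open>Up\<close> is constant on gaps.\<close>

lemma adapted_Up:
  assumes "adapted g D A Up" "x \<notin> A"
  shows "g x \<notin> A" "Up (g x) \<longleftrightarrow> Up x"
proof -
  note a = adaptedD[OF assms(1)]
  show 1: "g x \<notin> A" using fixes_notin[OF a(1) a(5) assms(2)] .
  have *: "(\<alpha> \<sqsubset> g x \<longleftrightarrow> \<alpha> \<sqsubset> x) \<and> (g x \<sqsubset> \<alpha> \<longleftrightarrow> x \<sqsubset> \<alpha>)" if "\<alpha> \<in> A" for \<alpha>
    using Aut_lt[OF a(1), of \<alpha> x] Aut_lt[OF a(1), of x \<alpha>] a(5)[OF that] by simp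
  show "Up (g x) \<longleftrightarrow> Up x"
  proof (rule ccontr)
    assume "Up (g x) \<noteq> Up x"
    then have "separated A (g x) x" using assms 1 unfolding adapted_def by blast
    then show False unfolding separated_def using * by (blast dest: less_asym)
  qed
qed

lemma adapted_funpow:
  assumes "adapted g D A Up" "x \<notin> A"
  shows "(g ^^ i) x \<notin> A \<and> (Up ((g ^^ i) x) \<longleftrightarrow> Up x)"
  by (induction i) (use adapted_Up[OF assms(1)] assms(2) in auto)

text \<open>Extending the range of \<open>g\<close> becomes extending the domain of a map that is
  adapted with the opposite directions.\<close>

lemma adapted_inv:
  assumes "adapted g D A Up"
  shows "adapted (inv g) (g ` D) A (\<lambda>x. \<not> Up x)"
proof -
  note a = adaptedD[OF assms]
  have "if \<not> Up c then c \<sqsubset> inv g c else inv g c \<sqsubset> c" if c: "c \<in> g ` D - A" for c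
  proof -
    obtain b where b: "b \<in> D" "c = g b" using c by auto
    then have "b \<notin> A" using c a(5) by auto
    then show ?thesis using a(1,7,8) b adapted_Up[OF assms \<open>b \<notin> A\<close>] by auto
  qed
  moreover have "A \<subseteq> g ` D" using a(3,5) by force
  moreover have "inv g \<alpha> = \<alpha>" if "\<alpha> \<in> A" for \<alpha> using a(1,5) that by (metis Aut_inv_f)
  ultimately show ?thesis
    using assms unfolding adapted_def by auto
qed

text \<open>The states reached when a partial automorphism is extended one point at a time, each new value
  being chosen as far from \<open>S0\<close> as the triangle inequality allows, and as high (or low) as possible.\<close>

definition sliding where
  "sliding D0 S0 A Up g D \<longleftrightarrow> adapted g D A Up \<and> A \<subseteq> D0 \<and> D0 \<subseteq> D \<and> finite S0 \<and>
     (\<forall>h\<in>D. \<forall>s\<in>S0. \<exists>c\<in>D0. d h c + d (g c) s \<le> d (g h) s) \<and>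
     (\<forall>h\<in>D - A. Up h \<longrightarrow> (\<forall>s\<in>S0. g h \<sqsubseteq> s \<longrightarrow> (\<exists>c\<in>D0. h \<sqsubseteq> c \<and> g c \<sqsubseteq> s))) \<and>
     (\<forall>h\<in>D - A. \<not> Up h \<longrightarrow> (\<forall>s\<in>S0. s \<sqsubseteq> g h \<longrightarrow> (\<exists>c\<in>D0. c \<sqsubseteq> h \<and> s \<sqsubseteq> g c)))"

lemma sliding_dual:
  "QU.sliding d (\<lambda>x y. y \<sqsubset> x) D0 S0 A (\<lambda>x. \<not> Up x) g D \<longleftrightarrow> sliding D0 S0 A Up g D"
  unfolding QU.sliding_def[OF dual] sliding_def adapted_dual le_dual by auto

lemma sliding_init:
  assumes "adapted g D A Up" "finite S"
  shows "sliding D S A Up g D"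
proof -
  have "\<exists>c\<in>D. d h c + d (g c) s \<le> d (g h) s" if "h \<in> D" for h s
    using that by (intro bexI[of _ h]) auto
  then show ?thesis
    using assms adaptedD[OF assms(1)] unfolding sliding_def by (auto simp: le_def)
qed

text \<open>The new step is free over the current domain \<open>D\<close>, while the invariant
  refers to the original \<open>D0\<close>. A constraint through \<open>c\<close> in
  \<open>D\<close> is pushed back to \<open>D0\<close> by the invariant at \<open>c\<close>. For the
  order, if \<open>c\<close> moves downwards, a fixed point between \<open>h\<close> and
  \<open>c\<close> takes its place, and fixed points lie in \<open>D0\<close>.\<close>

lemma sliding_add_Up:
  assumes s: "sliding D0 S0 A Up g D" and h: "h \<notin> D" "Up h"
  shows "\<exists>g'. sliding D0 S0 A Up g' (insert h D) \<and> (\<forall>c\<in>D. g' c = g c)"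
proof -
  have ad: "adapted g D A Up" and D0: "A \<subseteq> D0" "D0 \<subseteq> D" and fin: "finite S0"
    and free: "\<And>h s. h \<in> D \<Longrightarrow> s \<in> S0 \<Longrightarrow> \<exists>c\<in>D0. d h c + d (g c) s \<le> d (g h) s"
    and up: "\<And>h s. h \<in> D \<Longrightarrow> h \<notin> A \<Longrightarrow> Up h \<Longrightarrow> s \<in> S0 \<Longrightarrow> g h \<sqsubseteq> s \<Longrightarrow> \<exists>c\<in>D0. h \<sqsubseteq> c \<and> g c \<sqsubseteq> s"
    and down: "\<And>h s. h \<in> D \<Longrightarrow> h \<notin> A \<Longrightarrow> \<not> Up h \<Longrightarrow> s \<in> S0 \<Longrightarrow> s \<sqsubseteq> g h \<Longrightarrow> \<exists>c\<in>D0. c \<sqsubseteq> h \<and> s \<sqsubseteq> g c"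
    using s unfolding sliding_def by blast+
  note a = adaptedD[OF ad]
  have hA: "h \<notin> A" using h a(3) by auto
  \<comment> \<open>\<open>h\<close> itself is put into \<open>S\<close> so that \<open>g' h\<close>
    can be compared with it.\<close>
  define S where "S = insert h (S0 \<union> D \<union> g ` D)"
  have S: "D \<noteq> {}" "finite S" "D \<subseteq> S" "g ` D \<subseteq> S" using fin a(2,3,4) unfolding S_def by auto
  obtain g' where g': "g' \<in> G" "\<And>c. c \<in> D \<Longrightarrow> g' c = g c"
    "\<And>s. s \<in> S \<Longrightarrow> \<exists>c\<in>D. d h c + d (g c) s \<le> d (g' h) s"
    "\<And>s. s \<in> S \<Longrightarrow> g' h \<sqsubseteq> s \<Longrightarrow> \<exists>c\<in>D. h \<sqsubset> c \<and> g c \<sqsubseteq> s"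
    by (rule free_step_up[OF a(1,2) S h(1)], rule that)
  have agA: "g' \<alpha> = \<alpha>" if "\<alpha> \<in> A" for \<alpha> using that a(3,5) g'(2) by auto
  \<comment> \<open>Upward motion can be blocked only by some \<open>c\<close> with
    \<open>g c \<sqsubseteq> h \<sqsubset> c\<close>. Such a \<open>c\<close> moves downwards, so a
    fixed point lies between \<open>h\<close> and \<open>c\<close>, hence below \<open>g c\<close>:
    a contradiction.\<close>
  have "h \<sqsubset> g' h"
  proof (rule ccontr)
    assume "\<not> h \<sqsubset> g' h"
    then have "g' h \<sqsubseteq> h" by auto
    then obtain c where c: "c \<in> D" "h \<sqsubset> c" "g c \<sqsubseteq> h" using g'(4)[of h] unfolding S_def by auto
    then have lt: "g c \<sqsubset> c" by order
    then have cA: "c \<notin> A" using a(5) by auto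
    then have "\<not> Up c" using a(7)[OF c(1)] lt by (auto dest: less_asym)
    then obtain \<alpha> where \<alpha>: "\<alpha> \<in> A" "h \<sqsubset> \<alpha>" "\<alpha> \<sqsubset> c" using a(6)[OF hA cA] h(2) c(2) by auto
    then have "g \<alpha> \<sqsubset> g c" using a(1) by simp
    then show False using a(5)[OF \<alpha>(1)] \<alpha> c by order
  qed
  then have 1: "adapted g' (insert h D) A Up"
    using ad g'(1) h g'(2) agA hA unfolding adapted_def by auto
  have 2: "\<exists>c\<in>D0. d h c + d (g' c) s \<le> d (g' h) s" if sS: "s \<in> S0" for s
  proof -
    obtain c where c: "c \<in> D" "d h c + d (g c) s \<le> d (g' h) s" using g'(3)[of s] sS S_def by auto
    obtain c' where c': "c' \<in> D0" "d c c' + d (g c') s \<le> d (g c) s" using free[OF c(1) sS] by auto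
    then show ?thesis using c d_triangle[of h c' c] g'(2)[of c'] D0 by (intro bexI[of _ c']) auto
  qed
  have 3: "\<exists>c\<in>D0. h \<sqsubseteq> c \<and> g' c \<sqsubseteq> s" if sS: "s \<in> S0" "g' h \<sqsubseteq> s" for s
  proof -
    obtain c where c: "c \<in> D" "h \<sqsubset> c" "g c \<sqsubseteq> s" using g'(4)[of s] sS S_def by auto
    consider "c \<in> A" | "c \<notin> A" "Up c" | "c \<notin> A" "\<not> Up c" by blast
    then have "\<exists>c\<in>D0. h \<sqsubseteq> c \<and> g c \<sqsubseteq> s"
    proof cases
      case 1 then show ?thesis using c D0 by (intro bexI[of _ c]) auto
    next
      case 2 then obtain c' where "c' \<in> D0" "c \<sqsubseteq> c'" "g c' \<sqsubseteq> s" using up[OF c(1) 2 sS(1) c(3)] by blast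
      then show ?thesis using c(2) by (intro bexI[of _ c']) auto
    next
      case 3
      then obtain \<alpha> where \<alpha>: "\<alpha> \<in> A" "h \<sqsubset> \<alpha>" "\<alpha> \<sqsubset> c" using a(6)[OF hA 3(1)] h(2) c(2) by auto
      then have "g \<alpha> \<sqsubset> g c" using a(1) by simp
      then have "g \<alpha> \<sqsubseteq> s" using c(3) by order
      then show ?thesis using \<alpha> D0 by (intro bexI[of _ \<alpha>]) auto
    qed
    then show ?thesis using g'(2) D0 by (metis subsetD)
  qed
  have "sliding D0 S0 A Up g' (insert h D)"
    unfolding sliding_def
  proof (intro conjI)
    show "\<forall>x\<in>insert h D. \<forall>s\<in>S0. \<exists>c\<in>D0. d x c + d (g' c) s \<le> d (g' x) s"
      using 2 free g'(2) D0(2) by (metis insert_iff subsetD)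
    show "\<forall>x\<in>insert h D - A. Up x \<longrightarrow> (\<forall>s\<in>S0. g' x \<sqsubseteq> s \<longrightarrow> (\<exists>c\<in>D0. x \<sqsubseteq> c \<and> g' c \<sqsubseteq> s))"
      using 3 up g'(2) D0(2) by (metis Diff_iff insert_iff subsetD)
    show "\<forall>x\<in>insert h D - A. \<not> Up x \<longrightarrow> (\<forall>s\<in>S0. s \<sqsubseteq> g' x \<longrightarrow> (\<exists>c\<in>D0. c \<sqsubseteq> x \<and> s \<sqsubseteq> g' c))"
      using h(2) down g'(2) D0(2) by (metis Diff_iff insert_iff subsetD)
  qed (use 1 D0 fin in auto)
  then show ?thesis using g'(2) by auto
qed

lemma sliding_add:
  assumes "sliding D0 S0 A Up g D"
  shows "\<exists>g'. sliding D0 S0 A Up g' (insert h D) \<and> (\<forall>c\<in>D. g' c = g c)"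
proof -
  consider "h \<in> D" | "h \<notin> D" "Up h" | "h \<notin> D" "\<not> Up h" by blast
  then show ?thesis
  proof cases
    case 1 then show ?thesis using assms by (intro exI[of _ g]) (simp add: insert_absorb)
  next
    case 2 then show ?thesis using sliding_add_Up[OF assms] by blast
  next
    case 3 then show ?thesis using QU.sliding_add_Up[OF dual, of D0 S0 A "\<lambda>x. \<not> Up x" g D h] assms
      unfolding sliding_dual by blast
  qed
qed

lemma sliding_add_finite:
  assumes "finite H" "sliding D0 S0 A Up g D"
  shows "\<exists>g'. sliding D0 S0 A Up g' (D \<union> H) \<and> (\<forall>c\<in>D. g' c = g c)"
  using assms(1)
proof (induction H)
  case empty then show ?case using assms(2) by (intro exI[of _ g]) auto
next
  case (insert h H)
  then obtain g' where g': "sliding D0 S0 A Up g' (D \<union> H)" "\<forall>c\<in>D. g' c = g c" by blast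
  obtain g'' where g'': "sliding D0 S0 A Up g'' (insert h (D \<union> H))" "\<forall>c\<in>D\<union>H. g'' c = g' c"
    using sliding_add[OF g'(1)] by blast
  have "insert h (D \<union> H) = D \<union> insert h H" by auto
  then have "sliding D0 S0 A Up g'' (D \<union> insert h H)" using g''(1) by simp
  then show ?case using g' g'' by (intro exI[of _ g'']) simp
qed

section \<open>Long orbits of slides\<close>

lemma funpow_agree:
  assumes "\<forall>c\<in>D. g' c = g c" "\<And>j. j < i \<Longrightarrow> (g ^^ j) y \<in> D"
  shows "(g' ^^ i) y = (g ^^ i) y"
  using assms(2) by (induction i) (use assms(1) in auto)

lemma slide:
  assumes "finite Y" "sliding D0 S0 A Up g D"
  shows "\<exists>g' D'. sliding D0 S0 A Up g' D' \<and> D \<subseteq> D' \<and> (\<forall>c\<in>D. g' c = g c) \<and> (\<forall>y\<in>Y. \<forall>i<k. (g' ^^ i) y \<in> D')"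
proof (induction k)
  case 0 then show ?case using assms(2) by blast
next
  case (Suc k)
  then obtain g' D' where g': "sliding D0 S0 A Up g' D'" "D \<subseteq> D'" "\<forall>c\<in>D. g' c = g c"
    "\<forall>y\<in>Y. \<forall>i<k. (g' ^^ i) y \<in> D'" by blast
  \<comment> \<open>Only the current ends of the orbits are new. The earlier points are in
    \<open>D'\<close>, so the extension does not change the orbits up to there.\<close>
  define H where "H = (\<lambda>y. (g' ^^ k) y) ` Y"
  obtain g'' where g'': "sliding D0 S0 A Up g'' (D' \<union> H)" "\<forall>c\<in>D'. g'' c = g' c"
    using sliding_add_finite[OF _ g'(1), of H] assms(1) H_def by blast
  have "(g'' ^^ i) y \<in> D' \<union> H" if "y \<in> Y" "i < Suc k" for y i
  proof -
    have "(g'' ^^ i) y = (g' ^^ i) y"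
      using g'(4) that by (intro funpow_agree[OF g''(2)]) auto
    then show ?thesis using g'(4) that unfolding H_def by (cases "i = k") auto
  qed
  then show ?case using g' g'' by (intro exI[of _ g''] exI[of _ "D' \<union> H"]) auto
qed


text \<open>The rank \<open>\<rho> s\<close> counts the points of \<open>S0\<close> below
  \<open>s\<close>. If \<open>g h \<sqsubseteq> s\<close>, some \<open>c\<close> in
  \<open>D0\<close> has \<open>h \<sqsubseteq> c\<close> and \<open>g c \<sqsubseteq> s\<close>; if
  \<open>c\<close> moves upwards, it has smaller rank than \<open>s\<close>. So without a fixed
  point in the way each step climbs at least one rank, and more than \<open>card S0\<close> steps
  exhaust them.\<close>

lemma slide_order_Up:
  assumes s: "sliding D0 S0 A Up g D" and S0: "D0 \<subseteq> S0" and y: "y \<notin> A" "Up y"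
    and D: "\<And>i. i < k \<Longrightarrow> (g ^^ i) y \<in> D" and k: "card S0 < k"
    and t: "t \<in> S0" "(g ^^ k) y \<sqsubseteq> t"
  shows "\<exists>\<alpha>\<in>A. (g ^^ k) y \<sqsubset> \<alpha> \<and> \<alpha> \<sqsubseteq> t"
proof -
  have ad: "adapted g D A Up" and D0: "A \<subseteq> D0" "D0 \<subseteq> D" and fin: "finite S0"
    and up: "\<And>h s. h \<in> D \<Longrightarrow> h \<notin> A \<Longrightarrow> Up h \<Longrightarrow> s \<in> S0 \<Longrightarrow> g h \<sqsubseteq> s \<Longrightarrow> \<exists>c\<in>D0. h \<sqsubseteq> c \<and> g c \<sqsubseteq> s"
    using s unfolding sliding_def by blast+
  note a = adaptedD[OF ad]
  define \<rho> where "\<rho> s = card {x \<in> S0. x \<sqsubset> s}" for s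
  have "(\<exists>\<alpha>\<in>A. (g ^^ i) y \<sqsubset> \<alpha> \<and> \<alpha> \<sqsubseteq> s) \<or> i \<le> \<rho> s" if "i \<le> k" "s \<in> S0" "(g ^^ i) y \<sqsubseteq> s" for i s
    using that
  proof (induction i arbitrary: s)
    case 0 then show ?case by simp
  next
    case (Suc i)
    define h where "h = (g ^^ i) y"
    have h: "h \<notin> A" "Up h" "h \<in> D" using adapted_funpow[OF ad y(1), of i] y D Suc.prems h_def by auto
    have gh: "(g ^^ Suc i) y = g h" by (simp add: h_def)
    obtain c where c: "c \<in> D0" "h \<sqsubseteq> c" "g c \<sqsubseteq> s" using up[OF h(3,1,2) Suc.prems(2)] Suc.prems(3) gh by auto
    have up': ?case if "\<alpha> \<in> A" "h \<sqsubset> \<alpha>" "\<alpha> \<sqsubseteq> c" for \<alpha>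
    proof -
      have "g h \<sqsubset> \<alpha>" "\<alpha> \<sqsubseteq> g c" using Aut_lt[OF a(1), of h \<alpha>] Aut_le[OF a(1), of \<alpha> c] a(5) that by auto
      then show ?thesis using that(1) c(3) gh by (intro disjI1 bexI[of _ \<alpha>]) auto
    qed
    have "c \<in> S0" "c \<in> D" using c S0 D0 by auto
    from Suc.IH[OF _ this(1)] Suc.prems(1) c(2) h_def
    consider (1) \<alpha> where "\<alpha> \<in> A" "h \<sqsubset> \<alpha>" "\<alpha> \<sqsubseteq> c" | (2) "i \<le> \<rho> c" by auto
    then show ?case
    proof cases
      case 1 then show ?thesis using up' by blast
    next
      case 2
      consider "c \<in> A" | "c \<notin> A" "\<not> Up c" | "c \<notin> A" "Up c" by blast
      then show ?thesis
      proof cases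
        case 1 then show ?thesis using up'[of c] c(2) h(1) by (auto simp: le_def)
      next
        case 2
        then have "h \<sqsubset> c" using h c(2) by (auto simp: le_def)
        then obtain \<alpha> where "\<alpha> \<in> A" "h \<sqsubset> \<alpha>" "\<alpha> \<sqsubset> c" using a(6)[OF h(1) 2(1)] h 2 by auto
        then show ?thesis using up'[of \<alpha>] by auto
      next
        case 3
        then have "c \<sqsubset> s" using a(7)[OF \<open>c \<in> D\<close>] c(3) by auto
        then have "{x \<in> S0. x \<sqsubset> c} \<subset> {x \<in> S0. x \<sqsubset> s}" using \<open>c \<in> S0\<close> by auto
        then have "\<rho> c < \<rho> s" unfolding \<rho>_def using fin by (intro psubset_card_mono) auto
        then show ?thesis using 2 by auto
      qed
    qed
  qed
  from this[of k t] t have "(\<exists>\<alpha>\<in>A. (g ^^ k) y \<sqsubset> \<alpha> \<and> \<alpha> \<sqsubseteq> t) \<or> k \<le> \<rho> t" by simp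
  moreover have "\<rho> t \<le> card S0" unfolding \<rho>_def using fin by (intro card_mono) auto
  ultimately show ?thesis using k by auto
qed

lemma slide_order_Down:
  assumes s: "sliding D0 S0 A Up g D" and S0: "D0 \<subseteq> S0" and y: "y \<notin> A" "\<not> Up y"
    and D: "\<And>i. i < k \<Longrightarrow> (g ^^ i) y \<in> D" and k: "card S0 < k"
    and t: "t \<in> S0" "t \<sqsubseteq> (g ^^ k) y"
  shows "\<exists>\<alpha>\<in>A. \<alpha> \<sqsubset> (g ^^ k) y \<and> t \<sqsubseteq> \<alpha>"
  using QU.slide_order_Up[OF dual, of D0 S0 A "\<lambda>x. \<not> Up x" g D y k t] assms
  unfolding sliding_dual le_dual by blast

text \<open>A shortest path from \<open>(g ^^ k) y\<close> to \<open>t\<close> is traced back one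
  power at a time. Passing from \<open>s\<close> to \<open>c\<close> either costs
  \<open>\<delta>\<close>, or \<open>s = g c\<close> and the rank drops. Ranks are at most
  \<open>card S0\<close>, so the distance grows linearly with \<open>k\<close> unless the trace
  reaches a fixed point.\<close>

lemma slide_metric:
  assumes s: "sliding D0 S0 A Up g D" and S0: "D0 \<subseteq> S0" "g ` D0 \<subseteq> S0"
    and \<delta>: "\<And>s t. s \<in> S0 \<Longrightarrow> t \<in> S0 \<Longrightarrow> s \<noteq> t \<Longrightarrow> \<delta> \<le> d s t" "0 < \<delta>"
    and D: "\<And>i. i < k \<Longrightarrow> (g ^^ i) y \<in> D" and t: "t \<in> S0"
  shows "(\<exists>\<alpha>\<in>A. d ((g ^^ k) y) \<alpha> + d \<alpha> t \<le> d ((g ^^ k) y) t) \<or>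
     \<delta> * (of_nat k - of_nat (card S0)) \<le> of_nat (card S0 + 1) * d ((g ^^ k) y) t"
proof -
  have ad: "adapted g D A Up" and D0: "A \<subseteq> D0" "D0 \<subseteq> D" and fin: "finite S0"
    and free: "\<And>h s. h \<in> D \<Longrightarrow> s \<in> S0 \<Longrightarrow> \<exists>c\<in>D0. d h c + d (g c) s \<le> d (g h) s"
    using s unfolding sliding_def by blast+
  note a = adaptedD[OF ad]
  \<comment> \<open>\<open>\<rho>\<close> strictly increases along every non-trivial orbit, so a chain of free steps of length
     exceeding \<open>card S0\<close> has positive cost unless it meets \<open>A\<close>.\<close>
  define \<rho> where "\<rho> s = card {x \<in> S0. if Up s then x \<sqsubset> s else s \<sqsubset> x}" for s
  \<comment> \<open>In a step that costs \<open>\<delta>\<close>, the index rises by one and the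
    rank falls by at most \<open>card S0\<close>, so \<open>i - \<rho>\<close> grows by at most
    \<open>L\<close>; the gain in distance, multiplied by \<open>L\<close>, pays for this.\<close>
  define L :: rat where "L = of_nat (card S0 + 1)"
  have \<rho>_le: "\<rho> s \<le> card S0" for s unfolding \<rho>_def using fin by (intro card_mono) auto
  have \<rho>_inc: "\<rho> c < \<rho> (g c)" if "c \<in> D0" "c \<notin> A" for c
  proof -
    have "c \<in> S0" "c \<in> D" using that S0 D0 by auto
    then have "{x \<in> S0. if Up c then x \<sqsubset> c else c \<sqsubset> x} \<subset> {x \<in> S0. if Up (g c) then x \<sqsubset> g c else g c \<sqsubset> x}"
      using a(7,8)[of c] adapted_Up[OF ad that(2)] that(2) by (cases "Up c") (auto dest: less_trans)
    then show ?thesis unfolding \<rho>_def using fin by (intro psubset_card_mono) auto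
  qed
  have "(\<exists>\<alpha>\<in>A. d ((g ^^ i) y) \<alpha> + d \<alpha> s \<le> d ((g ^^ i) y) s) \<or> \<delta> * (of_nat i - of_nat (\<rho> s)) \<le> L * d ((g ^^ i) y) s"
    if "i \<le> k" "s \<in> S0" for i s
    using that
  proof (induction i arbitrary: s)
    case 0
    have "\<delta> * (0 - of_nat (\<rho> s)) \<le> 0" using \<delta>(2) by (simp add: mult_nonneg_nonneg)
    also have "0 \<le> L * d y s" unfolding L_def by (intro mult_nonneg_nonneg) auto
    finally show ?case by simp
  next
    case (Suc i)
    define h where "h = (g ^^ i) y"
    have h: "h \<in> D" using D Suc.prems h_def by auto
    have gh: "(g ^^ Suc i) y = g h" by (simp add: h_def)
    obtain c where c: "c \<in> D0" "d h c + d (g c) s \<le> d (g h) s" using free[OF h Suc.prems(2)] by auto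
    have via: ?case if "\<alpha> \<in> A" "d h \<alpha> + d \<alpha> c \<le> d h c" for \<alpha>
    proof -
      have "d (g h) \<alpha> = d h \<alpha>" "d \<alpha> (g c) = d \<alpha> c"
        using Aut_d[OF a(1), of h \<alpha>] Aut_d[OF a(1), of \<alpha> c] a(5) that by auto
      then have "d (g h) \<alpha> + d \<alpha> s \<le> d (g h) s" using that(2) c(2) d_triangle[of \<alpha> s "g c"] by linarith
      then show ?thesis using that(1) gh by auto
    qed
    have cS: "c \<in> S0" "g c \<in> S0" using c S0 by auto
    show ?case
    proof (cases "c \<in> A")
      case True then show ?thesis using via[of c] by simp
    next
      case False
      from Suc.IH[OF _ cS(1)] Suc.prems(1) h_def
      consider (1) \<alpha> where "\<alpha> \<in> A" "d h \<alpha> + d \<alpha> c \<le> d h c" | (2) "\<delta> * (of_nat i - of_nat (\<rho> c)) \<le> L * d h c" by auto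
      then show ?thesis
      proof cases
        case 1 then show ?thesis using via by blast
      next
        case 2
        have "\<delta> * (of_nat (Suc i) - of_nat (\<rho> s)) \<le> L * d (g h) s"
        proof (cases "s = g c")
          case True
          have "of_nat (Suc i) - of_nat (\<rho> s) \<le> (of_nat i - of_nat (\<rho> c) :: rat)"
            using \<rho>_inc[OF c(1) False] True by simp
          then have "\<delta> * (of_nat (Suc i) - of_nat (\<rho> s)) \<le> \<delta> * (of_nat i - of_nat (\<rho> c))" using \<delta>(2) by simp
          also have "\<dots> \<le> L * d h c" by (rule 2)
          also have "\<dots> \<le> L * d (g h) s" using c(2) True unfolding L_def by (intro mult_left_mono) auto
          finally show ?thesis .
        next
          case False
          have "of_nat (Suc i) - of_nat (\<rho> s) \<le> (of_nat i - of_nat (\<rho> c)) + L"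
            using \<rho>_le[of c] unfolding L_def by simp
          then have "\<delta> * (of_nat (Suc i) - of_nat (\<rho> s)) \<le> \<delta> * ((of_nat i - of_nat (\<rho> c)) + L)" using \<delta>(2) by simp
          also have "\<dots> \<le> L * d h c + L * \<delta>" using 2 by (simp add: algebra_simps)
          also have "\<dots> \<le> L * d h c + L * d (g c) s"
            using \<delta>(1)[OF cS(2) Suc.prems(2)] False unfolding L_def by (intro add_left_mono mult_left_mono) auto
          also have "\<dots> \<le> L * d (g h) s" using c(2) unfolding L_def distrib_left[symmetric] by (intro mult_left_mono) auto
          finally show ?thesis .
        qed
        then show ?thesis using gh by simp
      qed
    qed
  qed
  from this[of k t] t have "(\<exists>\<alpha>\<in>A. d ((g ^^ k) y) \<alpha> + d \<alpha> t \<le> d ((g ^^ k) y) t) \<or> \<delta> * (of_nat k - of_nat (\<rho> t)) \<le> L * d ((g ^^ k) y) t"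
    by simp
  moreover have "\<delta> * (of_nat k - of_nat (card S0)) \<le> \<delta> * (of_nat k - of_nat (\<rho> t))"
    using \<rho>_le[of t] \<delta>(2) by simp
  ultimately show ?thesis unfolding L_def by auto
qed

text \<open>With the triangle inequality the first clause says that \<open>t\<close> is as far from
  \<open>(f ^^ k) y\<close> as the distances to \<open>A\<close> permit. The others say that
  \<open>(f ^^ k) y\<close> has passed every \<open>t\<close> in its gap of \<open>A\<close>; they
  leave out the points of \<open>A\<close>, which do not move.\<close>

definition mixes where
  "mixes f A Up Y T k \<longleftrightarrow> (\<forall>y\<in>Y. \<forall>t\<in>T.
     (\<exists>\<alpha>\<in>A. d ((f ^^ k) y) \<alpha> + d \<alpha> t \<le> d ((f ^^ k) y) t) \<and>
     (y \<notin> A \<longrightarrow> Up y \<longrightarrow> (f ^^ k) y \<sqsubseteq> t \<longrightarrow> (\<exists>\<alpha>\<in>A. (f ^^ k) y \<sqsubset> \<alpha> \<and> \<alpha> \<sqsubseteq> t)) \<and>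
     (y \<notin> A \<longrightarrow> \<not> Up y \<longrightarrow> t \<sqsubseteq> (f ^^ k) y \<longrightarrow> (\<exists>\<alpha>\<in>A. \<alpha> \<sqsubset> (f ^^ k) y \<and> t \<sqsubseteq> \<alpha>)))"

lemma min_distance:
  assumes "finite S"
  shows "\<exists>\<delta>>0. \<forall>s\<in>S. \<forall>t\<in>S. s \<noteq> t \<longrightarrow> \<delta> \<le> d s t"
proof -
  define E where "E = insert 1 ((\<lambda>(s, t). d s t) ` {(s, t) \<in> S \<times> S. s \<noteq> t})"
  have "finite {(s, t) \<in> S \<times> S. s \<noteq> t}" by (rule finite_subset[of _ "S \<times> S"]) (use assms in auto)
  then have E: "finite E" unfolding E_def by auto
  then have "0 < linorder_class.Min E" unfolding E_def by (subst linorder_class.Min_gr_iff) auto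
  moreover have "linorder_class.Min E \<le> d s t" if "s \<in> S" "t \<in> S" "s \<noteq> t" for s t
    by (rule linorder_class.Min_le[OF E]) (use that in \<open>force simp: E_def\<close>)
  ultimately show ?thesis by blast
qed

lemma slide_mixes:
  assumes ad: "adapted g D A Up" and fin: "finite Y" "finite T"
  shows "\<exists>g' D' k. adapted g' D' A Up \<and> D \<subseteq> D' \<and> (\<forall>c\<in>D. g' c = g c) \<and>
     (\<forall>y\<in>Y. \<forall>i<k. (g' ^^ i) y \<in> D') \<and> mixes g' A Up Y T k"
proof -
  note a = adaptedD[OF ad]
  define S where "S = D \<union> g ` D \<union> T"
  have S: "finite S" "T \<subseteq> S" using a(2) fin unfolding S_def by auto
  obtain \<delta> where \<delta>: "0 < \<delta>" "\<And>s t. s \<in> S \<Longrightarrow> t \<in> S \<Longrightarrow> s \<noteq> t \<Longrightarrow> \<delta> \<le> d s t" using min_distance[OF S(1)] by blast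
  \<comment> \<open>Powers preserve the distance to the fixed point \<open>z\<close>, so once
    \<open>d ((g' ^^ k) y) t\<close> is at least \<open>M\<close>, the point \<open>z\<close> is
    itself the required witness. \<open>N\<close> is the number of steps after which the linear
    growth in \<open>slide_metric\<close> reaches \<open>M\<close>.\<close>
  obtain z where z: "z \<in> A" using a(4) by auto
  define M where "M = (\<Sum>y\<in>Y. d y z) + (\<Sum>t\<in>T. d z t)"
  define N :: rat where "N = of_nat (card S) + of_nat (card S + 1) * M / \<delta>"
  obtain k0 :: nat where k0: "N \<le> of_nat k0" using real_arch_simple by blast
  define k where "k = Suc (k0 + card S)"
  have k: "card S < k" "N \<le> of_nat k"
    using k0 unfolding k_def by auto
  obtain g' D' where g': "sliding D S A Up g' D'" "D \<subseteq> D'" "\<forall>c\<in>D. g' c = g c"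
    "\<forall>y\<in>Y. \<forall>i<k. (g' ^^ i) y \<in> D'"
    using slide[OF fin(1) sliding_init[OF ad S(1)]] by blast
  have ad': "adapted g' D' A Up" using g'(1) unfolding sliding_def by blast
  note a' = adaptedD[OF ad']
  have img: "D \<subseteq> S" "g' ` D \<subseteq> S" using g'(3) unfolding S_def by auto
  have "mixes g' A Up Y T k"
    unfolding mixes_def
  proof (intro ballI conjI impI)
    fix y t assume y: "y \<in> Y" and t: "t \<in> T"
    have pw: "\<And>i. i < k \<Longrightarrow> (g' ^^ i) y \<in> D'" using g'(4) y by auto
    have tS: "t \<in> S" using t S by auto
    show "y \<notin> A \<Longrightarrow> Up y \<Longrightarrow> (g' ^^ k) y \<sqsubseteq> t \<Longrightarrow> \<exists>\<alpha>\<in>A. (g' ^^ k) y \<sqsubset> \<alpha> \<and> \<alpha> \<sqsubseteq> t"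
      using slide_order_Up[OF g'(1) img(1) _ _ pw k(1) tS] by blast
    show "y \<notin> A \<Longrightarrow> \<not> Up y \<Longrightarrow> t \<sqsubseteq> (g' ^^ k) y \<Longrightarrow> \<exists>\<alpha>\<in>A. \<alpha> \<sqsubset> (g' ^^ k) y \<and> t \<sqsubseteq> \<alpha>"
      using slide_order_Down[OF g'(1) img(1) _ _ pw k(1) tS] by blast
    have fz: "(g' ^^ k) z = z" by (induction k) (use a'(5)[OF z] in auto)
    have dz: "d ((g' ^^ k) y) z = d y z" using Aut_d[OF Aut_funpow[OF a'(1)], of k y z] fz by simp
    have M: "d y z + d z t \<le> M"
      unfolding M_def using y t fin by (intro add_mono member_le_sum) auto
    from slide_metric[OF g'(1) img \<delta>(2,1) pw tS]
    show "\<exists>\<alpha>\<in>A. d ((g' ^^ k) y) \<alpha> + d \<alpha> t \<le> d ((g' ^^ k) y) t"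
    proof
      assume *: "\<delta> * (of_nat k - of_nat (card S)) \<le> of_nat (card S + 1) * d ((g' ^^ k) y) t"
      have "of_nat (card S + 1) * M = \<delta> * (N - of_nat (card S))" using \<delta>(1) unfolding N_def by simp
      also have "\<dots> \<le> \<delta> * (of_nat k - of_nat (card S))" using k(2) \<delta>(1) by simp
      also note *
      finally have "M \<le> d ((g' ^^ k) y) t" by (simp del: of_nat_add add: mult_le_cancel_left)
      then show ?thesis using M dz z by (intro bexI[of _ z]) auto
    qed blast
  qed
  then show ?thesis using ad' g' by blast
qed

end

subsection \<open>Mixing automorphisms\<close>

context QU begin

lemma mixes_subset:
  "mixes f A Up Y T k \<Longrightarrow> Y' \<subseteq> Y \<Longrightarrow> T' \<subseteq> T \<Longrightarrow> mixes f A Up Y' T' k"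
  unfolding mixes_def by blast

lemma mixes_cong:
  assumes "mixes g A Up Y T k" "\<And>y. y \<in> Y \<Longrightarrow> (f ^^ k) y = (g ^^ k) y"
  shows "mixes f A Up Y T k"
  using assms unfolding mixes_def by simp

lemma adapted_add:
  assumes "adapted g D A Up"
  shows "\<exists>g'. adapted g' (insert x D) A Up \<and> (\<forall>c\<in>D. g' c = g c)"
proof -
  obtain g' where "sliding D {} A Up g' (insert x D)" "\<forall>c\<in>D. g' c = g c"
    using sliding_add[OF sliding_init[OF assms finite.emptyI]] by blast
  then show ?thesis
    unfolding sliding_def by (intro exI[of _ g']) simp
qed

lemma adapted_of_inv:
  assumes g: "g \<in> G" and h: "adapted h E A (\<lambda>x. \<not> Up x)" "g ` D \<subseteq> E" "\<forall>c\<in>g ` D. h c = inv g c"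
  shows "adapted (inv h) (h ` E) A Up" "D \<subseteq> h ` E" "\<forall>c\<in>D. inv h c = g c"
    "inv (inv h) = h" "inv h ` h ` E = E"
proof -
  note a = adaptedD[OF h(1)]
  show "adapted (inv h) (h ` E) A Up" using adapted_inv[OF h(1)] by simp
  have hc: "h (g c) = c" if "c \<in> D" for c using h(3) g that by simp
  show "D \<subseteq> h ` E" using hc h(2) by (metis image_eqI image_subset_iff subsetI)
  show "\<forall>c\<in>D. inv h c = g c" using hc a(1) by (metis Aut_inv_f)
  show "inv (inv h) = h" using a(1) by simp
  show "inv h ` h ` E = E" using a(1) by (simp add: image_image)
qed

text \<open>The orbit segments used for mixing are kept inside the domain, so every later extension
  has the same powers on \<open>Y\<close> and mixes with the same \<open>k\<close>.\<close>

lemma mixing_stage: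
  assumes ad: "adapted g D A Up" and fin: "finite Y" "finite T"
  shows "\<exists>g' D'. adapted g' D' A Up \<and> D \<subseteq> D' \<and> (\<forall>c\<in>D. g' c = g c) \<and> x \<in> D' \<and> x \<in> g' ` D' \<and>
     (\<exists>k. (\<forall>y\<in>Y. \<forall>i<k. (g' ^^ i) y \<in> D') \<and> mixes g' A Up Y T k) \<and>
     (\<exists>k. (\<forall>y\<in>Y. \<forall>i<k. (inv g' ^^ i) y \<in> g' ` D') \<and> mixes (inv g') A (\<lambda>x. \<not> Up x) Y T k)"
proof -
  obtain g1 where g1: "adapted g1 (insert x D) A Up" "\<forall>c\<in>D. g1 c = g c"
    using adapted_add[OF ad] by blast
  define D1 where "D1 = insert x D"
  have g1': "adapted g1 D1 A Up" "D \<subseteq> D1" "x \<in> D1" "g1 \<in> G" using g1 adaptedD(1)[OF g1(1)] D1_def by auto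
  obtain h1 where h1: "adapted h1 (insert x (g1 ` D1)) A (\<lambda>x. \<not> Up x)" "\<forall>c\<in>g1 ` D1. h1 c = inv g1 c"
    using adapted_add[OF adapted_inv[OF g1'(1)]] by blast
  define g2 where "g2 = inv h1"
  define D2 where "D2 = h1 ` insert x (g1 ` D1)"
  have g2: "adapted g2 D2 A Up" "D1 \<subseteq> D2" "\<forall>c\<in>D1. g2 c = g1 c" "x \<in> g2 ` D2"
    using adapted_of_inv[OF g1'(4) h1(1) _ h1(2)] unfolding g2_def D2_def by (auto simp del: image_insert)
  obtain g3 D3 k where g3: "adapted g3 D3 A Up" "D2 \<subseteq> D3" "\<forall>c\<in>D2. g3 c = g2 c"
     "\<forall>y\<in>Y. \<forall>i<k. (g3 ^^ i) y \<in> D3" "mixes g3 A Up Y T k"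
    using slide_mixes[OF g2(1) fin] by blast
  have g3G: "g3 \<in> G" using adaptedD(1)[OF g3(1)] .
  obtain h4 E4 k' where h4: "adapted h4 E4 A (\<lambda>x. \<not> Up x)" "g3 ` D3 \<subseteq> E4" "\<forall>c\<in>g3 ` D3. h4 c = inv g3 c"
     "\<forall>y\<in>Y. \<forall>i<k'. (h4 ^^ i) y \<in> E4" "mixes h4 A (\<lambda>x. \<not> Up x) Y T k'"
    using slide_mixes[OF adapted_inv[OF g3(1)] fin] by blast
  define g4 where "g4 = inv h4"
  define D4 where "D4 = h4 ` E4"
  have g4: "adapted g4 D4 A Up" "D3 \<subseteq> D4" "\<forall>c\<in>D3. g4 c = g3 c" "inv g4 = h4" "g4 ` D4 = E4"
    using adapted_of_inv[OF g3G h4(1,2,3)] unfolding g4_def D4_def by auto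
  have "(g4 ^^ i) y = (g3 ^^ i) y" if "y \<in> Y" "i \<le> k" for y i
    by (rule funpow_agree[OF g4(3)]) (use g3(4) that in auto)
  then have "(\<forall>y\<in>Y. \<forall>i<k. (g4 ^^ i) y \<in> D4) \<and> mixes g4 A Up Y T k"
    using g3(4) g4(2) mixes_cong[OF g3(5), of g4] by (auto simp: subset_iff)
  moreover have "D \<subseteq> D4" "\<forall>c\<in>D. g4 c = g c" "x \<in> D4" "x \<in> g4 ` D4"
  proof -
    show "D \<subseteq> D4" using g1'(2) g2(2) g3(2) g4(2) by blast
    show "\<forall>c\<in>D. g4 c = g c" using g1(2) g1'(2) g2(2,3) g3(2,3) g4(2,3) by (metis subsetD)
    show "x \<in> D4" using g1'(3) g2(2) g3(2) g4(2) by blast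
    obtain c where "c \<in> D2" "x = g2 c" using g2(4) by auto
    then have "g4 c = x" "c \<in> D4" using g3(2,3) g4(2,3) by (metis subsetD)+
    then show "x \<in> g4 ` D4" by blast
  qed
  ultimately show ?thesis using g4 h4(4,5) by blast
qed

text \<open>The inverse is included with opposite directions: it serves to move upwards the gaps
  that \<open>f\<close> moves downwards.\<close>

definition mixing where
  "mixing f A Up \<longleftrightarrow> f \<in> G \<and> finite A \<and> A \<noteq> {} \<and> (\<forall>\<alpha>\<in>A. f \<alpha> = \<alpha>) \<and>
     (\<forall>Y T. finite Y \<longrightarrow> finite T \<longrightarrow> (\<exists>k. mixes f A Up Y T k) \<and> (\<exists>k. mixes (inv f) A (\<lambda>x. \<not> Up x) Y T k))"

text \<open>Back-and-forth along an enumeration \<open>e\<close>: stage \<open>n\<close> puts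
  \<open>e n\<close> into domain and range and mixes the points \<open>e 0, ..., e n\<close>. Any
  finite \<open>Y\<close> and \<open>T\<close> are covered by some stage.\<close>

lemma mixing_extension:
  assumes ad: "adapted g D A Up"
  shows "\<exists>f. mixing f A Up \<and> (\<forall>c\<in>D. f c = g c)"
proof -
  define e :: "nat \<Rightarrow> 'a" where "e = from_nat_into UNIV"
  have e: "\<exists>n. e n = x" for x unfolding e_def by (metis UNIV_I countable_UNIV from_nat_into_to_nat_on)
  define Y where "Y n = e ` {..n}" for n
  have finY: "finite (Y n)" for n unfolding Y_def by auto
  define P where "P s \<longleftrightarrow> adapted (fst s) (snd s) A Up" for s
  define Q where "Q n s s' \<longleftrightarrow> snd s \<subseteq> snd s' \<and> (\<forall>c\<in>snd s. fst s' c = fst s c) \<and> e n \<in> snd s' \<and> e n \<in> fst s' ` snd s' \<and>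
     (\<exists>k. (\<forall>y\<in>Y n. \<forall>i<k. (fst s' ^^ i) y \<in> snd s') \<and> mixes (fst s') A Up (Y n) (Y n) k) \<and>
     (\<exists>k. (\<forall>y\<in>Y n. \<forall>i<k. (inv (fst s') ^^ i) y \<in> fst s' ` snd s') \<and> mixes (inv (fst s')) A (\<lambda>x. \<not> Up x) (Y n) (Y n) k)"
    for n and s s' :: "('a \<Rightarrow> 'a) \<times> 'a set"
  have step: "\<exists>s'. P s' \<and> Q n s s'" if "P s" for s n
    using mixing_stage[OF that[unfolded P_def] finY[of n] finY[of n], of "e n"] unfolding P_def Q_def
    by (metis fst_conv snd_conv)
  define \<sigma> where "\<sigma> = rec_nat (g, D) (\<lambda>n s. SOME s'. P s' \<and> Q n s s')"
  have \<sigma>0: "\<sigma> 0 = (g, D)" by (simp add: \<sigma>_def)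
  have \<sigma>S: "\<sigma> (Suc n) = (SOME s'. P s' \<and> Q n (\<sigma> n) s')" for n by (simp add: \<sigma>_def)
  have P: "P (\<sigma> n)" for n
  proof (induction n)
    case 0 then show ?case using ad by (simp add: \<sigma>0 P_def)
  next
    case (Suc n) then show ?case unfolding \<sigma>S using someI_ex[OF step[OF Suc]] by blast
  qed
  have Q: "Q n (\<sigma> n) (\<sigma> (Suc n))" for n
    unfolding \<sigma>S using someI_ex[OF step[OF P]] by blast
  define h where "h n = fst (\<sigma> n)" for n
  define E where "E n = snd (\<sigma> n)" for n
  have adn: "adapted (h n) (E n) A Up" for n using P unfolding P_def h_def E_def .
  have hG: "h n \<in> G" for n using adaptedD(1)[OF adn] .
  have st: "E n \<subseteq> E (Suc n)" "\<forall>c\<in>E n. h (Suc n) c = h n c" "e n \<in> E (Suc n)" "e n \<in> h (Suc n) ` E (Suc n)"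
    "\<exists>k. (\<forall>y\<in>Y n. \<forall>i<k. (h (Suc n) ^^ i) y \<in> E (Suc n)) \<and> mixes (h (Suc n)) A Up (Y n) (Y n) k"
    "\<exists>k. (\<forall>y\<in>Y n. \<forall>i<k. (inv (h (Suc n)) ^^ i) y \<in> h (Suc n) ` E (Suc n)) \<and> mixes (inv (h (Suc n))) A (\<lambda>x. \<not> Up x) (Y n) (Y n) k" for n
    using Q[of n] unfolding Q_def h_def E_def by blast+
  have mono: "E m \<subseteq> E n \<and> (\<forall>c\<in>E m. h n c = h m c)" if "m \<le> n" for m n
    using that
  proof (induction n rule: dec_induct)
    case (step n) then show ?case using st(1,2)[of n] by (metis subset_iff)
  qed auto
  \<comment> \<open>Later stages extend earlier ones, so \<open>x\<close> may be evaluated at the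
    stage right after its index, when it has entered the domain.\<close>
  define f where "f x = h (Suc (SOME n. e n = x)) x" for x
  have f: "f c = h n c" if "c \<in> E n" for c n
  proof -
    define m where "m = (SOME n. e n = c)"
    have "e m = c" unfolding m_def using someI_ex[OF e] .
    then have "c \<in> E (Suc m)" using st(3)[of m] by simp
    then have "h (Suc m) c = h n c" using mono[of n "Suc m"] mono[of "Suc m" n] that by (metis nat_le_linear)
    then show ?thesis unfolding f_def m_def .
  qed
  have cover: "\<exists>n. x \<in> E n" for x using e[of x] st(3) by metis
  have fG: "f \<in> G"
  proof (rule AutI)
    show "surj f"
      unfolding surj_def
    proof
      fix y
      obtain n where "e n = y" using e by blast
      then obtain c where "c \<in> E (Suc n)" "y = h (Suc n) c" using st(4)[of n] by auto
      then show "\<exists>x. y = f x" using f[of c "Suc n"] by (intro exI[of _ c]) simp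
    qed
    fix x y
    obtain m n where "x \<in> E m" "y \<in> E n" using cover by blast
    then have "x \<in> E (m + n)" "y \<in> E (m + n)" using mono[of m "m + n"] mono[of n "m + n"] by auto
    then have "f x = h (m + n) x" "f y = h (m + n) y" using f by auto
    then show "d (f x) (f y) = d x y" "f x \<sqsubset> f y \<longleftrightarrow> x \<sqsubset> y" using hG by auto
  qed
  have fA: "f \<alpha> = \<alpha>" if "\<alpha> \<in> A" for \<alpha>
    using f[of \<alpha> 0] adaptedD(3,5)[OF adn[of 0]] that by auto
  have inv_f: "inv f c = inv (h n) c" if c: "c \<in> h n ` E n" for c n
  proof -
    obtain b where "b \<in> E n" "c = h n b" using c by auto
    then show ?thesis using f[of b n] fG hG[of n] by (metis Aut_inv_f)
  qed
  have mix: "(\<exists>k. mixes f A Up U T k) \<and> (\<exists>k. mixes (inv f) A (\<lambda>x. \<not> Up x) U T k)" if UT: "finite U" "finite T" for U T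
  proof -
    have "U \<union> T \<subseteq> range e" using e by (metis rangeI subsetI)
    then obtain C where C: "finite C" "U \<union> T = e ` C" using finite_subset_image[of "U \<union> T" e UNIV] UT by auto
    obtain n where "C \<subseteq> {..n}" using C(1) finite_nat_iff_bounded_le by blast
    then have sub: "U \<subseteq> Y n" "T \<subseteq> Y n" using C(2) unfolding Y_def by blast+
    obtain k where k: "\<forall>y\<in>Y n. \<forall>i<k. (h (Suc n) ^^ i) y \<in> E (Suc n)" "mixes (h (Suc n)) A Up (Y n) (Y n) k"
      using st(5) by blast
    have "\<forall>c\<in>E (Suc n). f c = h (Suc n) c" using f by blast
    then have "(f ^^ k) y = (h (Suc n) ^^ k) y" if "y \<in> Y n" for y
      by (rule funpow_agree) (use k(1) that in auto)
    then have 1: "mixes f A Up (Y n) (Y n) k" by (rule mixes_cong[OF k(2)])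
    obtain k' where k': "\<forall>y\<in>Y n. \<forall>i<k'. (inv (h (Suc n)) ^^ i) y \<in> h (Suc n) ` E (Suc n)"
      "mixes (inv (h (Suc n))) A (\<lambda>x. \<not> Up x) (Y n) (Y n) k'"
      using st(6) by blast
    have "\<forall>c\<in>h (Suc n) ` E (Suc n). inv f c = inv (h (Suc n)) c" using inv_f by blast
    then have "(inv f ^^ k') y = (inv (h (Suc n)) ^^ k') y" if "y \<in> Y n" for y
      by (rule funpow_agree) (use k'(1) that in auto)
    then have "mixes (inv f) A (\<lambda>x. \<not> Up x) (Y n) (Y n) k'" by (rule mixes_cong[OF k'(2)])
    then show ?thesis using 1 sub mixes_subset by meson
  qed
  have "finite A" "A \<noteq> {}" using adaptedD(2,3,4)[OF ad] finite_subset by auto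
  moreover have "f c = g c" if "c \<in> D" for c
    using f[of c 0] that by (simp add: h_def E_def \<sigma>0)
  ultimately show ?thesis unfolding mixing_def using fG fA mix by blast
qed

end

subsection \<open>Making fixed cuts explicit\<close>

context QU begin

text \<open>A positive constant is a Katetov function once its double bounds the distances in
  \<open>S\<close>. A point equidistant from \<open>S\<close> puts no metric constraint on a partial
  map within \<open>S\<close> that is to fix it; only its cut matters.\<close>

lemma equidistant_point:
  assumes S: "finite S" and L: "\<And>s t. s \<in> S \<Longrightarrow> t \<in> S \<Longrightarrow> s \<sqsubset> t \<Longrightarrow> P t \<Longrightarrow> P s"
  obtains y r where "y \<notin> S" "\<And>s. s \<in> S \<Longrightarrow> s \<sqsubset> y \<longleftrightarrow> P s" "\<And>s. s \<in> S \<Longrightarrow> d y s = r"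
proof -
  define r where "r = 1 + (\<Sum>s\<in>S. \<Sum>t\<in>S. d s t)"
  have "(0::rat) \<le> (\<Sum>s\<in>S. \<Sum>t\<in>S. d s t)" by (intro sum_nonneg) auto
  then have pos: "0 < r" unfolding r_def by linarith
  have le: "d s t \<le> r" if "s \<in> S" "t \<in> S" for s t
  proof -
    have "d s t \<le> (\<Sum>t\<in>S. d s t)" using that S by (intro member_le_sum) auto
    also have "\<dots> \<le> (\<Sum>s\<in>S. \<Sum>t\<in>S. d s t)"
      using that S by (intro member_le_sum[where f = "\<lambda>s. \<Sum>t\<in>S. d s t"]) (auto intro: sum_nonneg)
    finally show ?thesis unfolding r_def by simp
  qed
  show ?thesis
  proof (rule realize_type[OF S, of "\<lambda>_. r" P])
    show "d s t \<le> r + r" if "s \<in> S" "t \<in> S" for s t using le[OF that] pos by linarith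
    show "r \<le> r + d t s" for s t by simp
    fix y assume "\<And>s. s \<in> S \<Longrightarrow> d y s = r" "\<And>s. s \<in> S \<Longrightarrow> s \<sqsubset> y \<longleftrightarrow> P s" "y \<notin> S"
    then show thesis by (intro that[of y r])
  qed (use pos L in auto)
qed

lemma extend_fixing:
  assumes g: "g \<in> G" and S: "finite D" "D \<subseteq> S" "g ` D \<subseteq> S" and y: "y \<notin> S" "\<And>s. s \<in> S \<Longrightarrow> d y s = r"
    and cut: "\<And>c. c \<in> D \<Longrightarrow> c \<sqsubset> y \<longleftrightarrow> g c \<sqsubset> y"
  shows "\<exists>g'\<in>G. (\<forall>c\<in>D. g' c = g c) \<and> g' y = y"
proof -
  define p where "p = g(y := y)"
  have yD: "y \<notin> D" "y \<notin> g ` D" using y S by auto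
  have dy: "d y (g c) = d y c" if "c \<in> D" for c using y(2)[of c] y(2)[of "g c"] that S by auto
  have oy: "y \<sqsubset> c \<longleftrightarrow> y \<sqsubset> g c" if "c \<in> D" for c
    using cut[OF that] yD that lt_total[of y c] lt_total[of y "g c"] by (metis image_eqI less_asym)
  obtain g' where g': "g' \<in> G" "\<And>c. c \<in> insert y D \<Longrightarrow> g' c = p c"
  proof (rule extend_partial[of "insert y D" p])
    fix a b assume ab: "a \<in> insert y D" "b \<in> insert y D"
    show "d (p a) (p b) = d a b" using ab yD g dy d_sym unfolding p_def by auto
    show "a \<sqsubset> b \<Longrightarrow> p a \<sqsubset> p b" using ab yD g cut oy unfolding p_def by auto
  qed (use S in auto)
  then show ?thesis using yD unfolding p_def by (intro bexI[of _ g']) auto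
qed

text \<open>A cut is represented by its lower half in \<open>S\<close>. The fixed points are added
  one cut at a time, each equidistant from all points present, so invariance of the cut suffices for
  fixing it.\<close>

lemma add_fixed_cuts:
  assumes g: "g \<in> G" and S: "finite S" "D \<subseteq> S" "g ` D \<subseteq> S" and fin: "finite \<L>"
    and cuts: "\<And>L. L \<in> \<L> \<Longrightarrow> L \<subseteq> S" "\<And>L s t. L \<in> \<L> \<Longrightarrow> s \<in> S \<Longrightarrow> t \<in> L \<Longrightarrow> s \<sqsubset> t \<Longrightarrow> s \<in> L"
    "\<And>L c. L \<in> \<L> \<Longrightarrow> c \<in> D \<Longrightarrow> c \<in> L \<longleftrightarrow> g c \<in> L"
  shows "\<exists>g'\<in>G. \<exists>\<Phi>. finite \<Phi> \<and> (\<forall>c\<in>D. g' c = g c) \<and> (\<forall>\<phi>\<in>\<Phi>. g' \<phi> = \<phi>) \<and> \<Phi> \<inter> S = {} \<and>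
     (\<forall>L\<in>\<L>. \<exists>\<phi>\<in>\<Phi>. \<forall>s\<in>S. s \<sqsubset> \<phi> \<longleftrightarrow> s \<in> L)"
  using fin cuts
proof (induction \<L>)
  case empty then show ?case using g by (intro bexI[of _ g] exI[of _ "{}"]) auto
next
  case (insert L \<L>)
  have "\<exists>g'\<in>G. \<exists>\<Phi>. finite \<Phi> \<and> (\<forall>c\<in>D. g' c = g c) \<and> (\<forall>\<phi>\<in>\<Phi>. g' \<phi> = \<phi>) \<and> \<Phi> \<inter> S = {} \<and>
     (\<forall>L\<in>\<L>. \<exists>\<phi>\<in>\<Phi>. \<forall>s\<in>S. s \<sqsubset> \<phi> \<longleftrightarrow> s \<in> L)"
    using insert.prems by (intro insert.IH) auto
  then obtain g' \<Phi> where g': "g' \<in> G" "finite \<Phi>" "\<forall>c\<in>D. g' c = g c" "\<forall>\<phi>\<in>\<Phi>. g' \<phi> = \<phi>" "\<Phi> \<inter> S = {}"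
     "\<forall>L\<in>\<L>. \<exists>\<phi>\<in>\<Phi>. \<forall>s\<in>S. s \<sqsubset> \<phi> \<longleftrightarrow> s \<in> L" by blast
  have L: "L \<subseteq> S" "\<And>s t. s \<in> S \<Longrightarrow> t \<in> L \<Longrightarrow> s \<sqsubset> t \<Longrightarrow> s \<in> L" "\<And>c. c \<in> D \<Longrightarrow> c \<in> L \<longleftrightarrow> g c \<in> L"
    using insert.prems by auto
  \<comment> \<open>The lower closure of \<open>L\<close> also decides the position of the new point
    among the points of \<open>\<Phi>\<close> added before.\<close>
  define P where "P s \<longleftrightarrow> (\<exists>t\<in>L. s \<sqsubseteq> t)" for s
  have PS: "P s \<longleftrightarrow> s \<in> L" if "s \<in> S" for s using L(2)[OF that] unfolding P_def le_def by blast
  obtain y r where y: "y \<notin> S \<union> \<Phi>" "\<And>s. s \<in> S \<union> \<Phi> \<Longrightarrow> s \<sqsubset> y \<longleftrightarrow> P s" "\<And>s. s \<in> S \<union> \<Phi> \<Longrightarrow> d y s = r"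
  proof (rule equidistant_point[of "S \<union> \<Phi>" P])
    show "P s" if "s \<sqsubset> t" "P t" for s t using that less_le_trans less_imp_le unfolding P_def by blast
  qed (use S g'(2) in auto)
  have "\<exists>h\<in>G. (\<forall>c\<in>D \<union> \<Phi>. h c = g' c) \<and> h y = y"
  proof (rule extend_fixing[OF g'(1) _ _ _ y(1) y(3)])
    show "finite (D \<union> \<Phi>)" using S g'(2) finite_subset by blast
    show "D \<union> \<Phi> \<subseteq> S \<union> \<Phi>" "g' ` (D \<union> \<Phi>) \<subseteq> S \<union> \<Phi>" using S g'(3,4) by auto
    fix c assume c: "c \<in> D \<union> \<Phi>"
    show "c \<sqsubset> y \<longleftrightarrow> g' c \<sqsubset> y"
    proof (cases "c \<in> \<Phi>")
      case True then show ?thesis using g'(4) by auto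
    next
      case False
      then have "c \<in> D" using c by auto
      then have "c \<in> S" "g c \<in> S" "g' c = g c" using S g'(3) by auto
      then show ?thesis using y(2)[of c] y(2)[of "g c"] PS L(3)[OF \<open>c \<in> D\<close>] by auto
    qed
  qed
  then obtain h where h: "h \<in> G" "\<forall>c\<in>D \<union> \<Phi>. h c = g' c" "h y = y" by blast
  have "\<forall>s\<in>S. s \<sqsubset> y \<longleftrightarrow> s \<in> L" using y(2) PS by auto
  then have "\<forall>L\<in>insert L \<L>. \<exists>\<phi>\<in>insert y \<Phi>. \<forall>s\<in>S. s \<sqsubset> \<phi> \<longleftrightarrow> s \<in> L" using g'(6) by blast
  then show ?case using g' h y(1) by (intro bexI[OF _ h(1)] exI[of _ "insert y \<Phi>"]) auto
qed

lemma not_separated_iff: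
  assumes "x \<notin> A" "y \<notin> A"
  shows "\<not> separated A x y \<longleftrightarrow> (\<forall>\<alpha>\<in>A. \<alpha> \<sqsubset> x \<longleftrightarrow> \<alpha> \<sqsubset> y)"
proof
  assume ns: "\<not> separated A x y"
  show "\<forall>\<alpha>\<in>A. \<alpha> \<sqsubset> x \<longleftrightarrow> \<alpha> \<sqsubset> y"
  proof
    fix \<alpha> assume "\<alpha> \<in> A"
    then have "\<not> (x \<sqsubset> \<alpha> \<and> \<alpha> \<sqsubset> y)" "\<not> (y \<sqsubset> \<alpha> \<and> \<alpha> \<sqsubset> x)" "x \<noteq> \<alpha>" "y \<noteq> \<alpha>"
      using ns assms unfolding separated_def by auto
    then show "\<alpha> \<sqsubset> x \<longleftrightarrow> \<alpha> \<sqsubset> y"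
      using lt_total[of x \<alpha>] lt_total[of y \<alpha>] by (auto dest: less_asym)
  qed
next
  assume eq: "\<forall>\<alpha>\<in>A. \<alpha> \<sqsubset> x \<longleftrightarrow> \<alpha> \<sqsubset> y"
  show "\<not> separated A x y"
  proof
    assume "separated A x y"
    then obtain \<alpha> where "\<alpha> \<in> A" "x \<sqsubset> \<alpha> \<and> \<alpha> \<sqsubset> y \<or> y \<sqsubset> \<alpha> \<and> \<alpha> \<sqsubset> x"
      unfolding separated_def by (elim bexE)
    moreover from this(1) eq have "\<alpha> \<sqsubset> x \<longleftrightarrow> \<alpha> \<sqsubset> y" by (rule bspec[rotated])
    ultimately show False by (auto dest: less_asym)
  qed
qed

text \<open>If a partial automorphism moves two points of a gap in opposite directions, then some cut between them is
  invariant. Placing a fixed point into every invariant cut thus makes the direction constant on gaps; gaps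
  next to \<open>F\<close> become empty, so their direction can be chosen towards \<open>F\<close>.\<close>

lemma adapted_extension:
  assumes g: "g \<in> G" and S: "finite S" "D \<subseteq> S" "g ` D \<subseteq> S" and F: "F \<subseteq> {x \<in> D. g x = x}" "F \<noteq> {}"
  shows "\<exists>g' A Up. adapted g' (D \<union> A) A Up \<and> (\<forall>c\<in>D. g' c = g c) \<and> A \<inter> S = {x \<in> D. g x = x} \<and>
     (\<forall>x z. x \<notin> A \<longrightarrow> z \<in> F \<longrightarrow> x \<sqsubset> z \<longrightarrow> (\<forall>\<alpha>\<in>A. \<alpha> \<sqsubset> z \<longrightarrow> \<alpha> \<sqsubset> x) \<longrightarrow> Up x) \<and>
     (\<forall>x z. x \<notin> A \<longrightarrow> z \<in> F \<longrightarrow> z \<sqsubset> x \<longrightarrow> (\<forall>\<alpha>\<in>A. z \<sqsubset> \<alpha> \<longrightarrow> x \<sqsubset> \<alpha>) \<longrightarrow> \<not> Up x)"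
proof -
  define \<L> where "\<L> = {L. L \<subseteq> S \<and> (\<forall>s\<in>S. \<forall>t\<in>L. s \<sqsubset> t \<longrightarrow> s \<in> L) \<and> (\<forall>c\<in>D. c \<in> L \<longleftrightarrow> g c \<in> L)}"
  have "finite \<L>" by (rule finite_subset[of _ "Pow S"]) (use S in \<open>auto simp: \<L>_def\<close>)
  then have "\<exists>g'\<in>G. \<exists>\<Phi>. finite \<Phi> \<and> (\<forall>c\<in>D. g' c = g c) \<and> (\<forall>\<phi>\<in>\<Phi>. g' \<phi> = \<phi>) \<and> \<Phi> \<inter> S = {} \<and>
     (\<forall>L\<in>\<L>. \<exists>\<phi>\<in>\<Phi>. \<forall>s\<in>S. s \<sqsubset> \<phi> \<longleftrightarrow> s \<in> L)"
    by (rule add_fixed_cuts[OF g S]) (auto simp: \<L>_def)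
  then obtain g' \<Phi> where g': "g' \<in> G" "finite \<Phi>" "\<forall>c\<in>D. g' c = g c" "\<forall>\<phi>\<in>\<Phi>. g' \<phi> = \<phi>" "\<Phi> \<inter> S = {}"
     and cuts: "\<forall>L\<in>\<L>. \<exists>\<phi>\<in>\<Phi>. \<forall>s\<in>S. s \<sqsubset> \<phi> \<longleftrightarrow> s \<in> L" by (elim bexE exE conjE)
  define A where "A = {x \<in> D. g x = x} \<union> \<Phi>"
  have FA: "F \<subseteq> A" "F \<subseteq> S" using F S unfolding A_def by auto
  have \<Phi>A: "\<Phi> \<subseteq> A" unfolding A_def by auto
  have DS: "c \<in> S" "g c \<in> S" if "c \<in> D" for c using that S by auto
  have cut_between: "\<exists>\<phi>\<in>\<Phi>. c \<sqsubset> \<phi> \<and> \<phi> \<sqsubset> c'"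
    if L: "L \<in> \<L>" "c \<in> L" "c' \<in> S" "c' \<notin> L" for c c' L
  proof -
    obtain \<phi> where \<phi>: "\<phi> \<in> \<Phi>" "\<forall>s\<in>S. s \<sqsubset> \<phi> \<longleftrightarrow> s \<in> L" using bspec[OF cuts L(1)] by (elim bexE)
    then have "c \<sqsubset> \<phi>" "\<not> c' \<sqsubset> \<phi>" using L unfolding \<L>_def by auto
    moreover have "c' \<noteq> \<phi>" using g'(5) \<phi>(1) L(3) by auto
    ultimately show ?thesis using \<phi>(1) by (intro bexI[of _ \<phi>]) auto
  qed
  \<comment> \<open>Points moving towards each other: the images of the upward moving points below
    \<open>c'\<close> generate the invariant lower half. They stay below \<open>c'\<close> because
    \<open>g c' \<sqsubset> c'\<close>.\<close>
  have sign1: "\<exists>\<phi>\<in>\<Phi>. c \<sqsubset> \<phi> \<and> \<phi> \<sqsubset> c'" if c: "c \<in> D" "c' \<in> D" "c \<sqsubset> c'" "c \<sqsubset> g c" "g c' \<sqsubset> c'" for c c'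
  proof (rule cut_between)
    let ?L = "{t \<in> S. \<exists>e\<in>D. e \<sqsubset> c' \<and> e \<sqsubset> g e \<and> t \<sqsubseteq> g e}"
    have below: "g e \<sqsubset> c'" if "e \<sqsubset> c'" for e using Aut_lt[OF g, of e c'] that c(5) by auto
    have inv: "x \<in> ?L \<longleftrightarrow> g x \<in> ?L" if "x \<in> D" for x
    proof
      assume "x \<in> ?L"
      then obtain e where e: "e \<in> D" "e \<sqsubset> c'" "e \<sqsubset> g e" "x \<sqsubseteq> g e" by blast
      show "g x \<in> ?L"
      proof (cases "x \<sqsubset> g x")
        case True
        have "x \<sqsubset> c'" using e below[of e] by auto
        then show ?thesis using True that DS by auto
      next
        case False
        then have "g x \<sqsubseteq> g e" using e by auto
        then show ?thesis using e DS[OF that] by blast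
      qed
    next
      assume "g x \<in> ?L"
      then obtain e where e: "e \<in> D" "e \<sqsubset> c'" "e \<sqsubset> g e" "g x \<sqsubseteq> g e" by blast
      then have "x \<sqsubseteq> g e" using g by auto
      then show "x \<in> ?L" using e DS[OF that] by blast
    qed
    then show "?L \<in> \<L>" unfolding \<L>_def by (auto intro: less_imp_le less_le_trans)
    show "c \<in> ?L" using c DS by auto
    show "c' \<in> S" using c DS by auto
    show "c' \<notin> ?L" using below by (auto dest: less_le_trans)
  qed
  \<comment> \<open>Points moving apart: here the downward moving points below \<open>c'\<close>
    generate the invariant lower half themselves, rather than their images.\<close>
  have sign2: "\<exists>\<phi>\<in>\<Phi>. c \<sqsubset> \<phi> \<and> \<phi> \<sqsubset> c'" if c: "c \<in> D" "c' \<in> D" "c \<sqsubset> c'" "g c \<sqsubset> c" "c' \<sqsubset> g c'" for c c'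
  proof (rule cut_between)
    let ?L = "{t \<in> S. \<exists>e\<in>D. e \<sqsubset> c' \<and> g e \<sqsubset> e \<and> t \<sqsubseteq> e}"
    have inv: "x \<in> ?L \<longleftrightarrow> g x \<in> ?L" if "x \<in> D" for x
    proof
      assume "x \<in> ?L"
      then obtain e where e: "e \<in> D" "e \<sqsubset> c'" "g e \<sqsubset> e" "x \<sqsubseteq> e" by blast
      then have "g x \<sqsubseteq> e" using Aut_le[OF g, of x e] by auto
      then show "g x \<in> ?L" using e DS[OF that] by blast
    next
      assume "g x \<in> ?L"
      then obtain e where e: "e \<in> D" "e \<sqsubset> c'" "g e \<sqsubset> e" "g x \<sqsubseteq> e" by blast
      show "x \<in> ?L"
      proof (cases "x \<sqsubseteq> e")
        case True then show ?thesis using e DS[OF that] by blast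
      next
        case False
        then have "g x \<sqsubset> x" using e by auto
        moreover have "x \<sqsubset> c'" using Aut_le[OF g, of c' x] e c(5) by auto
        ultimately show ?thesis using that DS[OF that] by auto
      qed
    qed
    then show "?L \<in> \<L>" unfolding \<L>_def by (auto intro: less_imp_le less_le_trans)
    show "c \<in> ?L" using c DS by auto
    show "c' \<in> S" using c DS by auto
    show "c' \<notin> ?L" by (auto dest: less_le_trans)
  qed
  have below: "\<exists>\<phi>\<in>\<Phi>. s \<sqsubset> \<phi> \<and> \<phi> \<sqsubset> z" if "z \<in> F" "s \<in> S" "s \<sqsubset> z" for s z
  proof (rule cut_between)
    have "c \<sqsubset> z \<longleftrightarrow> g c \<sqsubset> z" for c using F that Aut_lt[OF g, of c z] by auto
    then show "{t \<in> S. t \<sqsubset> z} \<in> \<L>" unfolding \<L>_def using DS by auto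
  qed (use that FA in auto)
  have above: "\<exists>\<phi>\<in>\<Phi>. z \<sqsubset> \<phi> \<and> \<phi> \<sqsubset> s" if "z \<in> F" "s \<in> S" "z \<sqsubset> s" for s z
  proof (rule cut_between)
    have "c \<sqsubseteq> z \<longleftrightarrow> g c \<sqsubseteq> z" for c using F that Aut_le[OF g, of c z] by auto
    then show "{t \<in> S. t \<sqsubseteq> z} \<in> \<L>" unfolding \<L>_def using DS by auto
  qed (use that FA in auto)
  \<comment> \<open>The direction of a gap is read off a point of \<open>D\<close> in it. The second
    disjunct describes the gap directly below a point of \<open>F\<close>, which has no such point;
    all other gaps without a point of \<open>D\<close> are declared to move down.\<close>
  define Up where "Up x \<longleftrightarrow> (\<exists>c\<in>D - A. \<not> separated A x c \<and> c \<sqsubset> g c) \<or> (\<exists>z\<in>F. x \<sqsubset> z \<and> (\<forall>\<alpha>\<in>A. \<alpha> \<sqsubset> z \<longrightarrow> \<alpha> \<sqsubset> x))" for x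
  have sgn: "Up c \<longleftrightarrow> c \<sqsubset> g c" if c: "c \<in> D" "c \<notin> A" for c
  proof
    assume "c \<sqsubset> g c"
    moreover have "\<not> separated A c c" unfolding separated_def by (auto dest: less_asym)
    ultimately show "Up c" unfolding Up_def using c by blast
  next
    assume "Up c"
    then consider c' where "c' \<in> D" "c' \<notin> A" "\<not> separated A c c'" "c' \<sqsubset> g c'"
      | z where "z \<in> F" "c \<sqsubset> z" "\<forall>\<alpha>\<in>A. \<alpha> \<sqsubset> z \<longrightarrow> \<alpha> \<sqsubset> c" unfolding Up_def by blast
    then show "c \<sqsubset> g c"
    proof cases
      case 1
      show ?thesis
      proof (rule ccontr)
        assume "\<not> c \<sqsubset> g c"
        then have gc: "g c \<sqsubset> c" using c unfolding A_def by (auto simp: not_less le_def)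
        then have "c \<noteq> c'" using 1(4) by auto
        then have "c \<sqsubset> c' \<or> c' \<sqsubset> c" using lt_total by blast
        then show False
          using sign1[of c' c] sign2[of c c'] 1 gc c(1) \<Phi>A unfolding separated_def by blast
      qed
    next
      case 2 then show ?thesis using below[of z c] DS c \<Phi>A by (blast dest: less_asym)
    qed
  qed
  have sep: "separated A x y" if xy: "x \<notin> A" "y \<notin> A" "Up x" "\<not> Up y" for x y
  proof (rule ccontr)
    assume "\<not> separated A x y"
    then have eq: "\<alpha> \<sqsubset> x \<longleftrightarrow> \<alpha> \<sqsubset> y" if "\<alpha> \<in> A" for \<alpha> using not_separated_iff[OF xy(1,2)] that by blast
    from xy(3) consider c' where "c' \<in> D" "c' \<notin> A" "\<not> separated A x c'" "c' \<sqsubset> g c'"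
      | z where "z \<in> F" "x \<sqsubset> z" "\<forall>\<alpha>\<in>A. \<alpha> \<sqsubset> z \<longrightarrow> \<alpha> \<sqsubset> x" unfolding Up_def by blast
    then show False
    proof cases
      case 1
      then have "\<not> separated A y c'" using eq xy not_separated_iff by metis
      then show ?thesis using 1 xy(4) unfolding Up_def by blast
    next
      case 2
      then have "z \<in> A" using FA by auto
      then have "y \<sqsubset> z" using eq[of z] 2(2) xy(2) lt_total[of y z] by (auto dest: less_asym)
      then show ?thesis using 2 eq xy(4) unfolding Up_def by blast
    qed
  qed
  have "adapted g' (D \<union> A) A Up"
    unfolding adapted_def
  proof (intro conjI allI impI ballI)
    show "finite (D \<union> A)" using S(1,2) g'(2) finite_subset unfolding A_def by auto
    show "A \<noteq> {}" using F FA by auto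
    show "g' \<alpha> = \<alpha>" if "\<alpha> \<in> A" for \<alpha> using that g'(3,4) unfolding A_def by auto
    show "separated A x y" if "x \<notin> A" "y \<notin> A" "Up x \<noteq> Up y" for x y
      using sep[of x y] sep[of y x] that unfolding separated_def by blast
    show "if Up c then c \<sqsubset> g' c else g' c \<sqsubset> c" if c: "c \<in> D \<union> A - A" for c
    proof -
      have "g c \<noteq> c" using c unfolding A_def by auto
      then show ?thesis using sgn[of c] c g'(3) lt_total[of c "g c"] by auto
    qed
  qed (use g' in auto)
  moreover have "A \<inter> S = {x \<in> D. g x = x}" using g'(5) S unfolding A_def by auto
  moreover have "\<not> Up x" if x: "x \<notin> A" "z \<in> F" "z \<sqsubset> x" "\<forall>\<alpha>\<in>A. z \<sqsubset> \<alpha> \<longrightarrow> x \<sqsubset> \<alpha>" for x z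
  proof
    assume "Up x"
    then consider c' where "c' \<in> D" "c' \<notin> A" "\<not> separated A x c'" "c' \<sqsubset> g c'"
      | z' where "z' \<in> F" "x \<sqsubset> z'" "\<forall>\<alpha>\<in>A. \<alpha> \<sqsubset> z' \<longrightarrow> \<alpha> \<sqsubset> x" unfolding Up_def by blast
    then show False
    proof cases
      case 1
      then have eq: "\<alpha> \<sqsubset> x \<longleftrightarrow> \<alpha> \<sqsubset> c'" if "\<alpha> \<in> A" for \<alpha> using not_separated_iff[OF x(1) 1(2)] that by blast
      have "z \<sqsubset> c'" using eq[of z] x FA by auto
      then obtain \<phi> where "\<phi> \<in> \<Phi>" "z \<sqsubset> \<phi>" "\<phi> \<sqsubset> c'" using above[OF x(2) DS(1)[OF 1(1)]] by blast
      then show ?thesis using eq[of \<phi>] \<Phi>A x(4) by (blast dest: less_asym)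
    next
      case 2
      \<comment> \<open>A gap with both ends in \<open>F\<close> would have to move both ways; the
        fixed point placed directly above \<open>z\<close> rules it out.\<close>
      have "z \<sqsubset> z'" using 2(2) x(3) by (rule less_trans[rotated])
      then obtain \<phi> where "\<phi> \<in> \<Phi>" "z \<sqsubset> \<phi>" "\<phi> \<sqsubset> z'" using above[OF x(2), of z'] FA 2 by blast
      then show ?thesis using 2(3) \<Phi>A x(4) by (blast dest: less_asym)
    qed
  qed
  moreover have "Up x" if x: "z \<in> F" "x \<sqsubset> z" "\<forall>\<alpha>\<in>A. \<alpha> \<sqsubset> z \<longrightarrow> \<alpha> \<sqsubset> x" for x z
    unfolding Up_def using x by blast
  ultimately show ?thesis using g'(3) by blast
qed

end

subsection \<open>Words in a pair of mixing automorphisms\<close>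


text \<open>The head of a word acts first, so the recursion follows the path of a point;
  concatenation therefore reverses composition.\<close>

primrec ev :: "(bool \<Rightarrow> 'a \<Rightarrow> 'a) \<Rightarrow> (bool \<times> bool) list \<Rightarrow> 'a \<Rightarrow> 'a" where
  "ev f [] = id"
| "ev f (l # w) = ev f w \<circ> (if snd l then f (fst l) else inv (f (fst l)))"

lemma ev_append: "ev f (u @ w) = ev f w \<circ> ev f u"
  by (induction u) (auto simp: comp_assoc)

lemma ev_replicate_True: "ev f (replicate k (i, True)) = f i ^^ k"
  and ev_replicate_False: "ev f (replicate k (i, False)) = inv (f i) ^^ k"
  by (induction k) (simp_all only: replicate.simps ev.simps fst_conv snd_conv if_True if_False funpow_Suc_right funpow.simps(1))

context QU begin

lemma ev_in_G:
  assumes "\<And>i. f i \<in> G" shows "ev f w \<in> G"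
proof (induction w)
  case Nil show ?case unfolding ev.simps by (rule Aut_id)
next
  case (Cons l w) then show ?case unfolding ev.simps by (intro Aut_comp) (use assms in auto)
qed

text \<open>Only the path of \<open>x\<close> under the word matters. Both ends of each of its steps
  are recorded, since an inverse letter is controlled by the value at the end point of the
  step.\<close>

lemma ev_continuous:
  assumes f: "\<And>i. f i \<in> G"
  shows "\<exists>H. finite H \<and> (\<forall>f'. (\<forall>i. f' i \<in> G) \<longrightarrow> (\<forall>i. \<forall>c\<in>H. f' i c = f i c) \<longrightarrow> ev f' w x = ev f w x)"
proof (induction w arbitrary: x)
  case Nil then show ?case by auto
next
  case (Cons l w)
  obtain i e where l: "l = (i, e)" by (cases l)
  define y where "y = (if e then f i x else inv (f i) x)"
  obtain H where H: "finite H" "\<And>f'. (\<forall>i. f' i \<in> G) \<Longrightarrow> (\<forall>i. \<forall>c\<in>H. f' i c = f i c) \<Longrightarrow> ev f' w y = ev f w y"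
    using Cons.IH[of y] by blast
  have "ev f' (l # w) x = ev f (l # w) x"
    if f': "\<forall>i. f' i \<in> G" "\<forall>i. \<forall>c\<in>insert x (insert y H). f' i c = f i c" for f'
  proof -
    have "(if e then f' i x else inv (f' i) x) = y"
    proof (cases e)
      case False
      then have "f' i y = x" using f' f by (auto simp: y_def)
      then show ?thesis using False f' by (metis Aut_inv_f)
    qed (use f' in \<open>auto simp: y_def\<close>)
    then show ?thesis using H(2)[of f'] f' l by (auto simp: y_def)
  qed
  then show ?case using H(1) by (intro exI[of _ "insert x (insert y H)"]) auto
qed

lemma ev_continuous_finite:
  assumes f: "\<And>i. f i \<in> G" and "finite B"
  shows "\<exists>H. finite H \<and> (\<forall>f'. (\<forall>i. f' i \<in> G) \<longrightarrow> (\<forall>i. \<forall>c\<in>H. f' i c = f i c) \<longrightarrow> (\<forall>x\<in>B. ev f' w x = ev f w x))"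
proof -
  have "\<forall>x. \<exists>H. finite H \<and> (\<forall>f'. (\<forall>i. f' i \<in> G) \<longrightarrow> (\<forall>i. \<forall>c\<in>H. f' i c = f i c) \<longrightarrow> ev f' w x = ev f w x)"
    by (intro allI ev_continuous f)
  from choice[OF this] obtain H where "\<forall>x. finite (H x) \<and>
      (\<forall>f'. (\<forall>i. f' i \<in> G) \<longrightarrow> (\<forall>i. \<forall>c\<in>H x. f' i c = f i c) \<longrightarrow> ev f' w x = ev f w x)"
    by (elim exE)
  then show ?thesis using assms(2) by (intro exI[of _ "\<Union>x\<in>B. H x"]) auto
qed

end

text \<open>Every word fixes \<open>Z\<close>, so \<open>Z\<close> cuts the order into intervals
  that no word leaves. By the zone assumptions each \<open>f i\<close> moves towards a point of
  \<open>Z\<close> in the gaps of \<open>A i\<close> adjacent to it, so a point that has come close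
  to an end of its interval is only driven further.\<close>

locale mixing_pair = QU +
  fixes f :: "bool \<Rightarrow> 'a \<Rightarrow> 'a" and A :: "bool \<Rightarrow> 'a set" and Up :: "bool \<Rightarrow> 'a \<Rightarrow> bool" and Z :: "'a set"
  assumes mix: "\<And>i. mixing (f i) (A i) (Up i)" and Z: "Z = A True \<inter> A False"
    and zone_up: "\<And>i x z. x \<notin> A i \<Longrightarrow> z \<in> Z \<Longrightarrow> x \<sqsubset> z \<Longrightarrow> (\<forall>\<alpha>\<in>A i. \<alpha> \<sqsubset> z \<longrightarrow> \<alpha> \<sqsubset> x) \<Longrightarrow> Up i x"
    and zone_down: "\<And>i x z. x \<notin> A i \<Longrightarrow> z \<in> Z \<Longrightarrow> z \<sqsubset> x \<Longrightarrow> (\<forall>\<alpha>\<in>A i. z \<sqsubset> \<alpha> \<longrightarrow> x \<sqsubset> \<alpha>) \<Longrightarrow> \<not> Up i x"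
begin

lemma f_G [simp]: "f i \<in> G" and A_fin: "finite (A i)" and f_A: "\<alpha> \<in> A i \<Longrightarrow> f i \<alpha> = \<alpha>"
  and mixesE: "finite Y \<Longrightarrow> finite T \<Longrightarrow> \<exists>k. mixes (f i) (A i) (Up i) Y T k"
  and mixes_invE: "finite Y \<Longrightarrow> finite T \<Longrightarrow> \<exists>k. mixes (inv (f i)) (A i) (\<lambda>x. \<not> Up i x) Y T k"
  using mix[of i] unfolding mixing_def by auto

lemma Z_A: "Z \<subseteq> A i" using Z by (cases i) auto

lemma Z_fin: "finite Z" using A_fin finite_subset[OF Z_A] by blast

lemma notin_Z: "x \<notin> Z \<Longrightarrow> \<exists>i. x \<notin> A i" using Z by blast

lemma funpow_fix: "g x = x \<Longrightarrow> (g ^^ k) x = x"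
  by (induction k) auto

definition W where "W = range (ev f)"

lemma W_G: "g \<in> W \<Longrightarrow> g \<in> G" using ev_in_G[of f] unfolding W_def by auto

lemma W_comp: assumes "g \<in> W" "h \<in> W" shows "g \<circ> h \<in> W"
proof -
  obtain u w where "g = ev f u" "h = ev f w" using assms unfolding W_def by blast
  then have "g \<circ> h = ev f (w @ u)" by (simp add: ev_append)
  then show ?thesis unfolding W_def by blast
qed

lemma W_id: "id \<in> W" unfolding W_def using ev.simps(1)[of f] by (metis rangeI)

lemma W_pow: "f i ^^ k \<in> W" "inv (f i) ^^ k \<in> W"
  unfolding W_def using ev_replicate_True[of f] ev_replicate_False[of f] by (metis rangeI)+

lemma inv_f_A: "\<alpha> \<in> A i \<Longrightarrow> inv (f i) \<alpha> = \<alpha>"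
  using f_A[of \<alpha> i] Aut_inv_f[OF f_G, of i \<alpha>] by simp

lemma W_Z: assumes "g \<in> W" "z \<in> Z" shows "g z = z"
proof -
  have "ev f w z = z" for w
    by (induction w) (use assms(2) Z_A f_A inv_f_A in \<open>auto simp: subset_iff\<close>)
  then show ?thesis using assms(1) unfolding W_def by auto
qed

lemma W_lt_Z: "g \<in> W \<Longrightarrow> z \<in> Z \<Longrightarrow> g x \<sqsubset> z \<longleftrightarrow> x \<sqsubset> z" "g \<in> W \<Longrightarrow> z \<in> Z \<Longrightarrow> z \<sqsubset> g x \<longleftrightarrow> z \<sqsubset> x"
  using W_Z[of g z] Aut_lt[OF W_G, of g x z] Aut_lt[OF W_G, of g z x] by auto

section \<open>Independence in the order over the common fixed points\<close>

lemma step_up: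
  assumes "y \<notin> A i" "finite T"
  shows "\<exists>g\<in>W. (\<forall>\<alpha>\<in>A i. g \<alpha> = \<alpha>) \<and> (\<forall>t\<in>T. g y \<sqsubseteq> t \<longrightarrow> (\<exists>\<alpha>\<in>A i. g y \<sqsubset> \<alpha> \<and> \<alpha> \<sqsubseteq> t))"
proof (cases "Up i y")
  case True
  obtain k where "mixes (f i) (A i) (Up i) {y} T k" using mixesE assms(2) by blast
  moreover have "\<forall>\<alpha>\<in>A i. (f i ^^ k) \<alpha> = \<alpha>" by (auto intro!: funpow_fix f_A)
  ultimately show ?thesis using True assms(1) W_pow(1)[where i=i and k=k]
    unfolding mixes_def by (intro bexI[of _ "f i ^^ k"]) auto
next
  case False
  obtain k where "mixes (inv (f i)) (A i) (\<lambda>x. \<not> Up i x) {y} T k" using mixes_invE assms(2) by blast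
  moreover have "\<forall>\<alpha>\<in>A i. (inv (f i) ^^ k) \<alpha> = \<alpha>" by (auto intro!: funpow_fix inv_f_A)
  ultimately show ?thesis using False assms(1) W_pow(2)[where i=i and k=k]
    unfolding mixes_def by (intro bexI[of _ "inv (f i) ^^ k"]) auto
qed

text \<open>A word is taken for which the image of \<open>y\<close> has passed the most points of
  the finite set \<open>V\<close>. The next point \<open>\<alpha>\<close> of \<open>V\<close> is not
  in \<open>Z\<close>, hence outside some \<open>A i\<close>, and \<open>step_up\<close> for this
  \<open>i\<close> passes \<open>\<alpha>\<close>: a point of \<open>A i\<close> stopping it earlier
  would lie in \<open>V\<close> and contradict the choice of \<open>\<alpha>\<close>.\<close>

lemma climb:
  assumes z: "z \<in> Z" "y \<sqsubset> z" "h \<sqsubset> z" "\<And>\<zeta>. \<zeta> \<in> Z \<Longrightarrow> \<zeta> \<sqsubset> z \<Longrightarrow> \<zeta> \<sqsubset> y"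
  shows "\<exists>g\<in>W. h \<sqsubset> g y"
proof -
  define V where "V = {\<alpha> \<in> insert h (A True \<union> A False). \<alpha> \<sqsubset> z}"
  have V: "finite V" "h \<in> V" using A_fin z(3) unfolding V_def by auto
  have AV: "\<alpha> \<in> V" if "\<alpha> \<in> A i" "\<alpha> \<sqsubset> z" for \<alpha> i using that unfolding V_def by (cases i) auto
  define cnt where "cnt g = card {v \<in> V. v \<sqsubset> g y}" for g
  have "\<forall>g. g \<in> W \<longrightarrow> cnt g \<le> card V" unfolding cnt_def using V(1) by (auto intro: card_mono)
  then obtain g where g: "g \<in> W" "\<And>g'. g' \<in> W \<Longrightarrow> cnt g' \<le> cnt g"
    using ex_has_greatest_nat[of "\<lambda>g. g \<in> W" id cnt "card V + 1"] W_id by (auto simp: less_Suc_eq_le)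
  show ?thesis
  proof (rule ccontr)
    assume "\<not> ?thesis"
    then have "\<not> h \<sqsubset> g y" using g(1) by blast
    then have hg: "g y \<sqsubseteq> h" by simp
    define U where "U = {v \<in> V. g y \<sqsubseteq> v}"
    have U: "finite U" "h \<in> U" using V hg unfolding U_def by auto
    define \<alpha> where "\<alpha> = Min U"
    have \<alpha>: "\<alpha> \<in> V" "g y \<sqsubseteq> \<alpha>" using Min_in[OF U(1)] U(2) unfolding \<alpha>_def U_def by auto
    have \<alpha>min: "\<alpha> \<sqsubseteq> v" if "v \<in> V" "g y \<sqsubseteq> v" for v using Min_le[OF U(1), of v] that unfolding \<alpha>_def U_def by auto
    have \<alpha>z: "\<alpha> \<sqsubset> z" using \<alpha>(1) unfolding V_def by auto
    have "\<alpha> \<notin> Z" using z(4) W_lt_Z(2)[OF g(1)] \<alpha>z \<alpha>(2) by (auto simp: not_less[symmetric])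
    then obtain i where i: "\<alpha> \<notin> A i" using notin_Z by blast
    have gyz: "g y \<sqsubset> z" using W_lt_Z(1)[OF g(1) z(1)] z(2) by simp
    have gy: "g y \<notin> A i"
    proof
      assume "g y \<in> A i"
      then have "\<alpha> \<sqsubseteq> g y" using \<alpha>min AV gyz by blast
      then have "\<alpha> = g y" using \<alpha>(2) by auto
      then show False using i \<open>g y \<in> A i\<close> by simp
    qed
    obtain g' where g': "g' \<in> W" "\<forall>\<alpha>\<in>A i. g' \<alpha> = \<alpha>" "\<forall>t\<in>insert (g y) V. g' (g y) \<sqsubseteq> t \<longrightarrow> (\<exists>\<alpha>\<in>A i. g' (g y) \<sqsubset> \<alpha> \<and> \<alpha> \<sqsubseteq> t)"
      using step_up[OF gy, of "insert (g y) V"] V(1) by auto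
    have below: "g y \<sqsubset> \<beta>" if "\<beta> \<in> A i" "g' (g y) \<sqsubset> \<beta>" for \<beta>
      using Aut_lt[OF W_G[OF g'(1)], of "g y" \<beta>] g'(2) that by auto
    have 1: "g y \<sqsubset> g' (g y)"
    proof (rule ccontr)
      assume "\<not> ?thesis"
      then have "g' (g y) \<sqsubseteq> g y" by auto
      then obtain \<beta> where \<beta>: "\<beta> \<in> A i" "g' (g y) \<sqsubset> \<beta>" "\<beta> \<sqsubseteq> g y" using g'(3) by blast
      then show False using below[OF \<beta>(1,2)] by auto
    qed
    have 2: "\<alpha> \<sqsubset> g' (g y)"
    proof (rule ccontr)
      assume "\<not> ?thesis"
      then have "g' (g y) \<sqsubseteq> \<alpha>" by auto
      then obtain \<beta> where \<beta>: "\<beta> \<in> A i" "g' (g y) \<sqsubset> \<beta>" "\<beta> \<sqsubseteq> \<alpha>" using g'(3) \<alpha>(1) by blast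
      then have "g y \<sqsubset> \<beta>" using below by blast
      moreover have "\<beta> \<in> V" using AV[OF \<beta>(1)] \<beta>(3) \<alpha>z by auto
      ultimately have "\<alpha> \<sqsubseteq> \<beta>" using \<alpha>min by auto
      then have "\<alpha> = \<beta>" using \<beta>(3) by order
      then show False using \<beta>(1) i by simp
    qed
    have "{v \<in> V. v \<sqsubset> g y} \<subset> {v \<in> V. v \<sqsubset> (g' \<circ> g) y}"
    proof
      show "{v \<in> V. v \<sqsubset> g y} \<subseteq> {v \<in> V. v \<sqsubset> (g' \<circ> g) y}" using 1 by (auto dest: less_trans)
      have "\<alpha> \<in> {v \<in> V. v \<sqsubset> (g' \<circ> g) y}" "\<alpha> \<notin> {v \<in> V. v \<sqsubset> g y}" using 2 \<alpha> by auto
      then show "{v \<in> V. v \<sqsubset> g y} \<noteq> {v \<in> V. v \<sqsubset> (g' \<circ> g) y}" by blast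
    qed
    then have "cnt g < cnt (g' \<circ> g)" unfolding cnt_def using V(1) by (intro psubset_card_mono) auto
    then show False using g(2)[OF W_comp[OF g'(1) g(1)]] by auto
  qed
qed

text \<open>Inside its interval of \<open>Z\<close>, a point with \<open>top T\<close> lies strictly
  above every point of \<open>T\<close>, and one with \<open>bot T\<close> strictly below.
  \<open>extreme\<close> admits both ends since \<open>all_extreme\<close> does not control which
  end is reached.\<close>

definition top where "top T y \<longleftrightarrow> (\<forall>t\<in>T. y \<sqsubseteq> t \<longrightarrow> (\<exists>z\<in>Z. y \<sqsubset> z \<and> z \<sqsubseteq> t))"
definition bot where "bot T y \<longleftrightarrow> (\<forall>t\<in>T. t \<sqsubseteq> y \<longrightarrow> (\<exists>z\<in>Z. z \<sqsubset> y \<and> t \<sqsubseteq> z))"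
definition extreme where "extreme T y \<longleftrightarrow> top T y \<or> bot T y"
definition inner where "inner x \<longleftrightarrow> x \<notin> Z \<and> (\<exists>z\<in>Z. z \<sqsubset> x) \<and> (\<exists>z\<in>Z. x \<sqsubset> z)"

lemma extreme_subset: "extreme T y \<Longrightarrow> T' \<subseteq> T \<Longrightarrow> extreme T' y"
  unfolding extreme_def top_def bot_def by blast

lemma extreme_image:
  assumes "g \<in> W" "extreme T y" shows "extreme (g ` T) (g y)"
proof -
  have "top (g ` T) (g y)" if "top T y"
    unfolding top_def
  proof (intro ballI impI)
    fix t assume "t \<in> g ` T" "g y \<sqsubseteq> t"
    then obtain s where s: "s \<in> T" "t = g s" "y \<sqsubseteq> s" using W_G[OF assms(1)] by auto
    then obtain z where "z \<in> Z" "y \<sqsubset> z" "z \<sqsubseteq> s" using \<open>top T y\<close> unfolding top_def by blast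
    then show "\<exists>z\<in>Z. g y \<sqsubset> z \<and> z \<sqsubseteq> t"
      using W_lt_Z(1)[OF assms(1)] W_Z[OF assms(1)] Aut_le[OF W_G[OF assms(1)], of z s] s by (intro bexI[of _ z]) auto
  qed
  moreover have "bot (g ` T) (g y)" if "bot T y"
    unfolding bot_def
  proof (intro ballI impI)
    fix t assume "t \<in> g ` T" "t \<sqsubseteq> g y"
    then obtain s where s: "s \<in> T" "t = g s" "s \<sqsubseteq> y" using W_G[OF assms(1)] by auto
    then obtain z where "z \<in> Z" "z \<sqsubset> y" "s \<sqsubseteq> z" using \<open>bot T y\<close> unfolding bot_def by blast
    then show "\<exists>z\<in>Z. z \<sqsubset> g y \<and> t \<sqsubseteq> z"
      using W_lt_Z(2)[OF assms(1)] W_Z[OF assms(1)] Aut_le[OF W_G[OF assms(1)], of s z] s by (intro bexI[of _ z]) auto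
  qed
  ultimately show ?thesis using assms(2) unfolding extreme_def by blast
qed

lemma inner_W: "g \<in> W \<Longrightarrow> inner x \<Longrightarrow> inner (g x)"
  unfolding inner_def using W_lt_Z W_Z fixes_notin[OF W_G, of g Z x] by auto

text \<open>A fixed word \<open>g\<close> carries the lowest point \<open>l\<close> of
  \<open>S\<close> in the interval of \<open>x\<close> above the highest one \<open>h\<close>.
  Whatever \<open>v\<close> does to \<open>x\<close>, either \<open>v x\<close> is already below
  \<open>l\<close>, or \<open>g (v x)\<close> is above \<open>h\<close>.\<close>

lemma all_extreme:
  assumes "finite B" "\<And>x. x \<in> B \<Longrightarrow> inner x" "finite S"
  shows "\<exists>g\<in>W. \<forall>x\<in>B. extreme S (g x)"
  using assms
proof (induction B arbitrary: S)
  case empty then show ?case using W_id by blast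
next
  case (insert x B)
  define z1 where "z1 = Max {z \<in> Z. z \<sqsubset> x}"
  define z2 where "z2 = Min {z \<in> Z. x \<sqsubset> z}"
  have x: "inner x" using insert.prems by auto
  have "z1 \<in> {z \<in> Z. z \<sqsubset> x}" "z2 \<in> {z \<in> Z. x \<sqsubset> z}"
    unfolding z1_def z2_def using x Z_fin unfolding inner_def by (intro Max_in Min_in; auto)+
  then have z: "z1 \<in> Z" "z1 \<sqsubset> x" "z2 \<in> Z" "x \<sqsubset> z2" by auto
  have z1: "\<zeta> \<sqsubseteq> z1" if "\<zeta> \<in> Z" "\<zeta> \<sqsubset> x" for \<zeta> unfolding z1_def using that Z_fin by (intro Max_ge) auto
  have z2: "z2 \<sqsubseteq> \<zeta>" if "\<zeta> \<in> Z" "x \<sqsubset> \<zeta>" for \<zeta> unfolding z2_def using that Z_fin by (intro Min_le) auto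
  define S0 where "S0 = {s \<in> S. z1 \<sqsubset> s \<and> s \<sqsubset> z2}"
  show ?case
  proof (cases "S0 = {}")
    case True
    obtain g where g: "g \<in> W" "\<forall>x\<in>B. extreme S (g x)" using insert.IH[OF _ insert.prems(2)] insert.prems by auto
    have "z1 \<sqsubset> g x" "g x \<sqsubset> z2" using W_lt_Z[OF g(1)] z by auto
    then have "top S (g x)"
      unfolding top_def using True z(3) unfolding S0_def by (fastforce simp: not_less[symmetric])
    then show ?thesis using g unfolding extreme_def by (intro bexI[OF _ g(1)]) auto
  next
    case False
    have S0: "finite S0" using insert.prems S0_def by auto
    define l where "l = Min S0"
    define h where "h = Max S0"
    have lh: "l \<in> S0" "h \<in> S0" unfolding l_def h_def using S0 False by auto
    have l: "l \<sqsubseteq> s" if "s \<in> S0" for s using S0 that unfolding l_def by auto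
    have h: "s \<sqsubseteq> h" if "s \<in> S0" for s using S0 that unfolding h_def by auto
    have "\<exists>g\<in>W. h \<sqsubset> g l"
    proof (rule climb[OF z(3)])
      show "l \<sqsubset> z2" "h \<sqsubset> z2" using lh unfolding S0_def by auto
      fix \<zeta> assume \<zeta>: "\<zeta> \<in> Z" "\<zeta> \<sqsubset> z2"
      then have "\<not> x \<sqsubset> \<zeta>" "\<zeta> \<noteq> x" using z2 x unfolding inner_def by (auto simp: not_less[symmetric])
      then have "\<zeta> \<sqsubseteq> z1" using z1[OF \<zeta>(1)] by auto
      then show "\<zeta> \<sqsubset> l" using lh unfolding S0_def by auto
    qed
    then obtain g where g: "g \<in> W" "h \<sqsubset> g l" by blast
    \<comment> \<open>\<open>g\<close> is chosen before \<open>v\<close>, so the induction hypothesis can be made to survive an application of \<open>g\<close>.\<close>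
    have gG: "g \<in> G" using W_G[OF g(1)] .
    obtain v where v: "v \<in> W" "\<forall>x\<in>B. extreme (S \<union> inv g ` S) (v x)"
      using insert.IH[of "S \<union> inv g ` S"] insert.prems by auto
    have vx: "z1 \<sqsubset> v x" "v x \<sqsubset> z2" using W_lt_Z[OF v(1)] z by auto
    show ?thesis
    proof (cases "v x \<sqsubset> l")
      case True
      have "bot S (v x)" unfolding bot_def
      proof (intro ballI impI)
        fix s assume s: "s \<in> S" "s \<sqsubseteq> v x"
        then have "s \<notin> S0" using l[of s] True by auto
        then have "s \<sqsubseteq> z1" using s vx unfolding S0_def by auto
        then show "\<exists>z\<in>Z. z \<sqsubset> v x \<and> s \<sqsubseteq> z" using z(1) vx by blast
      qed
      moreover have "extreme S (v b)" if "b \<in> B" for b using v(2) that extreme_subset by blast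
      ultimately show ?thesis using v(1) unfolding extreme_def by (intro bexI[OF _ v(1)]) auto
    next
      case False
      then have "g l \<sqsubseteq> g (v x)" using gG by auto
      then have hv: "h \<sqsubset> g (v x)" using g(2) by auto
      have "top S (g (v x))" unfolding top_def
      proof (intro ballI impI)
        fix s assume s: "s \<in> S" "g (v x) \<sqsubseteq> s"
        then have "s \<notin> S0" using h[of s] hv by auto
        moreover have "z1 \<sqsubset> s" using s W_lt_Z(2)[OF g(1) z(1), of "v x"] vx by auto
        ultimately have "z2 \<sqsubseteq> s" using s unfolding S0_def by auto
        then show "\<exists>z\<in>Z. g (v x) \<sqsubset> z \<and> z \<sqsubseteq> s" using z(3) W_lt_Z(1)[OF g(1) z(3), of "v x"] vx by blast
      qed
      moreover have "extreme S (g (v b))" if "b \<in> B" for b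
      proof -
        have "extreme (g ` inv g ` S) (g (v b))"
          by (rule extreme_image[OF g(1) extreme_subset[OF bspec[OF v(2) that]]]) auto
        then show ?thesis using gG by (simp add: image_image)
      qed
      ultimately show ?thesis unfolding extreme_def by (intro bexI[OF _ W_comp[OF g(1) v(1)]]) auto
    qed
  qed
qed


text \<open>No point of \<open>A i\<close> is left between \<open>y\<close> and the next point of
  \<open>Z\<close>, so \<open>y\<close> is in the gap whose direction \<open>zone_up\<close>
  prescribes.\<close>

lemma top_Up:
  assumes "inner y" "top (A i) y" shows "y \<notin> A i" "Up i y"
proof -
  show yA: "y \<notin> A i" using assms(2) unfolding top_def by (force dest: leD)
  define z where "z = Min {z \<in> Z. y \<sqsubset> z}"
  have "z \<in> {z \<in> Z. y \<sqsubset> z}" unfolding z_def using assms(1) Z_fin unfolding inner_def by (intro Min_in) auto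
  then have z: "z \<in> Z" "y \<sqsubset> z" by auto
  show "Up i y"
  proof (rule zone_up[OF yA z], intro ballI impI, rule ccontr)
    fix \<alpha> assume \<alpha>: "\<alpha> \<in> A i" "\<alpha> \<sqsubset> z" "\<not> \<alpha> \<sqsubset> y"
    then obtain \<zeta> where \<zeta>: "\<zeta> \<in> Z" "y \<sqsubset> \<zeta>" "\<zeta> \<sqsubseteq> \<alpha>" using assms(2) unfolding top_def by auto
    have "z \<sqsubseteq> \<zeta>" unfolding z_def using \<zeta> Z_fin by (intro Min_le) auto
    then show False using \<zeta>(3) \<alpha>(2) by auto
  qed
qed

lemma bot_Down:
  assumes "inner y" "bot (A i) y" shows "y \<notin> A i" "\<not> Up i y"
proof -
  show yA: "y \<notin> A i" using assms(2) unfolding bot_def by (force dest: leD)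
  define z where "z = Max {z \<in> Z. z \<sqsubset> y}"
  have "z \<in> {z \<in> Z. z \<sqsubset> y}" unfolding z_def using assms(1) Z_fin unfolding inner_def by (intro Max_in) auto
  then have z: "z \<in> Z" "z \<sqsubset> y" by auto
  show "\<not> Up i y"
  proof (rule zone_down[OF yA z], intro ballI impI, rule ccontr)
    fix \<alpha> assume \<alpha>: "\<alpha> \<in> A i" "z \<sqsubset> \<alpha>" "\<not> y \<sqsubset> \<alpha>"
    then obtain \<zeta> where \<zeta>: "\<zeta> \<in> Z" "\<zeta> \<sqsubset> y" "\<alpha> \<sqsubseteq> \<zeta>" using assms(2) unfolding bot_def by auto
    have "\<zeta> \<sqsubseteq> z" unfolding z_def using \<zeta> Z_fin by (intro Max_ge) auto
    then show False using \<zeta>(3) \<alpha>(2) by auto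
  qed
qed

text \<open>An extreme point moves towards an end of its interval with no point of
  \<open>A i\<close> in its way, so the point of \<open>A i\<close> that \<open>mixes\<close>
  supplies between it and \<open>t\<close> lies at or beyond that end.\<close>

lemma extreme_pow:
  assumes m: "mixes (f i) (A i) (Up i) Y T k" and y: "y \<in> Y" "inner y" "extreme (A i) y"
  shows "extreme T ((f i ^^ k) y)"
proof -
  have fixA: "(f i ^^ k) \<alpha> = \<alpha>" if "\<alpha> \<in> A i" for \<alpha> by (intro funpow_fix f_A that)
  have fG: "f i ^^ k \<in> G" by simp
  have lt: "(f i ^^ k) y \<sqsubset> \<alpha> \<longleftrightarrow> y \<sqsubset> \<alpha>" "\<alpha> \<sqsubset> (f i ^^ k) y \<longleftrightarrow> \<alpha> \<sqsubset> y" if "\<alpha> \<in> A i" for \<alpha>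
    using Aut_lt[OF fG, of y \<alpha>] Aut_lt[OF fG, of \<alpha> y] fixA[OF that] by auto
  have ZA: "z \<in> A i" if "z \<in> Z" for z using that Z_A by blast
  have "top T ((f i ^^ k) y)" if top: "top (A i) y"
    unfolding top_def
  proof (intro ballI impI)
    fix t assume t: "t \<in> T" "(f i ^^ k) y \<sqsubseteq> t"
    then obtain \<alpha> where \<alpha>: "\<alpha> \<in> A i" "(f i ^^ k) y \<sqsubset> \<alpha>" "\<alpha> \<sqsubseteq> t"
      using m y(1) top_Up[OF y(2) top] unfolding mixes_def by blast
    then have "y \<sqsubseteq> \<alpha>" using lt by auto
    then obtain z where z: "z \<in> Z" "y \<sqsubset> z" "z \<sqsubseteq> \<alpha>" using top \<alpha>(1) unfolding top_def by blast
    then show "\<exists>z\<in>Z. (f i ^^ k) y \<sqsubset> z \<and> z \<sqsubseteq> t" using lt[OF ZA] \<alpha>(3) by (intro bexI[of _ z]) auto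
  qed
  moreover have "bot T ((f i ^^ k) y)" if bot: "bot (A i) y"
    unfolding bot_def
  proof (intro ballI impI)
    fix t assume t: "t \<in> T" "t \<sqsubseteq> (f i ^^ k) y"
    then obtain \<alpha> where \<alpha>: "\<alpha> \<in> A i" "\<alpha> \<sqsubset> (f i ^^ k) y" "t \<sqsubseteq> \<alpha>"
      using m y(1) bot_Down[OF y(2) bot] unfolding mixes_def by blast
    then have "\<alpha> \<sqsubseteq> y" using lt by auto
    then obtain z where z: "z \<in> Z" "z \<sqsubset> y" "\<alpha> \<sqsubseteq> z" using bot \<alpha>(1) unfolding bot_def by blast
    then show "\<exists>z\<in>Z. z \<sqsubset> (f i ^^ k) y \<and> t \<sqsubseteq> z" using lt[OF ZA] \<alpha>(3) by (intro bexI[of _ z]) auto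
  qed
  ultimately show ?thesis using y(3) unfolding extreme_def by blast
qed

section \<open>Metric independence over the common fixed points\<close>

definition dfree where "dfree y t \<longleftrightarrow> (\<exists>z\<in>Z. d y z + d z t \<le> d y t)"

lemma dfree_via: "dfree y \<alpha> \<Longrightarrow> d y \<alpha> + d \<alpha> t \<le> d y t \<Longrightarrow> dfree y t"
  unfolding dfree_def
proof (elim bexE)
  fix z assume "d y \<alpha> + d \<alpha> t \<le> d y t" "z \<in> Z" "d y z + d z \<alpha> \<le> d y \<alpha>"
  then show "\<exists>z\<in>Z. d y z + d z t \<le> d y t" using d_triangle[of z t \<alpha>] by (intro bexI[of _ z]) auto
qed

lemma d_pow: "\<alpha> \<in> A i \<Longrightarrow> d ((f i ^^ k) y) \<alpha> = d y \<alpha>"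
  using Aut_d[OF Aut_funpow[of "f i" k], of y \<alpha>] funpow_fix[of "f i" \<alpha> k] f_A[of \<alpha> i] by simp

lemma dfree_pow:
  assumes "dfree y \<alpha>" "\<alpha> \<in> A i" shows "dfree ((f i ^^ k) y) \<alpha>"
  using assms d_pow[where i=i and k=k and y=y] Z_A[of i] unfolding dfree_def by (auto simp: subset_iff)

text \<open>A shortest path from \<open>g2 x\<close> to \<open>t\<close> meets some
  \<open>\<beta>\<close> in \<open>A False\<close> and, traced back by one power, some
  \<open>\<alpha>\<close> in \<open>A True\<close>. Either they coincide and lie in
  \<open>Z\<close>, or the round adds at least \<open>\<delta>\<close>; freeness from an earlier
  round is kept.\<close>

lemma spread_out:
  assumes B: "finite B" "\<And>x. x \<in> B \<Longrightarrow> inner x"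
    and \<delta>: "\<And>s t. s \<in> A True \<union> A False \<Longrightarrow> t \<in> A True \<union> A False \<Longrightarrow> s \<noteq> t \<Longrightarrow> \<delta> \<le> d s t"
  shows "\<exists>g\<in>W. \<forall>x\<in>B. extreme (A True \<union> A False) (g x) \<and>
     (\<forall>t\<in>A True \<union> A False. dfree (g x) t \<or> of_nat n * \<delta> \<le> d (g x) t)"
proof (induction n)
  case 0
  have "finite (A True \<union> A False)" using A_fin by auto
  then show ?case using all_extreme[OF B] by auto
next
  case (Suc n)
  define T where "T = A True \<union> A False"
  have T: "finite T" "A i \<subseteq> T" for i using A_fin unfolding T_def by (auto, cases i, auto)
  obtain g where g: "g \<in> W" "\<And>x. x \<in> B \<Longrightarrow> extreme T (g x)"
    "\<And>x t. x \<in> B \<Longrightarrow> t \<in> T \<Longrightarrow> dfree (g x) t \<or> of_nat n * \<delta> \<le> d (g x) t" using Suc unfolding T_def by blast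
  obtain k where k: "mixes (f True) (A True) (Up True) (g ` B) T k" using mixesE B T by blast
  define g1 where "g1 = (f True ^^ k) \<circ> g"
  obtain l where l: "mixes (f False) (A False) (Up False) (g1 ` B) T l" using mixesE B T by blast
  define g2 where "g2 = (f False ^^ l) \<circ> g1"
  have W: "g1 \<in> W" "g2 \<in> W" unfolding g2_def g1_def by (intro W_comp W_pow g(1))+
  have ex1: "extreme T (g1 x)" if "x \<in> B" for x
    unfolding g1_def comp_apply using that
    by (intro extreme_pow[OF k] inner_W[OF g(1)] B(2) extreme_subset[OF g(2) T(2)]) auto
  have "extreme T (g2 x)" if "x \<in> B" for x
    unfolding g2_def comp_apply using that
    by (intro extreme_pow[OF l] inner_W[OF W(1)] B(2) extreme_subset[OF ex1 T(2)]) auto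
  moreover have "dfree (g2 x) t \<or> of_nat (Suc n) * \<delta> \<le> d (g2 x) t" if x: "x \<in> B" and t: "t \<in> T" for x t
  proof -
    obtain \<beta> where \<beta>: "\<beta> \<in> A False" "d (g2 x) \<beta> + d \<beta> t \<le> d (g2 x) t"
      using l x t unfolding mixes_def g2_def by auto
    have \<beta>T: "\<beta> \<in> T" using \<beta> T by auto
    then obtain \<alpha> where \<alpha>: "\<alpha> \<in> A True" "d (g1 x) \<alpha> + d \<alpha> \<beta> \<le> d (g1 x) \<beta>"
      using k x unfolding mixes_def g1_def by auto
    have \<alpha>T: "\<alpha> \<in> T" using \<alpha> T by auto
    have e1: "d (g1 x) \<alpha> = d (g x) \<alpha>" using d_pow[OF \<alpha>(1)] unfolding g1_def by simp
    have e2: "d (g2 x) \<beta> = d (g1 x) \<beta>" using d_pow[OF \<beta>(1)] unfolding g2_def by simp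
    show ?thesis
    proof (cases "\<alpha> = \<beta>")
      case True
      then have "\<beta> \<in> Z" using \<alpha> \<beta> Z by auto
      then show ?thesis using \<beta>(2) unfolding dfree_def by blast
    next
      case False
      from g(3)[OF x \<alpha>T] show ?thesis
      proof
        assume "dfree (g x) \<alpha>"
        then have "dfree (g1 x) \<alpha>" unfolding g1_def comp_apply by (rule dfree_pow[OF _ \<alpha>(1)])
        then have "dfree (g1 x) \<beta>" using \<alpha>(2) by (rule dfree_via)
        then have "dfree (g2 x) \<beta>" unfolding g2_def comp_apply by (rule dfree_pow[OF _ \<beta>(1)])
        then show ?thesis using dfree_via[OF _ \<beta>(2)] by blast
      next
        assume "of_nat n * \<delta> \<le> d (g x) \<alpha>"
        moreover have "\<delta> \<le> d \<alpha> \<beta>" using \<delta>[of \<alpha> \<beta>] False \<alpha>T \<beta>T unfolding T_def by auto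
        ultimately have "of_nat n * \<delta> + \<delta> \<le> d (g2 x) t" using e1 e2 \<alpha>(2) \<beta>(2) d_nonneg[of \<beta> t] by linarith
        then show ?thesis by (simp add: algebra_simps)
      qed
    qed
  qed
  ultimately show ?case using W(2) unfolding T_def by blast
qed

text \<open>The order of choices is essential: \<open>g\<close> precedes \<open>T\<close>, and only
  a power of \<open>f False\<close> depends on \<open>T\<close>. In \<open>fixed_image\<close> the
  set \<open>T\<close> contains the points at which \<open>g\<close> uses
  \<open>f True\<close>.\<close>

lemma independent_images:
  assumes B: "finite B" "\<And>x. x \<in> B \<Longrightarrow> inner x"
  shows "\<exists>g\<in>W. \<forall>T. finite T \<longrightarrow> (\<exists>k. \<forall>x\<in>B. extreme T ((f False ^^ k) (g x)) \<and> (\<forall>t\<in>T. dfree ((f False ^^ k) (g x)) t))"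
proof (cases "B = {}")
  case True then show ?thesis using W_id by blast
next
  case False
  then obtain z where z: "z \<in> Z" using B(2) unfolding inner_def by blast
  define T0 where "T0 = A True \<union> A False"
  have T0: "finite T0" "A i \<subseteq> T0" for i using A_fin unfolding T0_def by (auto, cases i, auto)
  obtain \<delta> where \<delta>: "0 < \<delta>" "\<forall>s\<in>T0. \<forall>t\<in>T0. s \<noteq> t \<longrightarrow> \<delta> \<le> d s t" using min_distance[OF T0(1)] by blast
  define M where "M = (\<Sum>x\<in>B. d x z) + (\<Sum>t\<in>T0. d z t)"
  \<comment> \<open>Words preserve the distance to \<open>z\<close> in \<open>Z\<close>, so a
    distance of at least \<open>n * \<delta>\<close>, and hence of at least \<open>M\<close>,
    already makes the path through \<open>z\<close> a shortest one.\<close>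
  obtain n :: nat where n: "M / \<delta> \<le> of_nat n" using real_arch_simple by blast
  then have n: "M \<le> of_nat n * \<delta>" using \<delta>(1) by (simp add: divide_le_eq)
  obtain g where g: "g \<in> W" "\<forall>x\<in>B. extreme T0 (g x) \<and> (\<forall>t\<in>T0. dfree (g x) t \<or> of_nat n * \<delta> \<le> d (g x) t)"
    using spread_out[OF B, of \<delta> n] \<delta>(2) unfolding T0_def by blast
  have free: "dfree (g x) t" if x: "x \<in> B" and t: "t \<in> T0" for x t
  proof -
    have "d (g x) z = d x z" using Aut_d[OF W_G[OF g(1)], of x z] W_Z[OF g(1) z] by simp
    moreover have "d x z + d z t \<le> M" unfolding M_def using B T0 x t by (intro add_mono member_le_sum) auto
    ultimately have "d (g x) z + d z t \<le> d (g x) t" if "of_nat n * \<delta> \<le> d (g x) t" using n that by linarith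
    then show ?thesis using g(2) x t z unfolding dfree_def by blast
  qed
  show ?thesis
  proof (intro bexI[OF _ g(1)] allI impI)
    fix T :: "'a set" assume "finite T"
    then obtain k where k: "mixes (f False) (A False) (Up False) (g ` B) T k" using mixesE B by blast
    have "extreme T ((f False ^^ k) (g x))" if "x \<in> B" for x
      using that g(2) by (intro extreme_pow[OF k] inner_W[OF g(1)] B(2) extreme_subset[OF _ T0(2)]) auto
    moreover have "dfree ((f False ^^ k) (g x)) t" if x: "x \<in> B" and t: "t \<in> T" for x t
    proof -
      obtain \<beta> where \<beta>: "\<beta> \<in> A False" "d ((f False ^^ k) (g x)) \<beta> + d \<beta> t \<le> d ((f False ^^ k) (g x)) t"
        using k x t unfolding mixes_def by auto
      have "dfree ((f False ^^ k) (g x)) \<beta>" by (rule dfree_pow[OF free[OF x] \<beta>(1)]) (use \<beta>(1) T0 in auto)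
      then show ?thesis using \<beta>(2) by (rule dfree_via)
    qed
    ultimately show "\<exists>k. \<forall>x\<in>B. extreme T ((f False ^^ k) (g x)) \<and> (\<forall>t\<in>T. dfree ((f False ^^ k) (g x)) t)" by blast
  qed
qed

text \<open>Distances and order between \<open>N\<close> and the points of \<open>E\<close>, or
  their images under \<open>a\<close>, are determined through \<open>Z\<close>, which
  \<open>a\<close> fixes. Hence \<open>a\<close> on \<open>E\<close> and the identity on
  \<open>N\<close> fit together to a partial automorphism.\<close>

lemma fixed_image:
  assumes B: "finite B" "\<And>x. x \<in> B \<Longrightarrow> inner x \<or> x \<in> Z" and D: "finite D"
  shows "\<exists>a\<in>G. (\<forall>c\<in>D. a c = f True c) \<and> (\<exists>w. \<forall>x\<in>B. a (ev (f(True := a)) w x) = ev (f(True := a)) w x)"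
proof -
  define B0 where "B0 = {x \<in> B. inner x}"
  have B0: "finite B0" "\<And>x. x \<in> B0 \<Longrightarrow> inner x" using B(1) unfolding B0_def by auto
  obtain g where g: "g \<in> W" "\<And>T. finite T \<Longrightarrow> \<exists>k. \<forall>x\<in>B0. extreme T ((f False ^^ k) (g x)) \<and> (\<forall>t\<in>T. dfree ((f False ^^ k) (g x)) t)"
    using independent_images[OF B0] by blast
  obtain u where u: "g = ev f u" using g(1) unfolding W_def by blast
  obtain H where H: "finite H" "\<And>f'. (\<forall>i. f' i \<in> G) \<Longrightarrow> (\<forall>i. \<forall>c\<in>H. f' i c = f i c) \<Longrightarrow> (\<forall>x\<in>B. ev f' u x = ev f u x)"
    using ev_continuous_finite[of f, OF f_G B(1), of u] by blast
  \<comment> \<open>\<open>H\<close> makes the new pair agree with \<open>f\<close> along the word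
    \<open>u\<close>, \<open>D\<close> is the prescribed part, and \<open>Z\<close> takes care of
    the points of \<open>B\<close> that are not \<open>inner\<close>.\<close>
  define E where "E = H \<union> D \<union> Z"
  have E: "finite E" using H(1) D Z_fin unfolding E_def by auto
  define a where "a = f True"
  have aG: "a \<in> G" and aZ: "\<And>z. z \<in> Z \<Longrightarrow> a z = z" using f_A[of _ True] Z_A[of True] unfolding a_def by auto
  obtain k where k: "\<And>x. x \<in> B0 \<Longrightarrow> extreme (E \<union> a ` E) ((f False ^^ k) (g x))"
     "\<And>x t. x \<in> B0 \<Longrightarrow> t \<in> E \<union> a ` E \<Longrightarrow> dfree ((f False ^^ k) (g x)) t"
    using g(2)[of "E \<union> a ` E"] E by blast
  define N where "N = (\<lambda>x. (f False ^^ k) (g x)) ` B0"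
  have N: "extreme (E \<union> a ` E) y" "\<And>t. t \<in> E \<union> a ` E \<Longrightarrow> dfree y t" if "y \<in> N" for y
    using k that unfolding N_def by auto
  have dle: "d y (a c) \<le> d y c" "d y c \<le> d y (a c)" if y: "y \<in> N" and c: "c \<in> E" for y c
  proof -
    have az: "d z (a c) = d z c" if "z \<in> Z" for z using Aut_d[OF aG, of z c] aZ[OF that] by simp
    obtain z where "z \<in> Z" "d y z + d z c \<le> d y c" using N(2)[OF y, of c] c unfolding dfree_def by blast
    then show "d y (a c) \<le> d y c" using az[of z] d_triangle[of y "a c" z] by simp
    obtain z where "z \<in> Z" "d y z + d z (a c) \<le> d y (a c)" using N(2)[OF y, of "a c"] c unfolding dfree_def by blast
    then show "d y c \<le> d y (a c)" using az[of z] d_triangle[of y c z] by simp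
  qed
  have dNE: "d y (a c) = d y c" if "y \<in> N" "c \<in> E" for y c using dle[OF that] by simp
  have ltZ: "a c \<sqsubset> z \<longleftrightarrow> c \<sqsubset> z" "z \<sqsubset> a c \<longleftrightarrow> z \<sqsubset> c" if "z \<in> Z" for c z
    using Aut_lt[OF aG, of c z] Aut_lt[OF aG, of z c] aZ[OF that] by auto
  have leZ: "a c \<sqsubseteq> z \<longleftrightarrow> c \<sqsubseteq> z" "z \<sqsubseteq> a c \<longleftrightarrow> z \<sqsubseteq> c" if "z \<in> Z" for c z
    using Aut_le[OF aG, of c z] Aut_le[OF aG, of z c] aZ[OF that] by auto
  have NE: "(c \<sqsubset> y \<longleftrightarrow> a c \<sqsubset> y) \<and> (y \<sqsubset> c \<longleftrightarrow> y \<sqsubset> a c) \<and> y \<noteq> c" if y: "y \<in> N" and c: "c \<in> E" for y c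
  proof -
    from N(1)[OF y] consider "top (E \<union> a ` E) y" | "bot (E \<union> a ` E) y" unfolding extreme_def by blast
    then show ?thesis
    proof cases
      case 1
      have "y \<sqsubset> c \<and> y \<sqsubset> a c" if "y \<sqsubseteq> c"
      proof -
        obtain z where "z \<in> Z" "y \<sqsubset> z" "z \<sqsubseteq> c" using 1 c \<open>y \<sqsubseteq> c\<close> unfolding top_def by blast
        then show ?thesis using leZ[of z c] by (auto dest: less_le_trans)
      qed
      moreover have "y \<sqsubset> c" if "y \<sqsubseteq> a c"
      proof -
        obtain z where "z \<in> Z" "y \<sqsubset> z" "z \<sqsubseteq> a c" using 1 c \<open>y \<sqsubseteq> a c\<close> unfolding top_def by blast
        then show ?thesis using leZ[of z c] by (auto dest: less_le_trans)
      qed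
      ultimately show ?thesis by (metis le_def less_asym lt_total)
    next
      case 2
      have "c \<sqsubset> y \<and> a c \<sqsubset> y" if "c \<sqsubseteq> y"
      proof -
        obtain z where "z \<in> Z" "z \<sqsubset> y" "c \<sqsubseteq> z" using 2 c \<open>c \<sqsubseteq> y\<close> unfolding bot_def by blast
        then show ?thesis using leZ[of z c] by (auto dest: le_less_trans)
      qed
      moreover have "c \<sqsubset> y" if "a c \<sqsubseteq> y"
      proof -
        obtain z where "z \<in> Z" "z \<sqsubset> y" "a c \<sqsubseteq> z" using 2 c \<open>a c \<sqsubseteq> y\<close> unfolding bot_def by blast
        then show ?thesis using leZ[of z c] by (auto dest: le_less_trans)
      qed
      ultimately show ?thesis by (metis le_def less_asym lt_total)
    qed
  qed
  define p where "p c = (if c \<in> N then c else a c)" for c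
  obtain a' where a': "a' \<in> G" "\<And>c. c \<in> E \<union> N \<Longrightarrow> a' c = p c"
  proof (rule extend_partial[of "E \<union> N" p])
    show "finite (E \<union> N)" using E B0(1) unfolding N_def by auto
    fix x y assume xy: "x \<in> E \<union> N" "y \<in> E \<union> N"
    show "d (p x) (p y) = d x y" using xy dNE[of x y] dNE[of y x] d_sym[of x y] d_sym[of "a x" y] aG unfolding p_def by auto
    show "x \<sqsubset> y \<Longrightarrow> p x \<sqsubset> p y" using xy NE[of x y] NE[of y x] aG unfolding p_def by auto
  qed blast
  have a'N: "a' y = y" if "y \<in> N" for y using a'(2)[of y] that unfolding p_def by auto
  have a'E: "a' c = a c" if "c \<in> E" for c using a'(2)[of c] that NE[of c c] unfolding p_def by auto
  define f' where "f' = f(True := a')"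
  have f'G: "\<forall>i. f' i \<in> G" using a'(1) unfolding f'_def by auto
  have "\<forall>i. \<forall>c\<in>H. f' i c = f i c" using a'E unfolding f'_def a_def E_def by auto
  then have fu: "\<forall>x\<in>B. ev f' u x = ev f u x" using H(2)[OF f'G] by blast
  \<comment> \<open>The part after \<open>u\<close> uses \<open>f False\<close> only, which is not
    changed.\<close>
  define w where "w = u @ replicate k (False, True)"
  have ew: "ev f' w x = (f False ^^ k) (g x)" if "x \<in> B" for x
    using fu that unfolding w_def ev_append ev_replicate_True by (simp add: f'_def u)
  have "a' (ev f' w x) = ev f' w x" if x: "x \<in> B" for x
  proof (cases "inner x")
    case True
    then have "ev f' w x \<in> N" using ew[OF x] x unfolding N_def B0_def by auto
    then show ?thesis using a'N by auto
  next
    case False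
    then have xZ: "x \<in> Z" using B(2) x by auto
    then have "ev f' w x = x" using ew[OF x] W_Z[OF g(1)] W_Z[OF W_pow(1)] by simp
    then show ?thesis using a'E[of x] aZ xZ unfolding E_def by simp
  qed
  then show ?thesis using a'(1) a'E unfolding f'_def E_def a_def by (intro bexI[of _ a'] conjI exI[of _ w]) auto
qed

end

subsection \<open>Extensions of finite partial pairs\<close>

context QU begin

lemma add_common_fixed_point:
  assumes g: "\<And>i :: bool. g i \<in> G" and S: "finite S" "\<And>i. D \<union> g i ` D \<subseteq> S"
  shows "\<exists>y g'. y \<notin> S \<and> (\<forall>s\<in>S. s \<sqsubset> y \<longleftrightarrow> P) \<and> (\<forall>i. g' i \<in> G \<and> (\<forall>c\<in>D. g' i c = g i c) \<and> g' i y = y)"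
proof -
  obtain y r where y: "y \<notin> S" "\<And>s. s \<in> S \<Longrightarrow> s \<sqsubset> y \<longleftrightarrow> P" "\<And>s. s \<in> S \<Longrightarrow> d y s = r"
    by (rule equidistant_point[OF S(1), of "\<lambda>_. P"]) (assumption, rule that)
  have "\<exists>h\<in>G. (\<forall>c\<in>D. h c = g i c) \<and> h y = y" for i
  proof (rule extend_fixing[OF g _ _ _ y(1,3)])
    show "finite D" "D \<subseteq> S" "g i ` D \<subseteq> S" using S finite_subset[of D S] by auto
    fix c assume "c \<in> D"
    then have "c \<in> S" "g i c \<in> S" using S by auto
    then show "c \<sqsubset> y \<longleftrightarrow> g i c \<sqsubset> y" using y(2) by auto
  qed
  then have "\<forall>i. \<exists>h. h \<in> G \<and> (\<forall>c\<in>D. h c = g i c) \<and> h y = y" by blast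
  from choice[OF this] obtain g' where "\<forall>i. g' i \<in> G \<and> (\<forall>c\<in>D. g' i c = g i c) \<and> g' i y = y" by (elim exE)
  then show ?thesis using y by blast
qed

text \<open>Two points \<open>\<tau>\<close> and \<open>\<beta>\<close>, fixed by both maps and
  placed above and below everything, make \<open>F\<close> nonempty and enclose \<open>B\<close>
  between points of \<open>F\<close>, as \<open>inner\<close> demands.\<close>

lemma extension_fixing_image:
  assumes g: "\<And>i. g i \<in> G" and fin: "finite D" "finite B"
  shows "\<exists>f. (\<forall>i. f i \<in> G \<and> (\<forall>c\<in>D. f i c = g i c)) \<and> (\<exists>w. \<forall>x\<in>B. f True (ev f w x) = ev f w x)"
proof -
  define S where "S = B \<union> D \<union> g True ` D \<union> g False ` D"
  have S: "finite S" "D \<union> g i ` D \<subseteq> S" for i using fin by (auto simp: S_def, (cases i; auto)+)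
  obtain \<tau> g1 where \<tau>: "\<tau> \<notin> S" "\<forall>s\<in>S. s \<sqsubset> \<tau>" and g1: "\<forall>i. g1 i \<in> G \<and> (\<forall>c\<in>D. g1 i c = g i c) \<and> g1 i \<tau> = \<tau>"
    using add_common_fixed_point[where g=g and P=True, OF g S] by auto
  define S1 where "S1 = insert \<tau> S"
  define D1 where "D1 = insert \<tau> D"
  have S1: "finite S1" "D1 \<union> g1 i ` D1 \<subseteq> S1" for i
    using S(1) S(2)[of i] g1 unfolding S1_def D1_def by (auto simp: subset_iff image_iff)
  obtain \<beta> g2 where \<beta>: "\<beta> \<notin> S1" "\<forall>s\<in>S1. \<not> s \<sqsubset> \<beta>" and g2: "\<forall>i. g2 i \<in> G \<and> (\<forall>c\<in>D1. g2 i c = g1 i c) \<and> g2 i \<beta> = \<beta>"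
    using add_common_fixed_point[where g=g1 and P=False and S=S1 and D=D1] g1 S1 by auto
  define S2 where "S2 = insert \<beta> S1"
  define D2 where "D2 = insert \<beta> D1"
  have g2G: "g2 i \<in> G" for i using g2 by auto
  have S2: "finite S2" "D2 \<subseteq> S2" "g2 i ` D2 \<subseteq> S2" for i
    using S1(1) S1(2)[of i] g2 unfolding S2_def D2_def by auto
  have g2D: "g2 i c = g i c" if "c \<in> D" for i c using g1 g2 that unfolding D1_def by auto
  have g2\<tau>: "g2 i \<tau> = \<tau>" for i using g1 g2 unfolding D1_def by auto
  define F where "F = {x \<in> D2. g2 True x = x \<and> g2 False x = x}"
  have F\<tau>\<beta>: "\<tau> \<in> F" "\<beta> \<in> F" using g2\<tau> g2 unfolding F_def D2_def D1_def by auto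
  have Fi: "F \<subseteq> {x \<in> D2. g2 i x = x}" "F \<noteq> {}" for i
    using F\<tau>\<beta> by (cases i, auto simp: F_def)
  obtain h1 A1 Up1 where ad1: "adapted h1 (D2 \<union> A1) A1 Up1" "\<forall>c\<in>D2. h1 c = g2 True c" "A1 \<inter> S2 = {x \<in> D2. g2 True x = x}"
     and up1: "\<forall>x z. x \<notin> A1 \<longrightarrow> z \<in> F \<longrightarrow> x \<sqsubset> z \<longrightarrow> (\<forall>\<alpha>\<in>A1. \<alpha> \<sqsubset> z \<longrightarrow> \<alpha> \<sqsubset> x) \<longrightarrow> Up1 x"
     and down1: "\<forall>x z. x \<notin> A1 \<longrightarrow> z \<in> F \<longrightarrow> z \<sqsubset> x \<longrightarrow> (\<forall>\<alpha>\<in>A1. z \<sqsubset> \<alpha> \<longrightarrow> x \<sqsubset> \<alpha>) \<longrightarrow> \<not> Up1 x"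
    using adapted_extension[OF g2G[of True] S2(1,2) S2(3)[of True] Fi(1)[of True] Fi(2)] by (elim exE conjE) (rule that)
  \<comment> \<open>The second fixed point set is built relative to \<open>S3\<close>, which
    contains \<open>A1\<close>: its new points avoid \<open>A1\<close>, so the two sets meet only in
    \<open>F\<close>.\<close>
  define S3 where "S3 = S2 \<union> A1"
  have S3: "finite S3" "D2 \<subseteq> S3" "g2 False ` D2 \<subseteq> S3"
    using S2 adaptedD(2)[OF ad1(1)] unfolding S3_def by auto
  obtain h2 A2 Up2 where ad2: "adapted h2 (D2 \<union> A2) A2 Up2" "\<forall>c\<in>D2. h2 c = g2 False c" "A2 \<inter> S3 = {x \<in> D2. g2 False x = x}"
     and up2: "\<forall>x z. x \<notin> A2 \<longrightarrow> z \<in> F \<longrightarrow> x \<sqsubset> z \<longrightarrow> (\<forall>\<alpha>\<in>A2. \<alpha> \<sqsubset> z \<longrightarrow> \<alpha> \<sqsubset> x) \<longrightarrow> Up2 x"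
     and down2: "\<forall>x z. x \<notin> A2 \<longrightarrow> z \<in> F \<longrightarrow> z \<sqsubset> x \<longrightarrow> (\<forall>\<alpha>\<in>A2. z \<sqsubset> \<alpha> \<longrightarrow> x \<sqsubset> \<alpha>) \<longrightarrow> \<not> Up2 x"
    using adapted_extension[OF g2G[of False] S3 Fi(1)[of False] Fi(2)] by (elim exE conjE) (rule that)
  have FA: "F = A1 \<inter> A2"
  proof
    show "F \<subseteq> A1 \<inter> A2" using ad1(3) ad2(3) unfolding F_def by blast
    show "A1 \<inter> A2 \<subseteq> F"
    proof
      fix x assume x: "x \<in> A1 \<inter> A2"
      then have "x \<in> A2 \<inter> S3" unfolding S3_def by auto
      then have 2: "x \<in> D2" "g2 False x = x" using ad2(3) by auto
      then have "x \<in> A1 \<inter> S2" using x S2(2) by auto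
      then show "x \<in> F" using ad1(3) 2 unfolding F_def by auto
    qed
  qed
  obtain f1 where f1: "mixing f1 A1 Up1" "\<forall>c\<in>D2 \<union> A1. f1 c = h1 c" using mixing_extension[OF ad1(1)] by blast
  obtain f2 where f2: "mixing f2 A2 Up2" "\<forall>c\<in>D2 \<union> A2. f2 c = h2 c" using mixing_extension[OF ad2(1)] by blast
  define f where "f i = (if i then f1 else f2)" for i
  define A where "A i = (if i then A1 else A2)" for i
  define Up where "Up i = (if i then Up1 else Up2)" for i
  interpret mixing_pair d lt f A Up F
  proof
    show "mixing (f i) (A i) (Up i)" for i using f1 f2 unfolding f_def A_def Up_def by auto
    show "F = A True \<inter> A False" using FA unfolding A_def by auto
    show "Up i x" if "x \<notin> A i" "z \<in> F" "x \<sqsubset> z" "\<forall>\<alpha>\<in>A i. \<alpha> \<sqsubset> z \<longrightarrow> \<alpha> \<sqsubset> x" for i x z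
      using that up1 up2 unfolding A_def Up_def by (cases i) auto
    show "\<not> Up i x" if "x \<notin> A i" "z \<in> F" "z \<sqsubset> x" "\<forall>\<alpha>\<in>A i. z \<sqsubset> \<alpha> \<longrightarrow> x \<sqsubset> \<alpha>" for i x z
      using that down1 down2 unfolding A_def Up_def by (cases i) auto
  qed
  have fD: "f i c = g i c" if "c \<in> D" for i c
  proof -
    have "c \<in> D2" using that unfolding D2_def D1_def by auto
    then show ?thesis using g2D[OF that] f1(2) f2(2) ad1(2) ad2(2) unfolding f_def by auto
  qed
  have inn: "inner x \<or> x \<in> F" if "x \<in> B" for x
  proof -
    have xS: "x \<in> S" using that unfolding S_def by auto
    then have "x \<sqsubset> \<tau>" "\<not> x \<sqsubset> \<beta>" "x \<noteq> \<beta>" using \<tau> \<beta> unfolding S1_def by auto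
    then have "x \<sqsubset> \<tau>" "\<beta> \<sqsubset> x" by auto
    then show ?thesis using F\<tau>\<beta> unfolding inner_def by blast
  qed
  obtain a w where a: "a \<in> G" "\<forall>c\<in>D. a c = f True c" "\<forall>x\<in>B. a (ev (f(True := a)) w x) = ev (f(True := a)) w x"
    using fixed_image[OF fin(2) inn fin(1)] by blast
  show ?thesis
    using a fD by (intro exI[of _ "f(True := a)"]) auto
qed

section \<open>Free extension along reduced words\<close>

definition undef where
  "undef g D l y \<longleftrightarrow> (if snd l then y \<notin> D (fst l) else y \<notin> g (fst l) ` D (fst l))"

abbreviation reduced :: "(bool \<times> bool) list \<Rightarrow> bool" where
  "reduced \<equiv> successively (\<lambda>l m. m \<noteq> (fst l, \<not> snd l))"

text \<open>Here \<open>g i\<close> stands for its restriction to \<open>D i\<close>. The first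
  letter, undefined at \<open>y\<close>, receives a fresh value \<open>y1\<close>. The only letter
  then defined at \<open>y1\<close> is the inverse of the one just used, which cannot come next in a
  reduced word, so the induction continues.\<close>

lemma free_word:
  assumes "w \<noteq> []" "reduced w" "\<And>i. g i \<in> G \<and> finite (D i) \<and> D i \<noteq> {}" "undef g D (hd w) y" "finite S"
  shows "\<exists>g'. (\<forall>i. g' i \<in> G \<and> (\<forall>c\<in>D i. g' i c = g i c)) \<and> ev g' w y \<notin> S"
  using assms
proof (induction w arbitrary: g D y)
  case (Cons l w)
  obtain i e where l: "l = (i, e)" by (cases l)
  \<comment> \<open>\<open>y\<close> belongs to \<open>S'\<close> because a repeated letter is
    undefined at \<open>y1\<close> only if \<open>y1 \<noteq> y\<close>.\<close>
  define S' where "S' = insert y (S \<union> (\<Union>j. D j \<union> g j ` D j))"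
  have gD: "g j \<in> G" "finite (D j)" "D j \<noteq> {}" for j using Cons.prems(3) by auto
  have S': "finite S'" "D j \<subseteq> S'" "g j ` D j \<subseteq> S'" for j using gD(2) Cons.prems(5) unfolding S'_def by auto
  have "\<exists>g0 y1. g0 \<in> G \<and> (\<forall>c\<in>D i. g0 c = g i c) \<and> y1 \<notin> S' \<and> (if e then g0 y = y1 else g0 y1 = y)"
  proof (cases e)
    case True
    then have "y \<notin> D i" using Cons.prems(4) l unfolding undef_def by auto
    from free_step_up[OF gD(1,2,3) S' this] obtain g0 where "g0 \<in> G" "\<And>c. c \<in> D i \<Longrightarrow> g0 c = g i c" "g0 y \<notin> S'"
      by metis
    then show ?thesis using True by auto
  next
    case False
    then have y: "y \<notin> g i ` D i" using Cons.prems(4) l unfolding undef_def by auto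
    have "inv (g i) ` g i ` D i \<subseteq> S'" using S'(2)[of i] gD(1)[of i] by (auto simp: image_image)
    with free_step_up[of "inv (g i)" "g i ` D i" S' y, OF _ _ _ S'(1) S'(3)[of i] _ y] gD[of i]
    obtain h where h: "h \<in> G" "\<And>c. c \<in> g i ` D i \<Longrightarrow> h c = inv (g i) c" "h y \<notin> S'"
      by (metis Aut_inv finite_imageI image_is_empty)
    have "inv h c = g i c" if "c \<in> D i" for c
    proof -
      have "h (g i c) = c" using h(2)[of "g i c"] that gD(1)[of i] by auto
      then show ?thesis using h(1) by (metis Aut_inv_f)
    qed
    then show ?thesis using False h by (intro exI[of _ "inv h"] exI[of _ "h y"]) auto
  qed
  then obtain g0 y1 where g0: "g0 \<in> G" "\<And>c. c \<in> D i \<Longrightarrow> g0 c = g i c" "y1 \<notin> S'" "if e then g0 y = y1 else g0 y1 = y" by blast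
  define g1 where "g1 = g(i := g0)"
  define D1 where "D1 = D(i := insert (if e then y else y1) (D i))"
  have letter: "(if e then g' i y else inv (g' i) y) = y1" if "g' i \<in> G" "\<forall>c\<in>D1 i. g' i c = g1 i c" for g'
  proof (cases e)
    case True then show ?thesis using that g0(4) unfolding D1_def g1_def by auto
  next
    case False
    then have "g' i y1 = y" using that g0(4) unfolding D1_def g1_def by auto
    then show ?thesis using False that(1) by (metis Aut_inv_f)
  qed
  have agree: "g' j c = g j c" if "\<forall>c\<in>D1 j. g' j c = g1 j c" "c \<in> D j" for g' j c
    using that g0(2) unfolding D1_def g1_def by (cases "j = i") auto
  have g1: "g1 j \<in> G" "finite (D1 j)" "D1 j \<noteq> {}" for j using gD g0(1) unfolding g1_def D1_def by auto
  show ?case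
  proof (cases "w = []")
    case True
    have "ev g1 (l # w) y = y1" using letter[of g1] g1(1) l True by auto
    then show ?thesis using g1 agree[of _ g1] g0(3) unfolding S'_def by (intro exI[of _ g1]) auto
  next
    case False
    then obtain m w' where w: "w = m # w'" by (cases w) auto
    have m: "m \<noteq> (i, \<not> e)" and red: "reduced w" using Cons.prems(2) l w by (auto simp: successively_Cons)
    have y1: "y1 \<noteq> y" "y1 \<notin> D j" "y1 \<notin> g j ` D j" for j using g0(3) S' unfolding S'_def by auto
    have g0D: "g0 ` D i = g i ` D i" using g0(2) by auto
    have "undef g1 D1 (hd w) y1"
    proof (cases "fst m = i")
      case True
      then have "snd m = e" using m by (cases m) auto
      then show ?thesis using True y1 g0D g0(4) unfolding undef_def w g1_def D1_def by auto
    next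
      case False
      then show ?thesis using y1 unfolding undef_def w g1_def D1_def by auto
    qed
    then have "\<exists>g'. (\<forall>i. g' i \<in> G \<and> (\<forall>c\<in>D1 i. g' i c = g1 i c)) \<and> ev g' w y1 \<notin> S"
      by (intro Cons.IH[OF False red]) (use g1 Cons.prems(5) in auto)
    then obtain g' where g': "\<forall>i. g' i \<in> G \<and> (\<forall>c\<in>D1 i. g' i c = g1 i c)" "ev g' w y1 \<notin> S" by blast
    have "ev g' (l # w) y = ev g' w y1" using letter[of g'] g'(1) l by auto
    then show ?thesis using g' agree[of _ g'] by (intro exI[of _ g']) auto
  qed
qed simp

lemma not_successivelyD: "\<not> successively R w \<Longrightarrow> \<exists>p a b q. w = p @ a # b # q \<and> \<not> R a b"
proof (induction w)
  case (Cons x w)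
  show ?case
  proof (cases "successively R w")
    case True
    then obtain y w' where "w = y # w'" "\<not> R x y" using Cons.prems by (cases w) auto
    then show ?thesis by (intro exI[of _ "[]"]) auto
  next
    case False
    then obtain p a b q where "w = p @ a # b # q" "\<not> R a b" using Cons.IH by blast
    then show ?thesis by (intro exI[of _ "x # p"]) auto
  qed
qed simp

text \<open>A shortest word with the property is reduced, since a cancellation would not change its
  value.\<close>

lemma ex_reduced_word:
  assumes g: "\<And>i. g i \<in> G" and P: "P (ev g w)"
  shows "\<exists>w. reduced w \<and> P (ev g w)"
proof -
  define n where "n = (LEAST n. \<exists>w. length w = n \<and> P (ev g w))"
  have "\<exists>w. length w = n \<and> P (ev g w)" unfolding n_def by (rule LeastI_ex) (use P in blast)
  then obtain w where w: "length w = n" "P (ev g w)" by blast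
  have least: "n \<le> length v" if "P (ev g v)" for v unfolding n_def by (rule Least_le) (use that in blast)
  have "reduced w"
  proof (rule ccontr)
    assume "\<not> reduced w"
    then obtain p a b q where w': "w = p @ a # b # q" "b = (fst a, \<not> snd a)" using not_successivelyD by blast
    have "(if snd b then g (fst b) else inv (g (fst b))) \<circ> (if snd a then g (fst a) else inv (g (fst a))) = id"
      using w'(2) g by (auto simp: fun_eq_iff)
    then have "ev g (a # b # q) = ev g q" by (simp add: comp_assoc)
    then have "ev g w = ev g (p @ q)" unfolding w'(1) ev_append by simp
    then show False using least[of "p @ q"] w w'(1) by simp
  qed
  then show ?thesis using w by blast
qed

lemma orbit_inj:
  assumes g: "g \<in> G" and x: "g x \<noteq> x" shows "inj (\<lambda>n. (g ^^ n) x)"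
proof -
  have "x \<sqsubset> g x \<or> g x \<sqsubset> x" using x lt_total by metis
  then have ne: "(g ^^ Suc k) x \<noteq> x" for k
  proof
    assume lt: "x \<sqsubset> g x"
    have "x \<sqsubset> (g ^^ Suc k) x"
    proof (induction k)
      case (Suc k)
      then have "g x \<sqsubset> g ((g ^^ Suc k) x)" using g by simp
      then show ?case using less_trans[OF lt] by simp
    qed (use lt in simp)
    then show ?thesis by auto
  next
    assume lt: "g x \<sqsubset> x"
    have "(g ^^ Suc k) x \<sqsubset> x"
    proof (induction k)
      case (Suc k)
      then have "g ((g ^^ Suc k) x) \<sqsubset> g x" using g by simp
      then show ?case using less_trans[OF _ lt] by simp
    qed (use lt in simp)
    then show ?thesis by auto
  qed
  show ?thesis
  proof (rule linorder_injI)
    fix m n :: nat assume "m < n"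
    then obtain k where k: "n = m + Suc k" using less_natE by auto
    have "(g ^^ n) x = (g ^^ m) ((g ^^ Suc k) x)" unfolding k funpow_add by simp
    then show "(g ^^ m) x \<noteq> (g ^^ n) x" using ne[of k] g Aut_eq[OF Aut_funpow[OF g]] by metis
  qed
qed


lemma orbit_leaves:
  assumes "g \<in> G" "g x \<noteq> x" "finite S" shows "\<exists>k. (g ^^ k) x \<notin> S"
proof (rule ccontr)
  assume "\<not> ?thesis"
  then have "range (\<lambda>n. (g ^^ n) x) \<subseteq> S" by auto
  then show False using range_inj_infinite[OF orbit_inj[OF assms(1,2)]] finite_subset assms(3) by blast
qed

text \<open>At the end \<open>y\<close> of the orbit segment the letter that undoes its last step
  may be defined; the assumption for \<open>fst l\<close> excludes this letter. For letters of the
  second automorphism either exponent \<open>e\<close> would do, and \<open>True\<close> is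
  taken.\<close>

lemma ex_leaf:
  assumes f: "\<And>i. f i \<in> G" and x: "f True x \<noteq> x" and D: "finite D"
    and l: "fst l \<Longrightarrow> snd l = e" "\<not> fst l \<Longrightarrow> e"
  shows "\<exists>k y D'. (\<forall>i. finite (D' i) \<and> D \<subseteq> D' i) \<and> undef f D' l y \<and>
     (\<forall>f'. (\<forall>i. f' i \<in> G \<and> (\<forall>c\<in>D' i. f' i c = f i c)) \<longrightarrow> ev f' (replicate k (True, e)) x = y)"
proof -
  define S where "S = D \<union> f True ` D \<union> f False ` D"
  have S: "finite S" using D unfolding S_def by auto
  show ?thesis
  proof (cases e)
    case True
    define h where "h = f True"
    have h: "h \<in> G" "h x \<noteq> x" using f x h_def by auto
    obtain k where k: "(h ^^ k) x \<notin> S" using orbit_leaves[OF h S] by blast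
    define C where "C = (\<lambda>j. (h ^^ j) x) ` {..<k}"
    define D' where "D' i = (if i then D \<union> C else D)" for i
    have "(h ^^ k) x \<notin> C" unfolding C_def using injD[OF orbit_inj[OF h], of k] by auto
    then have "undef f D' l ((h ^^ k) x)"
      using k l True unfolding undef_def D'_def S_def by (cases l) auto
    moreover have "ev f' (replicate k (True, e)) x = (h ^^ k) x" if f': "\<forall>i. f' i \<in> G \<and> (\<forall>c\<in>D' i. f' i c = f i c)" for f'
    proof -
      have "(f' True ^^ k) x = (h ^^ k) x"
        by (intro funpow_agree[of C]) (use f' in \<open>auto simp: C_def D'_def h_def\<close>)
      then show ?thesis using True by (simp add: ev_replicate_True)
    qed
    moreover have "finite (D' i) \<and> D \<subseteq> D' i" for i using D unfolding D'_def C_def by auto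
    ultimately show ?thesis by blast
  next
    case False
    define h where "h = inv (f True)"
    have fh: "f True (h y) = y" for y using f h_def by simp
    then have h: "h \<in> G" "h x \<noteq> x" using f x h_def by (simp, metis)
    obtain k where k: "(h ^^ k) x \<notin> S" using orbit_leaves[OF h S] by blast
    define C where "C = (\<lambda>j. (h ^^ j) x) ` {..<k}"
    define D' where "D' i = (if i then D \<union> h ` C else D)" for i
    have "(h ^^ k) x \<notin> C" unfolding C_def using injD[OF orbit_inj[OF h], of k] by auto
    moreover have "f True ` h ` C = C" using fh by (simp add: image_image)
    ultimately have "undef f D' l ((h ^^ k) x)"
      using k l False unfolding undef_def D'_def S_def by (cases l) (auto simp: image_Un)
    moreover have "ev f' (replicate k (True, e)) x = (h ^^ k) x" if f': "\<forall>i. f' i \<in> G \<and> (\<forall>c\<in>D' i. f' i c = f i c)" for f'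
    proof -
      have "inv (f' True) c = h c" if "c \<in> C" for c
      proof -
        have "f' True (h c) = c" using f' fh that unfolding D'_def by simp
        then show ?thesis using f' by (metis Aut_inv_f)
      qed
      then have "(inv (f' True) ^^ k) x = (h ^^ k) x"
        by (intro funpow_agree[of C]) (auto simp: C_def)
      then show "ev f' (replicate k (True, e)) x = (h ^^ k) x" using False by (simp add: ev_replicate_False)
    qed
    moreover have "finite (D' i) \<and> D \<subseteq> D' i" for i using D unfolding D'_def C_def by auto
    ultimately show ?thesis by blast
  qed
qed

lemma ev_replicate_cancel:
  assumes "\<And>i. f i \<in> G"
  shows "ev f (replicate k (i, \<not> e)) (ev f (replicate k (i, e)) x) = x"
proof -
  have *: "(inv g ^^ k) ((g ^^ k) x) = x" if "g \<in> G" for g x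
  proof (induction k arbitrary: x)
    case (Suc k)
    have "(inv g ^^ Suc k) ((g ^^ Suc k) x) = (inv g ^^ k) (inv g (g ((g ^^ k) x)))" by (simp add: funpow_swap1)
    then show ?case using that Suc by simp
  qed simp
  show ?thesis
    using *[OF assms, of i] *[OF Aut_inv[OF assms], of i] assms
    by (cases e) (simp_all add: ev_replicate_True ev_replicate_False)
qed

lemma extension_moving:
  assumes g: "\<And>i. g i \<in> G" and dense: "\<And>A. finite A \<Longrightarrow> \<exists>w. (\<forall>a\<in>A. ev g w a = a) \<and> ev g w \<noteq> id"
    and f: "\<And>i. f i \<in> G" and x: "f True x \<noteq> x" and fin: "finite A" "finite D"
  shows "\<exists>f'. (\<forall>i. f' i \<in> G \<and> (\<forall>c\<in>D. f' i c = f i c)) \<and> (\<exists>w. (\<forall>a\<in>A. ev g w a = a) \<and> ev f' w x \<noteq> x)"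
proof -
  define E where "E = insert x D"
  have E: "finite E" "E \<noteq> {}" using fin unfolding E_def by auto
  \<comment> \<open>The first letter of the word to be used is known only later, so leaves are prepared for each.\<close>
  have "\<forall>l. \<exists>e k y D'. (\<forall>i. finite (D' i) \<and> E \<subseteq> D' i) \<and> undef f D' l y \<and>
     (\<forall>f'. (\<forall>i. f' i \<in> G \<and> (\<forall>c\<in>D' i. f' i c = f i c)) \<longrightarrow> ev f' (replicate k (True, e)) x = y)"
  proof
    \<comment> \<open>The exponent is \<open>False\<close> for the letter
      \<open>(True, False)\<close> alone, in accordance with the assumptions of
      \<open>ex_leaf\<close>.\<close>
    fix l :: "bool \<times> bool"
    show "\<exists>e k y D'. (\<forall>i. finite (D' i) \<and> E \<subseteq> D' i) \<and> undef f D' l y \<and>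
     (\<forall>f'. (\<forall>i. f' i \<in> G \<and> (\<forall>c\<in>D' i. f' i c = f i c)) \<longrightarrow> ev f' (replicate k (True, e)) x = y)"
      by (rule exI[of _ "l \<noteq> (True, False)"], rule ex_leaf[of f, OF f x E(1)]) (cases l; auto)+
  qed
  then obtain e k y D' where leaf: "\<And>l i. finite (D' l i) \<and> E \<subseteq> D' l i" "\<And>l. undef f (D' l) l (y l)"
     "\<And>l f'. (\<forall>i. f' i \<in> G \<and> (\<forall>c\<in>D' l i. f' i c = f i c)) \<Longrightarrow> ev f' (replicate (k l) (True, e l)) x = y l"
    by metis
  define u where "u l = replicate (k l) (True, e l)" for l
  define A' where "A' = (\<Union>l. ev g (u l) ` A)"
  have "finite A'" using fin unfolding A'_def by auto
  then obtain w0 where "(\<forall>a\<in>A'. ev g w0 a = a) \<and> ev g w0 \<noteq> id" using dense by blast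
  then obtain w where w: "reduced w" "\<forall>a\<in>A'. ev g w a = a" "ev g w \<noteq> id"
    using ex_reduced_word[of g "\<lambda>h. (\<forall>a\<in>A'. h a = a) \<and> h \<noteq> id" w0, OF g] by blast
  have wne: "w \<noteq> []" using w(3) by auto
  define l where "l = hd w"
  have D': "D' l i \<noteq> {}" for i using leaf(1)[of l i] E by auto
  have "\<exists>f'. (\<forall>i. f' i \<in> G \<and> (\<forall>c\<in>D' l i. f' i c = f i c)) \<and> ev f' w (y l) \<notin> {y l}"
    by (rule free_word[OF wne w(1)]) (use leaf(1,2)[of l] D' f in \<open>auto simp: l_def\<close>)
  then obtain f' where f': "\<forall>i. f' i \<in> G \<and> (\<forall>c\<in>D' l i. f' i c = f i c)" "ev f' w (y l) \<notin> {y l}"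
    by (elim exE conjE)
  have f'G: "f' i \<in> G" for i using f' by auto
  \<comment> \<open>Only \<open>w\<close> has to be reduced: the last factor undoes
    \<open>u l\<close> at both pairs, whatever cancels.\<close>
  define v where "v = u l @ w @ replicate (k l) (True, \<not> e l)"
  have "ev g v a = a" if "a \<in> A" for a
  proof -
    have "ev g w (ev g (u l) a) = ev g (u l) a" using w(2) that unfolding A'_def by blast
    then show ?thesis using ev_replicate_cancel[of g, OF g] unfolding v_def ev_append u_def by simp
  qed
  moreover have "ev f' v x \<noteq> x"
  proof
    assume *: "ev f' v x = x"
    have ux: "ev f' (u l) x = y l" using leaf(3)[OF f'(1)] unfolding u_def .
    have "ev f' (u l) (ev f' v x) = ev f' w (y l)"
      using ev_replicate_cancel[of f' "k l" True "\<not> e l", OF f'G] ux unfolding v_def ev_append u_def by simp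
    then show False using f'(2) ux * by simp
  qed
  moreover have "\<forall>i. f' i \<in> G \<and> (\<forall>c\<in>D. f' i c = f i c)" using f' leaf(1)[of l] unfolding E_def by auto
  ultimately show ?thesis by blast
qed

text \<open>A point \<open>y\<close> outside \<open>D\<close> is given a fresh value. The auxiliary
  point \<open>z\<close> makes \<open>E\<close> nonempty, as the free step requires.\<close>

lemma extension_nontrivial:
  assumes f: "f \<in> G" and D: "finite D"
  shows "\<exists>h\<in>G. (\<forall>c\<in>D. h c = f c) \<and> (\<exists>x. h x \<noteq> x)"
proof -
  obtain y r where y: "y \<notin> D" "\<And>s. s \<in> D \<Longrightarrow> d y s = r"
    by (rule equidistant_point[OF D, of "\<lambda>_. True"]) (auto intro: that)
  obtain z r where z: "z \<notin> {y}" "\<And>s. s \<in> {y} \<Longrightarrow> d z s = r"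
    by (rule equidistant_point[of "{y}" "\<lambda>_. True"]) (auto intro: that)
  define E where "E = insert z D"
  have E: "finite E" "E \<noteq> {}" "y \<notin> E" using y z D unfolding E_def by auto
  obtain h where h: "h \<in> G" "\<And>c. c \<in> E \<Longrightarrow> h c = f c" "h y \<notin> insert y (E \<union> f ` E)"
    by (rule free_step_up[OF f E(1,2) _ _ _ E(3), of "insert y (E \<union> f ` E)"]) (use E in \<open>auto intro: that\<close>)
  then show ?thesis unfolding E_def by (intro bexI[of _ h]) auto
qed

section \<open>Basic open sets of the automorphism group\<close>

lemma topspace_Aut_top: "topspace (Aut_top d lt) = G"
  unfolding Aut_top_def by simp

lemma openin_Aut_top_agree:
  assumes "finite D" shows "openin (Aut_top d lt) {h \<in> G. \<forall>x\<in>D. h x = f x}"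
proof -
  define U where "U x = (if x \<in> D then {f x} else UNIV)" for x
  have "finite {x. U x \<noteq> UNIV}" by (rule finite_subset[OF _ assms]) (auto simp: U_def)
  then have "openin (product_topology (\<lambda>_. discrete_topology UNIV) UNIV) (PiE UNIV U)"
    by (subst openin_PiE_gen) auto
  moreover have "{h \<in> G. \<forall>x\<in>D. h x = f x} = PiE UNIV U \<inter> G"
    by (auto simp: U_def PiE_iff split: if_splits)
  ultimately show ?thesis unfolding Aut_top_def openin_subtopology by blast
qed

lemma Aut_top_nbhd:
  assumes "openin (Aut_top d lt) V" "f \<in> V"
  shows "\<exists>D. finite D \<and> {h \<in> G. \<forall>x\<in>D. h x = f x} \<subseteq> V"
proof -
  obtain T where T: "openin (product_topology (\<lambda>_. discrete_topology UNIV) UNIV) T" "V = T \<inter> G"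
    using assms(1) unfolding Aut_top_def openin_subtopology by blast
  have "f \<in> T" using assms(2) T(2) by simp
  then have "\<exists>U. finite {i. U i \<noteq> UNIV} \<and> f \<in> PiE UNIV U \<and> PiE UNIV U \<subseteq> T"
    using T(1) unfolding openin_product_topology_alt by (simp add: Ball_def)
  then obtain U where U: "finite {i. U i \<noteq> UNIV}" "f \<in> PiE UNIV U" "PiE UNIV U \<subseteq> T" by (elim exE conjE)
  have "h \<in> V" if "h \<in> G" "\<forall>x\<in>{i. U i \<noteq> UNIV}. h x = f x" for h
  proof -
    have "h x \<in> U x" for x using that(2) U(2) by (cases "U x = UNIV") (auto simp: PiE_iff)
    then show ?thesis using U(3) T(2) that(1) by (auto simp: PiE_iff)
  qed
  then show ?thesis using U(1) by blast
qed

abbreviation "GG \<equiv> prod_topology (Aut_top d lt) (Aut_top d lt)"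

text \<open>Finitely many prescribed values describe basic open sets: \<open>D\<close> gives a
  neighbourhood of an arbitrary pair, and \<open>E\<close> an open set that meets it in
  \<open>f'\<close> and misses \<open>N\<close>.\<close>

lemma nowhere_denseI:
  assumes N: "N \<subseteq> G \<times> G"
    and dense: "\<And>(f :: bool \<Rightarrow> 'a \<Rightarrow> 'a) D. (\<And>i. f i \<in> G) \<Longrightarrow> finite D \<Longrightarrow>
      \<exists>f' E. finite E \<and> (\<forall>i. f' i \<in> G \<and> (\<forall>c\<in>D. f' i c = f i c)) \<and>
        (\<forall>h :: bool \<Rightarrow> 'a \<Rightarrow> 'a. (\<forall>i. h i \<in> G \<and> (\<forall>c\<in>E. h i c = f' i c)) \<longrightarrow> (h True, h False) \<notin> N)"
  shows "nowhere_dense_in GG N"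
  unfolding nowhere_dense_in_def
proof (intro conjI)
  show "N \<subseteq> topspace GG" using N by (simp add: topspace_Aut_top)
  show "GG interior_of (GG closure_of N) = {}"
  proof (rule ccontr)
    assume "GG interior_of (GG closure_of N) \<noteq> {}"
    then obtain f1 f2 where f12: "(f1, f2) \<in> GG interior_of (GG closure_of N)" by auto
    define O' where "O' = GG interior_of (GG closure_of N)"
    have op: "openin GG O'" "O' \<subseteq> GG closure_of N" unfolding O'_def by (auto simp: interior_of_subset)
    obtain U V where UV: "openin (Aut_top d lt) U" "openin (Aut_top d lt) V" "f1 \<in> U" "f2 \<in> V" "U \<times> V \<subseteq> O'"
      using op(1)[unfolded openin_prod_topology_alt, rule_format, OF f12[folded O'_def]] by (elim exE conjE)
    obtain D1 where D1: "finite D1" "{h \<in> G. \<forall>x\<in>D1. h x = f1 x} \<subseteq> U" using Aut_top_nbhd[OF UV(1,3)] by blast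
    obtain D2 where D2: "finite D2" "{h \<in> G. \<forall>x\<in>D2. h x = f2 x} \<subseteq> V" using Aut_top_nbhd[OF UV(2,4)] by blast
    have fG: "f1 \<in> G" "f2 \<in> G" using UV openin_subset topspace_Aut_top by blast+
    define f where "f i = (if i then f1 else f2)" for i
    have fiG: "f i \<in> G" for i using fG unfolding f_def by simp
    obtain f' E where f': "finite E" "\<forall>i. f' i \<in> G \<and> (\<forall>c\<in>D1 \<union> D2. f' i c = f i c)"
       "\<forall>h :: bool \<Rightarrow> 'a \<Rightarrow> 'a. (\<forall>i. h i \<in> G \<and> (\<forall>c\<in>E. h i c = f' i c)) \<longrightarrow> (h True, h False) \<notin> N"
      using dense[of f, OF fiG finite_UnI[OF D1(1) D2(1)]] by (elim exE conjE)
    define Q where "Q = {h \<in> G. \<forall>x\<in>E. h x = f' True x} \<times> {h \<in> G. \<forall>x\<in>E. h x = f' False x}"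
    have "openin GG Q" unfolding Q_def using f'(1) by (intro openin_prod_Times_iff[THEN iffD2] disjI2 conjI openin_Aut_top_agree)
    moreover have "(f' True, f' False) \<in> Q" using f'(2) unfolding Q_def by auto
    moreover have "(f' True, f' False) \<in> GG closure_of N"
    proof -
      have "f' True \<in> U" using D1(2) f'(2) unfolding f_def by auto
      moreover have "f' False \<in> V" using D2(2) f'(2) unfolding f_def by auto
      ultimately show ?thesis using UV(5) op(2) by auto
    qed
    ultimately obtain h1 h2 where h: "(h1, h2) \<in> N" "(h1, h2) \<in> Q" unfolding in_closure_of by auto
    then have "\<forall>i. (if i then h1 else h2) \<in> G \<and> (\<forall>c\<in>E. (if i then h1 else h2) c = f' i c)"
      unfolding Q_def by auto
    then show False using f'(3)[THEN spec, of "\<lambda>i. if i then h1 else h2"] h(1) by simp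
  qed
qed

end

subsection \<open>Topological similarity classes\<close>


abbreviation pair :: "'b \<Rightarrow> 'b \<Rightarrow> bool \<Rightarrow> 'b" where
  "pair a b \<equiv> \<lambda>i. if i then a else b"

context QU begin

lemma gen2_eq_range_ev:
  assumes "g1 \<in> G" "g2 \<in> G"
  shows "gen2 g1 g2 = range (ev (pair g1 g2))"
proof
  let ?f = "pair g1 g2"
  have f: "?f i \<in> G" for i using assms by auto
  show "gen2 g1 g2 \<subseteq> range (ev ?f)"
  proof
    fix a assume "a \<in> gen2 g1 g2"
    then show "a \<in> range (ev ?f)"
    proof induction
      case gen2_id have "id = ev ?f []" by simp then show ?case by (rule range_eqI)
    next
      case gen2_g1 have "g1 = ev ?f [(True, True)]" by simp then show ?case by (rule range_eqI)
    next
      case gen2_g2 have "g2 = ev ?f [(False, True)]" by simp then show ?case by (rule range_eqI)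
    next
      case (gen2_comp a b)
      then obtain u w where "a = ev ?f u" "b = ev ?f w" by blast
      then have "a \<circ> b = ev ?f (w @ u)" by (simp add: ev_append)
      then show ?case by (rule range_eqI)
    next
      case (gen2_inv a)
      then obtain w where a: "a = ev ?f w" by blast
      have "\<exists>v. inv (ev ?f w) = ev ?f v" for w
      proof (induction w)
        case Nil have "inv (ev ?f []) = ev ?f []" by simp then show ?case by blast
      next
        case (Cons l w)
        then obtain v where v: "inv (ev ?f w) = ev ?f v" by blast
        define s where "s = (if snd l then ?f (fst l) else inv (?f (fst l)))"
        have s: "s \<in> G" "inv s = ev ?f [(fst l, \<not> snd l)]" unfolding s_def using f[of "fst l"] by auto
        have "inv (ev ?f (l # w)) = inv (ev ?f w \<circ> s)" by (simp add: s_def)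
        also have "\<dots> = inv s \<circ> inv (ev ?f w)"
          by (rule o_inv_distrib) (use ev_in_G[of ?f w] f s(1) Aut_bij in auto)
        also have "\<dots> = ev ?f (v @ [(fst l, \<not> snd l)])" unfolding v s(2) ev_append ..
        finally show ?case by blast
      qed
      then show ?case using a by blast
    qed
  qed
  have "ev ?f w \<in> gen2 g1 g2" for w
  proof (induction w)
    case Nil show ?case unfolding ev.simps by (rule gen2_id)
  next
    case (Cons l w)
    have "(if snd l then ?f (fst l) else inv (?f (fst l))) \<in> gen2 g1 g2"
      by (auto intro: gen2_g1 gen2_g2 gen2_inv)
    then show ?case unfolding ev.simps by (intro gen2_comp Cons)
  qed
  then show "range (ev ?f) \<subseteq> gen2 g1 g2" by blast
qed

lemma openin_fixing:
  assumes "finite D"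
  shows "openin (subtopology (Aut_top d lt) R) {h \<in> R \<inter> G. \<forall>x\<in>D. h x = x}"
proof -
  have "openin (Aut_top d lt) {h \<in> G. \<forall>x\<in>D. h x = id x}" by (rule openin_Aut_top_agree[OF assms])
  moreover have "{h \<in> R \<inter> G. \<forall>x\<in>D. h x = x} = {h \<in> G. \<forall>x\<in>D. h x = id x} \<inter> R" by auto
  ultimately show ?thesis unfolding openin_subtopology by blast
qed

lemma nbhd_id:
  assumes "openin (subtopology (Aut_top d lt) R) V" "id \<in> V"
  shows "\<exists>D. finite D \<and> {h \<in> R \<inter> G. \<forall>x\<in>D. h x = x} \<subseteq> V"
proof -
  obtain T where T: "openin (Aut_top d lt) T" "V = T \<inter> R" using assms(1) unfolding openin_subtopology by blast
  then obtain D where "finite D" "{h \<in> G. \<forall>x\<in>D. h x = id x} \<subseteq> T" using Aut_top_nbhd[OF T(1), of id] assms(2) by blast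
  then show ?thesis using T(2) by (intro exI[of _ D]) auto
qed

text \<open>Injectivity of the isomorphism gives the first statement. For the others only its
  behaviour at the identity counts: continuity there gives the second, openness the third.\<close>

lemma top_similar_words:
  assumes g: "g1 \<in> G" "g2 \<in> G" and f: "f1 \<in> G" "f2 \<in> G" and sim: "top_similar (Aut_top d lt) g1 g2 f1 f2"
  shows "ev (pair g1 g2) w = id \<longleftrightarrow> ev (pair f1 f2) w = id"
    "finite B \<Longrightarrow> \<exists>A. finite A \<and> (\<forall>w. (\<forall>a\<in>A. ev (pair g1 g2) w a = a) \<longrightarrow> (\<forall>b\<in>B. ev (pair f1 f2) w b = b))"
    "finite A \<Longrightarrow> \<exists>B. finite B \<and> (\<forall>w. (\<forall>b\<in>B. ev (pair f1 f2) w b = b) \<longrightarrow> (\<forall>a\<in>A. ev (pair g1 g2) w a = a))"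
proof -
  let ?g = "pair g1 g2" and ?f = "pair f1 f2"
  define Rg where "Rg = gen2 g1 g2"
  define Rf where "Rf = gen2 f1 f2"
  have R: "Rg = range (ev ?g)" "Rf = range (ev ?f)" unfolding Rg_def Rf_def using gen2_eq_range_ev f g by auto
  have gi: "?g i \<in> G" and fi: "?f i \<in> G" for i using g f by auto
  have RG: "Rg \<subseteq> G" "Rf \<subseteq> G" unfolding R using ev_in_G[of ?g] ev_in_G[of ?f] gi fi by auto
  obtain \<phi> where bij: "bij_betw \<phi> Rg Rf" and hom: "\<And>a b. a \<in> Rg \<Longrightarrow> b \<in> Rg \<Longrightarrow> \<phi> (a \<circ> b) = \<phi> a \<circ> \<phi> b"
    and gen: "\<phi> g1 = f1" "\<phi> g2 = f2"
    and homeo: "homeomorphic_map (subtopology (Aut_top d lt) Rg) (subtopology (Aut_top d lt) Rf) \<phi>"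
    using sim unfolding top_similar_def Rg_def Rf_def by blast
  have in_Rg: "ev ?g w \<in> Rg" "ev ?f w \<in> Rf" for w unfolding R by auto
  have \<phi>G: "\<phi> a \<in> G" if "a \<in> Rg" for a using bij that RG bij_betwE by blast
  have idR: "id \<in> Rg" using in_Rg(1)[of "[]"] by simp
  have \<phi>id: "\<phi> id = id"
  proof -
    have "\<phi> id (\<phi> id x) = \<phi> id x" for x using fun_cong[OF hom[OF idR idR], of x] by simp
    then have "\<phi> id x = x" for x using \<phi>G[OF idR] by (metis Aut_eq)
    then show ?thesis by auto
  qed
  have \<phi>inv: "\<phi> (inv a) = inv (\<phi> a)" if a: "a \<in> Rg" "inv a \<in> Rg" for a
  proof -
    have "inv a \<circ> a = id" using a RG Aut_bij by (auto simp: fun_eq_iff)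
    then have "\<phi> (inv a) \<circ> \<phi> a = id" using hom[OF a(2,1)] \<phi>id by simp
    moreover have "\<phi> a \<circ> inv (\<phi> a) = id" using \<phi>G[OF a(1)] by (auto simp: fun_eq_iff)
    ultimately show ?thesis by (metis comp_assoc comp_id id_comp)
  qed
  have letter: "\<phi> (if e then ?g i else inv (?g i)) = (if e then ?f i else inv (?f i)) \<and> (if e then ?g i else inv (?g i)) \<in> Rg" for i e
  proof -
    have "?g i \<in> Rg" unfolding Rg_def by (auto intro: gen2_g1 gen2_g2)
    moreover have "inv (?g i) \<in> Rg" using calculation unfolding Rg_def by (rule gen2_inv)
    moreover have "\<phi> (?g i) = ?f i" using gen by auto
    ultimately show ?thesis using \<phi>inv[of "?g i"] by (cases e) simp_all
  qed
  have ev: "\<phi> (ev ?g w) = ev ?f w" for w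
  proof (induction w)
    case Nil show ?case unfolding ev.simps by (rule \<phi>id)
  next
    case (Cons l w)
    have "\<phi> (ev ?g w \<circ> (if snd l then ?g (fst l) else inv (?g (fst l)))) =
        ev ?f w \<circ> (if snd l then ?f (fst l) else inv (?f (fst l)))"
      by (simp only: hom[OF in_Rg(1) letter[THEN conjunct2]] letter[THEN conjunct1] Cons)
    then show ?case unfolding ev.simps .
  qed
  have inj: "\<phi> a = \<phi> b \<Longrightarrow> a \<in> Rg \<Longrightarrow> b \<in> Rg \<Longrightarrow> a = b" for a b using bij unfolding bij_betw_def inj_on_def by blast
  show "ev ?g w = id \<longleftrightarrow> ev ?f w = id" using ev[of w] \<phi>id inj[OF _ in_Rg(1) idR, of w] by metis
  show "\<exists>A. finite A \<and> (\<forall>w. (\<forall>a\<in>A. ev ?g w a = a) \<longrightarrow> (\<forall>b\<in>B. ev ?f w b = b))" if "finite B"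
  proof -
    define V where "V = {h \<in> Rf \<inter> G. \<forall>x\<in>B. h x = x}"
    have "continuous_map (subtopology (Aut_top d lt) Rg) (subtopology (Aut_top d lt) Rf) \<phi>"
      by (rule homeomorphic_imp_continuous_map[OF homeo])
    then have "openin (subtopology (Aut_top d lt) Rg) {x \<in> topspace (subtopology (Aut_top d lt) Rg). \<phi> x \<in> V}"
      by (rule openin_continuous_map_preimage) (unfold V_def, rule openin_fixing[OF that])
    moreover have top: "topspace (subtopology (Aut_top d lt) Rg) = Rg" using RG by (auto simp: topspace_Aut_top)
    ultimately have "openin (subtopology (Aut_top d lt) Rg) {x \<in> Rg. \<phi> x \<in> V}" by (simp only: top)
    moreover have "id \<in> {x \<in> Rg. \<phi> x \<in> V}" using idR \<phi>id in_Rg(2)[of "[]"] unfolding V_def by simp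
    ultimately obtain A where A: "finite A" "{h \<in> Rg \<inter> G. \<forall>x\<in>A. h x = x} \<subseteq> {x \<in> Rg. \<phi> x \<in> V}"
      using nbhd_id[of Rg "{x \<in> Rg. \<phi> x \<in> V}"] by blast
    have "\<forall>b\<in>B. ev ?f w b = b" if "\<forall>a\<in>A. ev ?g w a = a" for w
    proof -
      have "ev ?g w \<in> {h \<in> Rg \<inter> G. \<forall>x\<in>A. h x = x}" using that in_Rg(1) RG by auto
      then have "\<phi> (ev ?g w) \<in> V" using A(2) by auto
      then show ?thesis unfolding ev V_def by simp
    qed
    then show ?thesis using A(1) by blast
  qed
  show "\<exists>B. finite B \<and> (\<forall>w. (\<forall>b\<in>B. ev ?f w b = b) \<longrightarrow> (\<forall>a\<in>A. ev ?g w a = a))" if "finite A"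
  proof -
    define V where "V = {h \<in> Rg \<inter> G. \<forall>x\<in>A. h x = x}"
    have "open_map (subtopology (Aut_top d lt) Rg) (subtopology (Aut_top d lt) Rf) \<phi>"
      by (rule homeomorphic_imp_open_map[OF homeo])
    then have "openin (subtopology (Aut_top d lt) Rf) (\<phi> ` V)"
      unfolding open_map_def V_def using openin_fixing[OF that] by blast
    moreover have "id \<in> \<phi> ` V" using idR \<phi>id unfolding V_def by (intro image_eqI[of _ _ id]) auto
    ultimately obtain B where B: "finite B" "{h \<in> Rf \<inter> G. \<forall>x\<in>B. h x = x} \<subseteq> \<phi> ` V"
      using nbhd_id[of Rf "\<phi> ` V"] by blast
    have "\<forall>a\<in>A. ev ?g w a = a" if "\<forall>b\<in>B. ev ?f w b = b" for w
    proof -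
      have "ev ?f w \<in> {h \<in> Rf \<inter> G. \<forall>x\<in>B. h x = x}" using that in_Rg(2) RG by auto
      then obtain h where h: "h \<in> V" "\<phi> (ev ?g w) = \<phi> h" using B(2) ev by auto
      then have "ev ?g w = h" using inj[OF h(2) in_Rg(1)] unfolding V_def by auto
      then show ?thesis using h(1) unfolding V_def by auto
    qed
    then show ?thesis using B(1) by blast
  qed
qed

lemma pair_eta: "pair (h True) (h False) = h"
  by (auto simp: fun_eq_iff)

section \<open>Nowhere dense sets covering a similarity class\<close>

lemma nowhere_dense_id: "nowhere_dense_in GG ({id} \<times> G)"
proof (rule nowhere_denseI)
  fix f :: "bool \<Rightarrow> 'a \<Rightarrow> 'a" and D :: "'a set" assume f: "\<And>i. f i \<in> G" and D: "finite D"
  obtain h x where h: "h \<in> G" "\<forall>c\<in>D. h c = f True c" "h x \<noteq> x" using extension_nontrivial[OF f[of True] D] by blast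
  have "(h' True, h' False) \<notin> {id} \<times> G" if "\<forall>i. h' i \<in> G \<and> (\<forall>c\<in>{x}. h' i c = (f(True := h)) i c)" for h'
    using that[rule_format, of True] h(3) by auto
  then show "\<exists>f' E. finite E \<and> (\<forall>i. f' i \<in> G \<and> (\<forall>c\<in>D. f' i c = f i c)) \<and>
        (\<forall>h. (\<forall>i. h i \<in> G \<and> (\<forall>c\<in>E. h i c = f' i c)) \<longrightarrow> (h True, h False) \<notin> {id} \<times> G)"
    using h(1,2) f by (intro exI[of _ "f(True := h)"] exI[of _ "{x}"]) auto
qed (use Aut_id in blast)

lemma nowhere_dense_unfixed:
  assumes B: "finite B"
  shows "nowhere_dense_in GG {(f1, f2) \<in> G \<times> G. \<forall>w. \<not> (\<forall>x\<in>B. f1 (ev (pair f1 f2) w x) = ev (pair f1 f2) w x)}"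
proof (rule nowhere_denseI)
  fix f :: "bool \<Rightarrow> 'a \<Rightarrow> 'a" and D :: "'a set" assume f: "\<And>i. f i \<in> G" and D: "finite D"
  obtain f' w where f': "\<forall>i. f' i \<in> G \<and> (\<forall>c\<in>D. f' i c = f i c)" "\<forall>x\<in>B. f' True (ev f' w x) = ev f' w x"
    using extension_fixing_image[of f, OF f D B] by blast
  have f'G: "f' i \<in> G" for i using f' by auto
  obtain H where H: "finite H" "\<And>h. (\<forall>i. h i \<in> G) \<Longrightarrow> (\<forall>i. \<forall>c\<in>H. h i c = f' i c) \<Longrightarrow> (\<forall>x\<in>B. ev h w x = ev f' w x)"
    using ev_continuous_finite[of f', OF f'G B, of w] by blast
  \<comment> \<open>\<open>H\<close> determines the images of \<open>B\<close> under
    \<open>w\<close>, and the values at these images force \<open>h True\<close> to fix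
    them.\<close>
  define E where "E = H \<union> ev f' w ` B"
  have "\<forall>x\<in>B. h True (ev h w x) = ev h w x" if h: "\<forall>i. h i \<in> G \<and> (\<forall>c\<in>E. h i c = f' i c)" for h
    using H(2)[of h] h f'(2) unfolding E_def by auto
  then show "\<exists>f' E. finite E \<and> (\<forall>i. f' i \<in> G \<and> (\<forall>c\<in>D. f' i c = f i c)) \<and>
        (\<forall>h. (\<forall>i. h i \<in> G \<and> (\<forall>c\<in>E. h i c = f' i c)) \<longrightarrow> (h True, h False) \<notin>
          {(f1, f2) \<in> G \<times> G. \<forall>w. \<not> (\<forall>x\<in>B. f1 (ev (pair f1 f2) w x) = ev (pair f1 f2) w x)})"
    using f'(1) H(1) B by (intro exI[of _ f'] exI[of _ E]) (auto simp: pair_eta E_def)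
qed auto

lemma nowhere_dense_convergent:
  assumes g: "\<And>i. g i \<in> G" and dense: "\<And>A. finite A \<Longrightarrow> \<exists>w. (\<forall>a\<in>A. ev g w a = a) \<and> ev g w \<noteq> id"
    and A: "finite A"
  shows "nowhere_dense_in GG {(f1, f2) \<in> G \<times> G. f1 x \<noteq> x \<and> (\<forall>w. (\<forall>a\<in>A. ev g w a = a) \<longrightarrow> ev (pair f1 f2) w x = x)}"
    (is "nowhere_dense_in GG ?N")
proof (rule nowhere_denseI)
  fix f :: "bool \<Rightarrow> 'a \<Rightarrow> 'a" and D :: "'a set" assume f: "\<And>i. f i \<in> G" and D: "finite D"
  show "\<exists>f' E. finite E \<and> (\<forall>i. f' i \<in> G \<and> (\<forall>c\<in>D. f' i c = f i c)) \<and>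
        (\<forall>h. (\<forall>i. h i \<in> G \<and> (\<forall>c\<in>E. h i c = f' i c)) \<longrightarrow> (h True, h False) \<notin> ?N)"
  proof (cases "f True x = x")
    case True
    then show ?thesis using f by (intro exI[of _ f] exI[of _ "{x}"]) auto
  next
    case False
    obtain f' w where f': "\<forall>i. f' i \<in> G \<and> (\<forall>c\<in>D. f' i c = f i c)" "\<forall>a\<in>A. ev g w a = a" "ev f' w x \<noteq> x"
      using extension_moving[of g f, OF g dense f False A D] by blast
    have f'G: "f' i \<in> G" for i using f' by auto
    obtain H where H: "finite H" "\<And>h. (\<forall>i. h i \<in> G) \<Longrightarrow> (\<forall>i. \<forall>c\<in>H. h i c = f' i c) \<Longrightarrow> ev h w x = ev f' w x"
      using ev_continuous[of f' w x, OF f'G] by blast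
    have "(h True, h False) \<notin> ?N" if h: "\<forall>i. h i \<in> G \<and> (\<forall>c\<in>H. h i c = f' i c)" for h
    proof -
      have "ev h w x \<noteq> x" using H(2)[of h] h f'(3) by auto
      then show ?thesis using f'(2) by (auto simp: pair_eta)
    qed
    then show ?thesis using f'(1) H(1) by blast
  qed
qed auto

end

theorem theorem5p6:
  fixes d :: "'a \<Rightarrow> 'a \<Rightarrow> rat" and lt :: "'a \<Rightarrow> 'a \<Rightarrow> bool"
  assumes "is_QU_prec d lt"
    and "g1 \<in> Aut d lt" and "g2 \<in> Aut d lt"
  shows "meager_in (prod_topology (Aut_top d lt) (Aut_top d lt))
           {(f1, f2). f1 \<in> Aut d lt \<and> f2 \<in> Aut d lt \<and> top_similar (Aut_top d lt) g1 g2 f1 f2}"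
proof -
  let ?C = "{(f1, f2). f1 \<in> Aut d lt \<and> f2 \<in> Aut d lt \<and> top_similar (Aut_top d lt) g1 g2 f1 f2}"
  interpret QU d lt by unfold_locales (rule assms(1))
  let ?g = "pair g1 g2"
  have g: "?g i \<in> G" for i using assms(2,3) by auto
  have cof: "countable {B :: 'a set. finite B}"
    using countable_Collect_finite_subset[OF countable_UNIV] by simp
  have cU: "countable (UNIV :: 'a set)" by (rule countable_UNIV)
  note words = top_similar_words[OF assms(2,3)]
  have C: "?C \<subseteq> topspace GG" by (auto simp: topspace_Aut_top)
  \<comment> \<open>The pointwise stabilizers of finite sets form a neighbourhood base at the
    identity, so the first case says that the group generated by \<open>g1\<close> and
    \<open>g2\<close> is not discrete.\<close>
  show ?thesis
  proof (cases "\<forall>A. finite A \<longrightarrow> (\<exists>w. (\<forall>a\<in>A. ev ?g w a = a) \<and> ev ?g w \<noteq> id)")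
    case True
    define N where "N x A = {(f1, f2) \<in> G \<times> G. f1 x \<noteq> x \<and> (\<forall>w. (\<forall>a\<in>A. ev ?g w a = a) \<longrightarrow> ev (pair f1 f2) w x = x)}" for x A
    define \<F> where "\<F> = insert ({id} \<times> G) ((\<lambda>(x, A). N x A) ` (UNIV \<times> {A. finite A}))"
    have "countable \<F>" unfolding \<F>_def using cof cU by (intro countable_insert countable_image countable_SIGMA) auto
    moreover have "nowhere_dense_in GG M" if "M \<in> \<F>" for M
      using that nowhere_dense_id nowhere_dense_convergent[of ?g, OF g] True unfolding \<F>_def N_def by auto
    moreover have "?C \<subseteq> \<Union>\<F>"
    proof
      fix F assume "F \<in> ?C"
      then obtain f1 f2 where F: "F = (f1, f2)" and f: "f1 \<in> G" "f2 \<in> G" and sim: "top_similar (Aut_top d lt) g1 g2 f1 f2" by auto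
      show "F \<in> \<Union>\<F>"
      proof (cases "f1 = id")
        case True then show ?thesis using f unfolding F \<F>_def by auto
      next
        case False
        then obtain x where x: "f1 x \<noteq> x" by (auto simp: fun_eq_iff)
        obtain A where "finite A" "\<forall>w. (\<forall>a\<in>A. ev ?g w a = a) \<longrightarrow> (\<forall>b\<in>{x}. ev (pair f1 f2) w b = b)"
          using words(2)[OF f sim, of "{x}"] by auto
        then have "F \<in> N x A" using f x unfolding F N_def by auto
        then show ?thesis using \<open>finite A\<close> unfolding \<F>_def by auto
      qed
    qed
    ultimately show ?thesis using C unfolding meager_in_def by blast
  next
    case False
    then obtain A where A: "finite A" "\<And>w. (\<forall>a\<in>A. ev ?g w a = a) \<Longrightarrow> ev ?g w = id" by blast
    define N where "N B = {(f1, f2) \<in> G \<times> G. \<forall>w. \<not> (\<forall>x\<in>B. f1 (ev (pair f1 f2) w x) = ev (pair f1 f2) w x)}" for B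
    define \<F> where "\<F> = insert ({id} \<times> G) (N ` {B. finite B})"
    have "countable \<F>" unfolding \<F>_def using cof by (intro countable_insert countable_image)
    moreover have "nowhere_dense_in GG M" if "M \<in> \<F>" for M
      using that nowhere_dense_id nowhere_dense_unfixed unfolding \<F>_def N_def by auto
    moreover have "?C \<subseteq> \<Union>\<F>"
    proof
      fix F assume "F \<in> ?C"
      then obtain f1 f2 where F: "F = (f1, f2)" and f: "f1 \<in> G" "f2 \<in> G" and sim: "top_similar (Aut_top d lt) g1 g2 f1 f2" by auto
      let ?f = "pair f1 f2"
      have fi: "?f i \<in> G" for i using f by auto
      show "F \<in> \<Union>\<F>"
      proof (cases "f1 = id")
        case True then show ?thesis using f unfolding F \<F>_def by auto
      next
        case False
        obtain B where B: "finite B" "\<forall>w. (\<forall>b\<in>B. ev ?f w b = b) \<longrightarrow> (\<forall>a\<in>A. ev ?g w a = a)"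
          using words(3)[OF f sim A(1)] by blast
        have "\<not> (\<forall>x\<in>B. f1 (ev ?f w x) = ev ?f w x)" for w
        proof
          assume *: "\<forall>x\<in>B. f1 (ev ?f w x) = ev ?f w x"
          have wG: "ev ?f w \<in> G" by (rule ev_in_G[OF fi])
          have "inv (ev ?f w) \<in> gen2 f1 f2" using gen2_inv gen2_eq_range_ev[OF f] by blast
          then obtain v where v: "inv (ev ?f w) = ev ?f v" unfolding gen2_eq_range_ev[OF f] by blast
          \<comment> \<open>\<open>u\<close> is \<open>f1\<close> conjugated by the word
            \<open>w\<close>. It fixes \<open>B\<close>, so its value at \<open>g\<close> fixes
            \<open>A\<close> and is trivial; then it is trivial at \<open>f\<close> as well, which
            forces \<open>f1 = id\<close>.\<close>
          define u where "u = w @ [(True, True)] @ v"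
          have u: "ev ?f u x = inv (ev ?f w) (f1 (ev ?f w x))" for x unfolding u_def ev_append v[symmetric] by simp
          have "\<forall>b\<in>B. ev ?f u b = b" using * u wG by simp
          then have "ev ?g u = id" using B(2) A(2) by blast
          then have "ev ?f u = id" using words(1)[OF f sim] by blast
          then have "inv (ev ?f w) (f1 (ev ?f w x)) = x" for x using u[of x] by simp
          then have "f1 (ev ?f w x) = ev ?f w x" for x using wG by (metis Aut_f_inv)
          then have "f1 y = y" for y using wG by (metis Aut_f_inv)
          then show False using False by auto
        qed
        then have "F \<in> N B" using f unfolding F N_def by auto
        then show ?thesis using B(1) unfolding \<F>_def by auto
      qed
    qed
    ultimately show ?thesis using C unfolding meager_in_def by blast
  qed
qed

end
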